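(* Suppose there exists a non-zero projection $\Pi_h$ onto $\mathcal{W}_h\cap C^1(\Omega)$. Let $$\Phi_h(\mathbf{p},\mathbf{q})=\Lambda(\mathbf{p},\mathbf{q})\,\mathbb{S}\big(\nabla_{h,p}\Pi_h\mathcal{E}(\mathbf{p}),\nabla_{h,q}\Pi_h\mathcal{E}(\mathbf{q})\big),$$ and let $f_h(\cdot,t)\in\mathcal{W}_h$ be a solution of the semi-discrete weak form $$\sum_R(\partial_t f_h,\varphi_h)_R+\sum_R(\nabla_h f_h,\mathcal{D}_h\cdot\nabla_h\varphi_h)_R=\sum_R(\mathcal{U}_hf_h,\nabla\varphi_h)_R-\sum_R\langle\widehat{\widehat{\mathcal{U}_hf_h}},\varphi_h^-\mathbf{n}^-\rangle_{\partial R\setminus\Gamma}\qquad\forall\varphi_h\in\mathcal{W}_h,$$ where $\mathcal{D}_h(\mathbf{p})=\int_\Omega\Phi_h(\mathbf{p},\mathbf{q})f_h(\mathbf{q})\,d\mathbf{q}$, $\mathcal{U}_h(\mathbf{p})=\int_\Omega\Phi_h(\mathbf{p},\mathbf{q})\cdot\nabla_{h,q}f_h(\mathbf{q})\,d\mathbf{q}$, and $\widehat{\widehat{\mathcal{U}_hf_h}}$ is the upwind flux. Then the following discrete conservation laws hold: $$\partial_t(f_h,\Pi_h1)_\Omega=0,\qquad\partial_t(f_h,\Pi_h\mathbf{p})_\Omega=0,\qquad\partial_t(f_h,\Pi_h\mathcal{E}(\mathbf{p}))_\Omega=0.$$ Moreover, the following $L^2$ stability relation holds: $$\tfrac12\partial_t(f_h,f_h)_\Omega+(\nabla_hf_h,\mathcal{D}_h\cdot\nabla_hf_h)_\Omega+\big(\tfrac12\nabla\cdot\mathcal{U}_h,f_h^2\big)_\Omega-\big\langle\tfrac12\mathcal{U}_h\cdot\mathbf{n}^-,(f_h^-)^2\big\rangle_\Gamma=-\sum_e\Big\langle\tfrac{|\mathcal{U}_h\cdot\mathbf{n}|}{2}[[f_h]],[[f_h]]\Big\rangle_e\le0,$$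 where the sum runs over all interior interfaces $e$, each counted once.
   Context: $\Omega\subset\mathbb{R}^3$ is a bounded domain with boundary $\Gamma=\partial\Omega$. $\mathcal{T}_h=\{R\}$ is a partition of $\Omega$ into Cartesian boxes or simplices. $\mathcal{W}_h=\{g\in L^2(\Omega): g|_R\in\mathbb{Q}^k(R)\ \forall R\in\mathcal{T}_h\}$, where $\mathbb{Q}^k(R)$ is the space of polynomials of degree at most $k$ in each variable, $k\ge2$. $(g,h)_R=\int_R gh\,d\mathbf{p}$ and $\langle g,h\rangle_e=\int_e gh\,ds$ (dot product for vector fields); $(\cdot,\cdot)_\Omega=\sum_R(\cdot,\cdot)_R$. $\nabla$ and $\nabla\cdot$ inside these products are taken elementwise. Kinetic energy: $\mathcal{E}(\mathbf{p})=|\mathbf{p}|^2/2$ (non-relativistic case) or $\mathcal{E}(\mathbf{p})=\sqrt{1+|\mathbf{p}|^2}$ (relativistic case). For $\mathbf{v},\mathbf{w}\in\mathbb{R}^3$, with $\mathbf{u}=\mathbf{v}-\mathbf{w}$ and $\mathbf{z}=(\mathbf{v}+\mathbf{w})/2$, the tensor is $\mathbb{S}(\mathbf{v},\mathbf{w})=|\mathbf{u}|^2I-\mathbf{u}\otimes\mathbf{u}$ (non-relativistic) or $\mathbb{S}(\mathbf{v},\mathbf{w})=|\mathbf{u}|^2I-\mathbf{u}\otimes\mathbf{u}-(\mathbf{z}\times\mathbf{u})\otimes(\mathbf{z}\times\mathbf{u})$ (relativistic). $\Lambda(\mathbf{p},\mathbf{q})=\Lambda(\mathbf{q},\mathbf{p})$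 is a given scalar field, regular enough that the integrals above make sense, that continuity of $\mathbb{S}(\nabla_{h,p}\Pi_h\mathcal{E}(\mathbf{p}),\nabla_{h,q}\Pi_h\mathcal{E}(\mathbf{q}))$ in $(\mathbf{p},\mathbf{q})$ yields continuity of $\mathcal{U}_h$, and that $\nabla\cdot\mathcal{U}_h$ and elementwise integration by parts make sense. $\Pi_h$ is a linear projection onto $\mathcal{W}_h\cap C^1(\Omega)$ (so $\Pi_hg=g$ for $g\in\mathcal{W}_h\cap C^1(\Omega)$), applied componentwise to $\mathbf{p}$, from a family satisfying the consistency conditions $\|\mathcal{E}-\Pi_h\mathcal{E}\|_{L^2(\Omega)}\to0$ as $h\to0$ and $\|\nabla\mathcal{E}-\nabla_h\Pi_h\mathcal{E}\|_{L^2(\Omega;e^{-p^2})}\to0$ as $h\to0$ and the size $r(\Omega)\to\infty$, where $h=\max_R\mathrm{diam}(R)$. Traces: in a boundary term over $\partial R$, superscript $-$ denotes the trace from inside $R$, $+$ the trace from the neighbouring element, $\mathbf{n}^-$ the unit outward normal to $\partial R$ ($\mathbf{n}^+=-\mathbf{n}^-$); on $\Gamma$, $\mathbf{n}^-$ is the outward normal to $\Omega$. In $\sum_R\langle\cdot,\cdot\rangle_{\partial R\setminus\Gamma}$ every interior interface is counted twice, once from each side. The jump across an interior interface is $[[g]]=g^+\mathbf{n}^++g^-\mathbf{n}^-$. The upwind flux on interior interfaces is $\widehat{\widehat{\mathcal{U}_hf_h}}\cdot\mathbf{n}^-=\mathcal{U}_hf_h^-\cdot\mathbf{n}^-$ if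 $\mathcal{U}_h\cdot\mathbf{n}^->0$ and $=\mathcal{U}_hf_h^+\cdot\mathbf{n}^-$ if $\mathcal{U}_h\cdot\mathbf{n}^-<0$ (and $0$ when $\mathcal{U}_h\cdot\mathbf{n}^-=0$). Fix a reference direction $\mathbf{u}_0\in\mathbb{R}^3$ (e.g. $(1,1,1)$) with $\mathbf{n}\cdot\mathbf{u}_0\neq0$ for the normal of every interior interface. For $g\in\mathcal{W}_h$ set $\check g=g^-$ if $\mathbf{n}^-\cdot\mathbf{u}_0<0$ or if the face lies on $\partial\Omega$, and $\check g=g^+$ otherwise. Discrete gradient: for $g_h\in\mathcal{W}_h$, $\nabla_h g_h\in\mathcal{W}_h^3$ is the unique element with $$\sum_R(\nabla_h g_h,V_h)_R=-\sum_R(g_h,\nabla\cdot V_h)_R+\sum_R\langle\check g_h,V_h^-\cdot\mathbf{n}^-\rangle_{\partial R}\quad\forall V_h\in\mathcal{W}_h^3;$$ $\nabla_{h,p},\nabla_{h,q}$ denote this operator acting in the variable $\mathbf{p}$, respectively $\mathbf{q}$. *)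

theory Defs
  imports "HOL-Analysis.Analysis"
begin

unbundle no cross3_syntax

datatype regime = Nonrelativistic | Relativistic

fun energy :: "regime \<Rightarrow> real^3 \<Rightarrow> real" where
  "energy Nonrelativistic p = (norm p)\<^sup>2 / 2"
| "energy Relativistic p = sqrt (1 + (norm p)\<^sup>2)"

definition outer :: "real^3 \<Rightarrow> real^3 \<Rightarrow> real^3^3" where
  "outer a b = (\<chi> i j. a $ i * b $ j)"

fun coll_tensor :: "regime \<Rightarrow> real^3 \<Rightarrow> real^3 \<Rightarrow> real^3^3" where
  "coll_tensor Nonrelativistic v w =
     (let u = v - w in (norm u)\<^sup>2 *\<^sub>R mat 1 - outer u u)"
| "coll_tensor Relativistic v w =
     (let u = v - w; z = (1/2) *\<^sub>R (v + w) in
        (norm u)\<^sup>2 *\<^sub>R mat 1 - outer u u - outer (cross3 z u) (cross3 z u))"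

definition grad :: "(real^3 \<Rightarrow> real) \<Rightarrow> real^3 \<Rightarrow> real^3" where
  "grad g x = (\<chi> i. frechet_derivative g (at x) (axis i 1))"

definition divergence :: "(real^3 \<Rightarrow> real^3) \<Rightarrow> real^3 \<Rightarrow> real" where
  "divergence V x = (\<Sum>i\<in>UNIV. frechet_derivative V (at x) (axis i 1) $ i)"

definition C1 :: "(real^3) set \<Rightarrow> (real^3 \<Rightarrow> real) set" where
  "C1 S = {g. (\<forall>x\<in>S. g differentiable (at x)) \<and> continuous_on S (grad g)}"

definition L2 :: "(real^3) set \<Rightarrow> (real^3 \<Rightarrow> real) set" where
  "L2 S = {g. g \<in> borel_measurable (lebesgue_on S) \<and> integrable (lebesgue_on S) (\<lambda>x. (g x)\<^sup>2)}"

definition Qpoly :: "nat \<Rightarrow> (real^3 \<Rightarrow> real) set" where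
  "Qpoly k = {P. \<exists>c. \<forall>x. P x =
     (\<Sum>i\<le>k. \<Sum>j\<le>k. \<Sum>l\<le>k. c i j l * (x $ 1) ^ i * (x $ 2) ^ j * (x $ 3) ^ l)}"

text \<open>
  A discretization bundles the domain, the set of (closed) mesh elements, the reference direction
  of the check flux, and the projection \<open>Proj\<close> together with the function space \<open>Pdom\<close> it acts on.
  Functions on the domain are represented by total functions whose values elsewhere are irrelevant.
\<close>

record discretization =
  Omega :: "(real^3) set"
  mesh :: "(real^3) set set"
  refdir :: "real^3"
  Pdom :: "(real^3 \<Rightarrow> real) set"
  Proj :: "(real^3 \<Rightarrow> real) \<Rightarrow> (real^3 \<Rightarrow> real)"

definition cartesian_box :: "(real^3) set \<Rightarrow> bool" where
  "cartesian_box R \<longleftrightarrow> (\<exists>a b. (\<forall>i. a $ i < b $ i) \<and> R = cbox a b)"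

text \<open>Hanging nodes are permitted: elements need not meet in full faces.\<close>

definition is_mesh :: "(real^3) set \<Rightarrow> (real^3) set set \<Rightarrow> bool" where
  "is_mesh \<Omega> T \<longleftrightarrow> finite T \<and>
     (\<forall>R\<in>T. (cartesian_box R \<or> 3 simplex R) \<and> interior R \<subseteq> \<Omega>) \<and>
     (\<forall>R\<in>T. \<forall>R'\<in>T. R \<noteq> R' \<longrightarrow> interior R \<inter> interior R' = {}) \<and>
     \<Union>T = closure \<Omega>"

definition mesh_size :: "discretization \<Rightarrow> real" where
  "mesh_size d = Max (diameter ` mesh d)"

text \<open>
  The pair \<open>(n, c)\<close> represents the facet of \<open>R\<close> in the plane \<open>n \<bullet> x = c\<close>, with \<open>n\<close> the unit outward
  normal.
\<close>

definition facets :: "(real^3) set \<Rightarrow> ((real^3) \<times> real) set" where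
  "facets R = {(n, c). norm n = 1 \<and> R \<subseteq> {x. n \<bullet> x \<le> c} \<and> (R \<inter> {x. n \<bullet> x = c}) facet_of R}"

text \<open>
  Surface measure on the plane \<open>n \<bullet> x = c\<close> with unit normal \<open>n\<close>: three-dimensional Lebesgue measure
  on the adjacent slab of thickness 1, pushed forward by orthogonal projection to the plane.
\<close>

definition plane_area :: "real^3 \<Rightarrow> real \<Rightarrow> (real^3) measure" where
  "plane_area n c =
     distr (restrict_space lborel {x. c \<le> n \<bullet> x \<and> n \<bullet> x \<le> c + 1}) borel
       (\<lambda>x. x - (n \<bullet> x - c) *\<^sub>R n)"

text \<open>
  Interior interfaces, seen from one side: \<open>(R, R', n, c)\<close> is the two-dimensional interface
  \<open>R \<inter> R' \<inter> Omega d\<close> viewed from \<open>R\<close> (the minus side), with neighbour \<open>R'\<close> (the plus side) and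
  normal \<open>n\<close> outward to \<open>R\<close>. Every interior interface occurs exactly twice, so a sum over
  \<open>oriented_faces d\<close> is the sum over all \<open>R\<close> of the integrals over the part of the boundary of \<open>R\<close>
  inside the domain.
\<close>

definition oriented_faces ::
    "discretization \<Rightarrow> ((real^3) set \<times> (real^3) set \<times> (real^3) \<times> real) set" where
  "oriented_faces d = {(R, R', n, c). R \<in> mesh d \<and> R' \<in> mesh d \<and> R \<noteq> R' \<and> (n, c) \<in> facets R \<and>
     R \<inter> R' \<subseteq> {x. n \<bullet> x = c} \<and> aff_dim (R \<inter> R' \<inter> Omega d) = 2}"

text \<open>
  Selects one of the two orientations of each interior interface, since no interface normal is
  orthogonal to the reference direction.
\<close>

definition interior_faces ::
    "discretization \<Rightarrow> ((real^3) set \<times> (real^3) set \<times> (real^3) \<times> real) set" where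
  "interior_faces d = {(R, R', n, c) \<in> oriented_faces d. n \<bullet> refdir d > 0}"

definition trace_in :: "(real^3) set \<Rightarrow> (real^3 \<Rightarrow> 'b::t2_space) \<Rightarrow> real^3 \<Rightarrow> 'b" where
  "trace_in R g x = Lim (at x within interior R) g"

definition face_integral ::
    "discretization \<Rightarrow> (real^3) set \<times> (real^3) set \<times> (real^3) \<times> real \<Rightarrow>
     ((real^3) set \<Rightarrow> (real^3) set \<Rightarrow> real^3 \<Rightarrow> real^3 \<Rightarrow> real) \<Rightarrow> real" where
  "face_integral d e w = (case e of (R, R', n, c) \<Rightarrow>
     (LINT x:(R \<inter> R' \<inter> Omega d)|plane_area n c. w R R' n x))"

text \<open>Integral over the boundary of the domain, assembled from the elements touching it.\<close>

definition Gamma_integral ::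
    "discretization \<Rightarrow> ((real^3) set \<Rightarrow> real^3 \<Rightarrow> real^3 \<Rightarrow> real) \<Rightarrow> real" where
  "Gamma_integral d w = (\<Sum>R\<in>mesh d. \<Sum>(n, c)\<in>facets R.
     (LINT x:(R \<inter> {x. n \<bullet> x = c} \<inter> frontier (Omega d))|plane_area n c. w R n x))"

definition ip :: "discretization \<Rightarrow> (real^3 \<Rightarrow> 'b::euclidean_space) \<Rightarrow> (real^3 \<Rightarrow> 'b) \<Rightarrow> real" where
  "ip d g h = (\<Sum>R\<in>mesh d. (LINT x:R|lebesgue. g x \<bullet> h x))"

text \<open>
  Members of the broken polynomial space are taken to be polynomial on the whole interior of each
  element (not just almost everywhere); their values on the mesh skeleton are unconstrained.
\<close>

definition Wh :: "nat \<Rightarrow> discretization \<Rightarrow> (real^3 \<Rightarrow> real) set" where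
  "Wh k d = {g. g \<in> L2 (Omega d) \<and> (\<forall>R\<in>mesh d. \<exists>P\<in>Qpoly k. \<forall>x\<in>interior R. g x = P x)}"

definition Wh3 :: "nat \<Rightarrow> discretization \<Rightarrow> (real^3 \<Rightarrow> real^3) set" where
  "Wh3 k d = {V. \<forall>i. (\<lambda>x. V x $ i) \<in> Wh k d}"

definition check_flux ::
    "discretization \<Rightarrow> (real^3 \<Rightarrow> real) \<Rightarrow> (real^3) set \<Rightarrow> (real^3) set \<Rightarrow> real^3 \<Rightarrow> real^3 \<Rightarrow> real" where
  "check_flux d g R R' n x = (if n \<bullet> refdir d < 0 then trace_in R g x else trace_in R' g x)"

definition is_discrete_gradient ::
    "nat \<Rightarrow> discretization \<Rightarrow> (real^3 \<Rightarrow> real) \<Rightarrow> (real^3 \<Rightarrow> real^3) \<Rightarrow> bool" where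
  "is_discrete_gradient k d g G \<longleftrightarrow> G \<in> Wh3 k d \<and>
     (\<forall>V\<in>Wh3 k d. ip d G V =
        - ip d g (divergence V)
        + ((\<Sum>e\<in>oriented_faces d. face_integral d e
              (\<lambda>R R' n x. check_flux d g R R' n x * (trace_in R V x \<bullet> n)))
           + Gamma_integral d (\<lambda>R n x. trace_in R g x * (trace_in R V x \<bullet> n))))"

text \<open>
  The discrete gradient is unique only up to its values on the mesh skeleton. Taking the limit from
  the element interiors fixes the representative: inside elements it is the polynomial itself, and on
  the skeleton it is the continuous extension wherever one exists.
\<close>

definition dgrad :: "nat \<Rightarrow> discretization \<Rightarrow> (real^3 \<Rightarrow> real) \<Rightarrow> real^3 \<Rightarrow> real^3" where
  "dgrad k d g x =
     Lim (at x within (\<Union>R\<in>mesh d. interior R)) (SOME G. is_discrete_gradient k d g G)"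

definition linear_projection_onto ::
    "(real^3) set \<Rightarrow> (real^3 \<Rightarrow> real) set \<Rightarrow> (real^3 \<Rightarrow> real) set \<Rightarrow>
     ((real^3 \<Rightarrow> real) \<Rightarrow> (real^3 \<Rightarrow> real)) \<Rightarrow> bool" where
  "linear_projection_onto \<Omega> X V P \<longleftrightarrow>
     V \<subseteq> X \<and>
     (\<forall>g\<in>X. \<forall>h\<in>X. \<forall>a b. (\<lambda>x. a * g x + b * h x) \<in> X \<and>
        (\<forall>x\<in>\<Omega>. P (\<lambda>x. a * g x + b * h x) x = a * P g x + b * P h x)) \<and>
     (\<forall>g\<in>X. P g \<in> V) \<and>
     (\<forall>g\<in>V. \<forall>x\<in>\<Omega>. P g x = g x)"

definition admissible :: "nat \<Rightarrow> regime \<Rightarrow> discretization \<Rightarrow> bool" where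
  "admissible k rg d \<longleftrightarrow>
     open (Omega d) \<and> connected (Omega d) \<and> Omega d \<noteq> {} \<and> bounded (Omega d) \<and>
     is_mesh (Omega d) (mesh d) \<and>
     (\<forall>(R, R', n, c)\<in>oriented_faces d. n \<bullet> refdir d \<noteq> 0) \<and>
     energy rg \<in> Pdom d \<and>
     linear_projection_onto (Omega d) (Pdom d) (Wh k d \<inter> C1 (Omega d)) (Proj d) \<and>
     (\<exists>g\<in>Pdom d. \<exists>x\<in>Omega d. Proj d g x \<noteq> 0)"

text \<open>
  Consistency of a family \<open>F\<close>; \<open>r\<close> measures the size of a domain. The first limit is taken for each
  fixed domain.
\<close>

definition consistent_family ::
    "nat \<Rightarrow> regime \<Rightarrow> ((real^3) set \<Rightarrow> real) \<Rightarrow> discretization set \<Rightarrow> bool" where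
  "consistent_family k rg r F \<longleftrightarrow>
     (\<forall>\<Omega>. ((\<lambda>d. sqrt (LINT x:\<Omega>|lebesgue. (energy rg x - Proj d (energy rg) x)\<^sup>2)) \<longlongrightarrow> 0)
            (inf (filtercomap mesh_size (at_right 0)) (principal {d\<in>F. Omega d = \<Omega>}))) \<and>
     ((\<lambda>d. sqrt (LINT x:Omega d|lebesgue.
               (norm (grad (energy rg) x - dgrad k d (Proj d (energy rg)) x))\<^sup>2 * exp (- (norm x)\<^sup>2)))
        \<longlongrightarrow> 0)
       (inf (inf (filtercomap mesh_size (at_right 0)) (filtercomap (\<lambda>d. r (Omega d)) at_top))
            (principal F))"

definition Phi_h ::
    "nat \<Rightarrow> regime \<Rightarrow> discretization \<Rightarrow> (real^3 \<Rightarrow> real^3 \<Rightarrow> real) \<Rightarrow> real^3 \<Rightarrow> real^3 \<Rightarrow> real^3^3" where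
  "Phi_h k rg d \<Lambda> p q = \<Lambda> p q *\<^sub>R
     coll_tensor rg (dgrad k d (Proj d (energy rg)) p) (dgrad k d (Proj d (energy rg)) q)"

definition D_h ::
    "nat \<Rightarrow> regime \<Rightarrow> discretization \<Rightarrow> (real^3 \<Rightarrow> real^3 \<Rightarrow> real) \<Rightarrow> (real^3 \<Rightarrow> real) \<Rightarrow>
     real^3 \<Rightarrow> real^3^3" where
  "D_h k rg d \<Lambda> g p = (LINT q:Omega d|lebesgue. g q *\<^sub>R Phi_h k rg d \<Lambda> p q)"

definition U_h ::
    "nat \<Rightarrow> regime \<Rightarrow> discretization \<Rightarrow> (real^3 \<Rightarrow> real^3 \<Rightarrow> real) \<Rightarrow> (real^3 \<Rightarrow> real) \<Rightarrow>
     real^3 \<Rightarrow> real^3" where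
  "U_h k rg d \<Lambda> g p = (LINT q:Omega d|lebesgue. Phi_h k rg d \<Lambda> p q *v dgrad k d g q)"

text \<open>
  The symmetry and regularity required of \<open>\<Lambda>\<close>: (absolute) integrability of the kernel in \<open>q\<close> and
  jointly; continuity of the drift \<open>U_h\<close> whenever the collision tensor is continuous; and, in each
  element, a drift that is continuously differentiable inside, extends continuously to the
  boundary, and has integrable divergence.
\<close>

definition regular_kernel ::
    "nat \<Rightarrow> regime \<Rightarrow> discretization \<Rightarrow> (real^3 \<Rightarrow> real^3 \<Rightarrow> real) \<Rightarrow> bool" where
  "regular_kernel k rg d \<Lambda> \<longleftrightarrow>
     (\<forall>p\<in>Omega d. \<forall>q\<in>Omega d. \<Lambda> p q = \<Lambda> q p) \<and>
     (\<forall>p\<in>Omega d. set_integrable lebesgue (Omega d) (Phi_h k rg d \<Lambda> p)) \<and>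
     set_integrable (lebesgue \<Otimes>\<^sub>M lebesgue) (Omega d \<times> Omega d) (\<lambda>(p, q). Phi_h k rg d \<Lambda> p q) \<and>
     (\<forall>g\<in>Wh k d.
        (continuous_on (Omega d \<times> Omega d) (\<lambda>(p, q).
             coll_tensor rg (dgrad k d (Proj d (energy rg)) p) (dgrad k d (Proj d (energy rg)) q))
           \<longrightarrow> continuous_on (Omega d) (U_h k rg d \<Lambda> g)) \<and>
        (\<forall>R\<in>mesh d.
           (\<forall>i. (\<lambda>x. U_h k rg d \<Lambda> g x $ i) \<in> C1 (interior R)) \<and>
           (\<forall>x\<in>R. \<exists>l. (U_h k rg d \<Lambda> g \<longlongrightarrow> l) (at x within interior R)) \<and>
           set_integrable lebesgue R (divergence (U_h k rg d \<Lambda> g))))"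

text \<open>Normal component of the upwind flux of \<open>U f\<close>, where \<open>un\<close> is \<open>U \<bullet> n\<close> for the normal \<open>n\<close>
  pointing from the minus side to the plus side.\<close>

definition upwind :: "real \<Rightarrow> real \<Rightarrow> real \<Rightarrow> real" where
  "upwind un fm fp = (if un > 0 then un * fm else if un < 0 then un * fp else 0)"

definition time_deriv :: "real set \<Rightarrow> (real \<Rightarrow> real^3 \<Rightarrow> real) \<Rightarrow> real \<Rightarrow> real^3 \<Rightarrow> real" where
  "time_deriv I f t x = vector_derivative (\<lambda>s. f s x) (at t within I)"

definition weak_solution ::
    "nat \<Rightarrow> regime \<Rightarrow> discretization \<Rightarrow> (real^3 \<Rightarrow> real^3 \<Rightarrow> real) \<Rightarrow> real set \<Rightarrow>
     (real \<Rightarrow> real^3 \<Rightarrow> real) \<Rightarrow> bool" where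
  "weak_solution k rg d \<Lambda> I f \<longleftrightarrow>
     (\<forall>t\<in>I. f t \<in> Wh k d) \<and>
     (\<forall>t\<in>I. \<forall>R\<in>mesh d. \<forall>x\<in>interior R. (\<lambda>s. f s x) differentiable (at t within I)) \<and>
     (\<forall>t\<in>I. \<forall>\<phi>\<in>Wh k d.
        ip d (time_deriv I f t) \<phi>
        + ip d (dgrad k d (f t)) (\<lambda>p. D_h k rg d \<Lambda> (f t) p *v dgrad k d \<phi> p)
        = ip d (\<lambda>p. f t p *\<^sub>R U_h k rg d \<Lambda> (f t) p) (grad \<phi>)
          - (\<Sum>e\<in>oriented_faces d. face_integral d e (\<lambda>R R' n x.
               upwind (U_h k rg d \<Lambda> (f t) x \<bullet> n) (trace_in R (f t) x) (trace_in R' (f t) x)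
               * trace_in R \<phi> x)))"

text \<open>The normals are \<open>n\<close> on the side of \<open>R\<close> and \<open>- n\<close> on the side of \<open>R'\<close>.\<close>

definition jump ::
    "(real^3 \<Rightarrow> real) \<Rightarrow> (real^3) set \<Rightarrow> (real^3) set \<Rightarrow> real^3 \<Rightarrow> real^3 \<Rightarrow> real^3" where
  "jump g R R' n x = trace_in R' g x *\<^sub>R (- n) + trace_in R g x *\<^sub>R n"

end

theory Submission
  imports Defs
begin

text \<open>
  Three facts carry the theorem. First, the divergence theorem holds on every mesh element for fields
  that are continuously differentiable inside and continuous up to the boundary: on almost every line
  in a coordinate direction the fundamental theorem of calculus sees exactly one entry and one exit
  facet, and shrinking the element towards an interior point removes the need for smoothness at the
  boundary. Facet integrals then split into interior interfaces, each seen from both sides, and the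
  part on the boundary of the domain. Second, the elementwise gradient of a function in the broken
  space that is continuously differentiable on the domain satisfies the equation of the discrete
  gradient. Hence the invariants \<open>1\<close>, \<open>p\<close> and the projected energy have discrete gradients
  \<open>0\<close>, the unit vectors, and the very argument of the collision tensor, whose kernel contains the
  difference of its two arguments; exchanging the integration variables makes diffusion and drift
  cancel, while single-valued test functions kill the upwind flux. Third, testing with the solution
  itself and integrating \<open>U \<bullet> grad (f\<^sup>2 / 2)\<close> by parts leaves on each interface a quadratic form in the
  two traces which equals minus half the absolute normal drift times the squared jump.
\<close>

subsection \<open>Area measure on planes\<close>

text \<open>Some objects are accessible only indirectly, and this shapes the proof. The area on a
  plane is the push-forward of a slab along the normal, whereas the fundamental theorem runs along
  coordinate lines; a volume-preserving shear tilts one projection into the other.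
  \<open>dgrad\<close> is a limit of a field picked by \<open>SOME\<close>, so nothing about it is
  available before existence and uniqueness; as test fields may be chosen separately on each
  element, existence reduces to one Gram system per element. The time derivative is given pointwise
  inside elements and reaches the integrals through finitely many point values.

  The equation of the discrete gradient fixes it only off the mesh skeleton, but the tensor has to
  be continuous on the whole domain. Here the C1 property of the projected energy enters: its
  \<open>dgrad\<close> is the classical gradient at every point of the domain, so the drift has one
  value at each point of an interface.

  Since a non-existing integral has the value 0, splittings and exchanges of integrals come with
  integrability statements.\<close>

lemma integral_line_average:
  fixes K :: "'a::euclidean_space \<Rightarrow> real"
  assumes e: "norm e = 1" and K: "integrable lborel K"
  shows "integral\<^sup>L lborel K =
    (\<integral>x. indicator {x. 0 \<le> e \<bullet> x \<and> e \<bullet> x \<le> 1} x * (\<integral>s. K (x + s *\<^sub>R e) \<partial>lborel) \<partial>lborel)"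
proof -
  define G :: "'a \<Rightarrow> real" where "G = indicator {x. 0 \<le> e \<bullet> x \<and> e \<bullet> x \<le> 1}"
  have ee: "e \<bullet> e = 1" using e by (simp add: dot_square_norm)
  have Gm[measurable]: "G \<in> borel_measurable borel" unfolding G_def by measurable
  have Km[measurable]: "K \<in> borel_measurable borel" using K by auto
  \<comment> \<open>As a function of \<open>s\<close> the slab indicator at \<open>x - s e\<close>
    is the indicator of an interval of length 1, whatever \<open>x\<close> is. Its integral 1 is
    inserted into the integral of \<open>K\<close>; exchanging the order and translating by
    \<open>s e\<close> gives the claim.\<close>
  have Gs: "G (x - s *\<^sub>R e) = indicator {e \<bullet> x - 1 .. e \<bullet> x} s" for x s
    by (auto simp: G_def indicator_def inner_diff_right ee)
  have FI: "integrable (lborel \<Otimes>\<^sub>M lborel) (\<lambda>(x,s). K x * G (x - s *\<^sub>R e))"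
  proof (rule lborel_pair.Fubini_integrable)
    show "integrable lborel (\<lambda>x. \<integral> y. norm (case (x, y) of (x,s) \<Rightarrow> K x * G (x - s *\<^sub>R e)) \<partial>lborel)"
      using K by (simp add: Gs abs_mult)
    show "AE x in lborel. integrable lborel (\<lambda>y. case (x, y) of (x,s) \<Rightarrow> K x * G (x - s *\<^sub>R e))"
      by (simp add: Gs)
  qed measurable
  have sh: "(\<integral>x. h (x + s *\<^sub>R e) \<partial>lborel) = integral\<^sup>L lborel h"
    if [measurable]: "h \<in> borel_measurable borel" for h :: "'a \<Rightarrow> real" and s
    by (subst (2) lborel_distr_plus[symmetric, of "s *\<^sub>R e"], subst integral_distr)
       (auto simp: add.commute)
  have shi: "integrable lborel (\<lambda>x. h (x + s *\<^sub>R e))"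
    if "integrable lborel h" for h :: "'a \<Rightarrow> real" and s
  proof -
    have "integrable (distr lborel borel ((+) (s *\<^sub>R e))) h"
      using that by (simp add: lborel_distr_plus)
    then show ?thesis using that by (subst (asm) integrable_distr_eq) (auto simp: add.commute)
  qed
  have swap: "(\<integral>x. K x * G (x - s *\<^sub>R e) \<partial>lborel) = (\<integral>x. K (x + s *\<^sub>R e) * G x \<partial>lborel)" for s
    by (subst sh[where s=s, symmetric]) auto
  \<comment> \<open>The translation depends on \<open>s\<close>, so the exchange back is a new
    application of Fubini; its integrability follows because the translation leaves the inner
    integrals of the norms unchanged.\<close>
  have FJ: "integrable (lborel \<Otimes>\<^sub>M lborel) (\<lambda>(s,x). K (x + s *\<^sub>R e) * G x)"
  proof (rule lborel_pair.Fubini_integrable)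
    have "integrable lborel (\<lambda>s. \<integral>x. norm (K x * G (x - s *\<^sub>R e)) \<partial>lborel)"
      using lborel_pair.integrable_snd[of "\<lambda>x s. norm (K x * G (x - s *\<^sub>R e))"]
        integrable_norm[OF FI] by (simp add: split_beta')
    also have "(\<lambda>s. \<integral>x. norm (K x * G (x - s *\<^sub>R e)) \<partial>lborel) =
       (\<lambda>s. \<integral>x. norm (K (x + s *\<^sub>R e) * G x) \<partial>lborel)"
    proof
      fix s
      show "(\<integral>x. norm (K x * G (x - s *\<^sub>R e)) \<partial>lborel) = (\<integral>x. norm (K (x + s *\<^sub>R e) * G x) \<partial>lborel)"
        by (subst sh[where s=s, symmetric]) (auto simp:)
    qed
    finally show "integrable lborel (\<lambda>x. \<integral>y. norm (case (x, y) of (s,x) \<Rightarrow> K (x + s *\<^sub>R e) * G x) \<partial>lborel)"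
      by simp
    have "integrable lborel (\<lambda>x. K (x + s *\<^sub>R e) * G x)" for s
      using shi[OF K, of s]
      by (rule Bochner_Integration.integrable_bound) (auto simp: G_def indicator_def)
    then show "AE s in lborel. integrable lborel (\<lambda>y. case (s, y) of (s,x) \<Rightarrow> K (x + s *\<^sub>R e) * G x)"
      by simp
  qed measurable
  have "integral\<^sup>L lborel K = (\<integral>x. (\<integral>s. K x * G (x - s *\<^sub>R e) \<partial>lborel) \<partial>lborel)"
    by (simp add: Gs)
  also have "\<dots> = (\<integral>s. (\<integral>x. K x * G (x - s *\<^sub>R e) \<partial>lborel) \<partial>lborel)"
    using lborel_pair.Fubini_integral[of "\<lambda>x s. K x * G (x - s *\<^sub>R e)"] FI by simp
  also have "\<dots> = (\<integral>s. (\<integral>x. K (x + s *\<^sub>R e) * G x \<partial>lborel) \<partial>lborel)"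
    by (simp only: swap)
  also have "\<dots> = (\<integral>x. (\<integral>s. K (x + s *\<^sub>R e) * G x \<partial>lborel) \<partial>lborel)"
    using lborel_pair.Fubini_integral[of "\<lambda>s x. K (x + s *\<^sub>R e) * G x"] FJ by simp
  finally show ?thesis by (simp add: G_def mult.commute)
qed

text \<open>The identity plus the rank-one map with factors \<open>n\<close> and \<open>w\<close>
  has determinant 1 + n . w = 1, and its inverse is the same map with \<open>- w\<close>. This turns
  projection along the normal into projection along any transversal direction.\<close>

lemma lborel_distr_shear:
  fixes n w :: "real^3"
  assumes nw: "n \<bullet> w = 0"
  shows "distr lborel borel (\<lambda>x. x + (n \<bullet> x) *\<^sub>R w) = lborel"
proof (rule lborel_eqI[symmetric])
  fix l u :: "real^3"
  assume lu: "\<And>b. b \<in> Basis \<Longrightarrow> l \<bullet> b \<le> u \<bullet> b"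
  let ?T = "\<lambda>x. x + (n \<bullet> x) *\<^sub>R w" and ?T' = "\<lambda>x. x + (n \<bullet> x) *\<^sub>R (- w)"
  have inv: "?T -` S = ?T' ` S" for S
  proof safe
    fix x assume "?T x \<in> S"
    moreover have "?T' (?T x) = x" using nw by (simp add: inner_add_right)
    ultimately show "x \<in> ?T' ` S" by (intro image_eqI[of _ _ "?T x"]) simp_all
  next
    fix x assume "x \<in> S"
    moreover have "?T (?T' x) = x" using nw by (simp add: inner_add_right inner_diff_right)
    ultimately show "?T' x \<in> ?T -` S" by (simp only: vimage_def mem_Collect_eq)
  qed
  have lin: "linear ?T'"
    by (rule linearI) (auto simp: algebra_simps inner_add_right)
  have det: "det (matrix ?T') = 1"
  proof -
    have "n$1*w$1 + n$2*w$2 + n$3*w$3 = 0"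
      using nw by (simp add: inner_vec_def sum_3)
    then show ?thesis
      unfolding det_3 matrix_def
      by (simp add: axis_def inner_vec_def sum_3) algebra
  qed
  have "emeasure (distr lborel borel ?T) (box l u) = emeasure lborel (?T' ` box l u)"
    by (subst emeasure_distr) (auto simp: inv)
  also have "\<dots> = emeasure lebesgue (?T' ` box l u)"
  proof -
    have "?T' ` box l u \<in> sets borel"
      unfolding inv[symmetric]
      using measurable_sets[of ?T borel borel "box l u"] by simp
    then show ?thesis by simp
  qed
  also have "\<dots> = ennreal (measure lebesgue (?T' ` box l u))"
    using measurable_linear_image[OF lin, of "box l u"]
    by (intro emeasure_eq_measure2) (auto simp: fmeasurableD2)
  also have "\<dots> = ennreal (measure lebesgue (box l u))"
    by (subst measure_linear_image[OF lin]) (simp_all only: det abs_one mult_1 lmeasurable_box)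
  also have "\<dots> = (\<Prod>b\<in>Basis. (u - l) \<bullet> b)"
    using lu by (simp add: measure_lborel_box_eq)
  finally show "emeasure (distr lborel borel ?T) (box l u) = ennreal (\<Prod>b\<in>Basis. (u - l) \<bullet> b)" .
qed simp

lemma sets_plane_area [simp, measurable_cong]: "sets (plane_area n c) = sets borel"
  by (simp add: plane_area_def)

lemma space_plane_area [simp]: "space (plane_area n c) = UNIV"
  by (simp add: plane_area_def)

lemma closed_slab: "closed {x::'a::real_inner. a \<le> n \<bullet> x \<and> n \<bullet> x \<le> b}"
proof -
  have "{x. a \<le> n \<bullet> x \<and> n \<bullet> x \<le> b} = {x. n \<bullet> x \<ge> a} \<inter> {x. n \<bullet> x \<le> b}" by auto
  then show ?thesis by (simp add: closed_Int closed_halfspace_le closed_halfspace_ge)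
qed

lemma integral_plane_area:
  fixes \<phi> :: "real^3 \<Rightarrow> real"
  assumes [measurable]: "\<phi> \<in> borel_measurable borel"
  shows "integral\<^sup>L (plane_area n c) \<phi> =
    (\<integral>x. indicator {x. c \<le> n \<bullet> x \<and> n \<bullet> x \<le> c + 1} x * \<phi> (x - (n \<bullet> x - c) *\<^sub>R n) \<partial>lborel)"
proof -
  let ?S = "{x. c \<le> n \<bullet> x \<and> n \<bullet> x \<le> c + 1}"
  have S: "?S \<in> sets borel" using closed_slab by (blast intro: borel_closed)
  have "integral\<^sup>L (plane_area n c) \<phi> = (\<integral>x. \<phi> (x - (n \<bullet> x - c) *\<^sub>R n) \<partial>restrict_space lborel ?S)"
    unfolding plane_area_def
    by (rule integral_distr) (auto intro!: measurable_restrict_space1)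
  also have "\<dots> = (\<integral>x. indicator ?S x * \<phi> (x - (n \<bullet> x - c) *\<^sub>R n) \<partial>lborel)"
    using S by (subst integral_restrict_space) auto
  finally show ?thesis .
qed

lemma emeasure_plane_area:
  assumes [measurable]: "A \<in> sets borel"
  shows "emeasure (plane_area n c) A =
    emeasure lborel {x. c \<le> n \<bullet> x \<and> n \<bullet> x \<le> c + 1 \<and> x - (n \<bullet> x - c) *\<^sub>R n \<in> A}"
proof -
  let ?S = "{x. c \<le> n \<bullet> x \<and> n \<bullet> x \<le> c + 1}"
  have S: "?S \<in> sets borel" using closed_slab by (blast intro: borel_closed)
  have "emeasure (plane_area n c) A =
     emeasure (restrict_space lborel ?S) ((\<lambda>x. x - (n \<bullet> x - c) *\<^sub>R n) -` A \<inter> space (restrict_space lborel ?S))"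
    unfolding plane_area_def
    by (rule emeasure_distr) (auto intro!: measurable_restrict_space1)
  also have "\<dots> = emeasure lborel ((\<lambda>x. x - (n \<bullet> x - c) *\<^sub>R n) -` A \<inter> ?S)"
    using S by (subst emeasure_restrict_space) (auto simp: space_restrict_space)
  also have "(\<lambda>x. x - (n \<bullet> x - c) *\<^sub>R n) -` A \<inter> ?S = 
     {x. c \<le> n \<bullet> x \<and> n \<bullet> x \<le> c + 1 \<and> x - (n \<bullet> x - c) *\<^sub>R n \<in> A}" by auto
  finally show ?thesis .
qed

text \<open>The slab in \<open>plane_area\<close> lies on the side to which the normal points.
  Reversing the normal gives the slab on the other side, a translate by a unit normal, and the
  projection to the plane does not see this translation. The two sides of an interface therefore
  share one measure.\<close>

lemma plane_area_minus:
  assumes n: "norm n = 1"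
  shows "plane_area (- n) (- c) = plane_area n c"
proof (rule measure_eqI)
  fix A assume "A \<in> sets (plane_area (- n) (- c))"
  then have [measurable]: "A \<in> sets borel" by simp
  have nn: "n \<bullet> n = 1" using n by (simp add: dot_square_norm)
  let ?P = "{x. c \<le> n \<bullet> x \<and> n \<bullet> x \<le> c + 1 \<and> x - (n \<bullet> x - c) *\<^sub>R n \<in> A}"
  have [measurable]: "?P \<in> sets borel" by measurable
  have "emeasure (plane_area n c) A = emeasure (distr lborel borel ((+) n)) ?P"
    by (simp add: emeasure_plane_area lborel_distr_plus)
  also have "\<dots> = emeasure lborel ((+) n -` ?P)"
    by (subst emeasure_distr) auto
  also have "(+) n -` ?P = {x. - c \<le> - n \<bullet> x \<and> - n \<bullet> x \<le> - c + 1 \<and> x - (- n \<bullet> x - - c) *\<^sub>R (- n) \<in> A}"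
    by (auto simp: inner_add_right nn algebra_simps)
  finally show "emeasure (plane_area (- n) (- c)) A = emeasure (plane_area n c) A"
    by (simp add: emeasure_plane_area)
qed simp

lemma emeasure_plane_area_bounded:
  assumes n: "norm n = 1" and A: "A \<in> sets borel" "bounded A"
  shows "emeasure (plane_area n c) A < \<infinity>"
proof -
  obtain B where B: "\<And>x. x \<in> A \<Longrightarrow> norm x \<le> B" using A(2) by (auto simp: bounded_iff)
  \<comment> \<open>Slab points that project into \<open>A\<close> are within distance 1 of
    \<open>A\<close>, hence the radius \<open>B + 1\<close>.\<close>
  have "emeasure (plane_area n c) A \<le> emeasure lborel (cball (0::real^3) (B + 1))"
    unfolding emeasure_plane_area[OF A(1)]
  proof (rule emeasure_mono)
    show "{x. c \<le> n \<bullet> x \<and> n \<bullet> x \<le> c + 1 \<and> x - (n \<bullet> x - c) *\<^sub>R n \<in> A} \<subseteq> cball 0 (B + 1)"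
    proof safe
      fix x assume x: "c \<le> n \<bullet> x" "n \<bullet> x \<le> c + 1" "x - (n \<bullet> x - c) *\<^sub>R n \<in> A"
      have "norm x \<le> norm (x - (n \<bullet> x - c) *\<^sub>R n) + norm ((n \<bullet> x - c) *\<^sub>R n)"
        by (metis diff_add_cancel norm_triangle_ineq)
      also have "\<dots> \<le> B + 1" using B[OF x(3)] x n by simp
      finally show "x \<in> cball 0 (B + 1)" by simp
    qed
  qed auto
  also have "\<dots> < \<infinity>" using emeasure_bounded_finite[OF bounded_cball] by simp
  finally show ?thesis .
qed

lemma integrable_bounded_support:
  fixes f :: "'a::euclidean_space \<Rightarrow> real"
  assumes "f \<in> borel_measurable borel" "\<And>x. \<bar>f x\<bar> \<le> B" "\<And>x. f x \<noteq> 0 \<Longrightarrow> norm x \<le> M"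
  shows "integrable lborel f"
proof (rule Bochner_Integration.integrable_bound)
  show "integrable lborel (\<lambda>x::'a. indicator (cball 0 M) x * B)"
    by (intro integrable_mult_left integrable_real_indicator) (use emeasure_bounded_finite[OF bounded_cball] in auto)
  show "AE x in lborel. norm (f x) \<le> norm (indicator (cball 0 M) x * B)"
    using assms(2,3) proof (intro AE_I2)
    fix x :: 'a
    show "norm (f x) \<le> norm (indicator (cball 0 M) x * B)"
      using assms(2)[of x] assms(3)[of x] by (cases "f x = 0") auto
  qed
qed (use assms in auto)

text \<open>The factor is the ratio between the area on the plane and that of its shadow along \<open>e\<close>.\<close>

lemma plane_area_shadow:
  fixes \<phi> :: "real^3 \<Rightarrow> real"
  assumes n: "norm n = 1" and e: "norm e = 1" and ne: "n \<bullet> e \<noteq> 0"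
    and \<phi>[measurable]: "\<phi> \<in> borel_measurable borel" and B: "\<And>x. \<bar>\<phi> x\<bar> \<le> B"
    and M: "\<And>x. \<phi> x \<noteq> 0 \<Longrightarrow> norm x \<le> M"
  shows "\<bar>n \<bullet> e\<bar> * integral\<^sup>L (plane_area n c) \<phi> =
    (\<integral>x. indicator {x. 0 \<le> e \<bullet> x \<and> e \<bullet> x \<le> 1} x * \<phi> (x + ((c - n \<bullet> x) / (n \<bullet> e)) *\<^sub>R e) \<partial>lborel)"
proof -
  have nn: "n \<bullet> n = 1" using n by (simp add: dot_square_norm)
  \<comment> \<open>The value of \<open>\<phi>\<close> where the line through \<open>x\<close> in
    direction \<open>e\<close> meets the plane; it is constant along such lines.\<close>
  define H where "H x = \<phi> (x + ((c - n \<bullet> x) / (n \<bullet> e)) *\<^sub>R e)" for x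
  \<comment> \<open>The tangential part of \<open>e / (n . e)\<close>. Moving by \<open>w\<close>
    per unit of height turns projection along \<open>e\<close> into projection along
    \<open>n\<close>, and as \<open>w\<close> is orthogonal to \<open>n\<close> the slab is
    kept.\<close>
  define w where "w = (1 / (n \<bullet> e)) *\<^sub>R e - n"
  define S where "S = {x::real^3. c \<le> n \<bullet> x \<and> n \<bullet> x \<le> c + 1}"
  have [measurable]: "S \<in> sets borel" unfolding S_def using closed_slab by (blast intro: borel_closed)
  have [measurable]: "H \<in> borel_measurable borel" unfolding H_def by measurable
  have nw: "n \<bullet> w = 0" using ne by (simp add: w_def inner_diff_right nn)
  have Hline: "H (x + s *\<^sub>R e) = H x" for x s
    using ne by (simp add: H_def inner_add_right diff_divide_distrib add_divide_distrib algebra_simps)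
  have HS: "H (x + (n \<bullet> x - c) *\<^sub>R w) = \<phi> (x - (n \<bullet> x - c) *\<^sub>R n)" for x
  proof -
    have 1: "n \<bullet> (x + (n \<bullet> x - c) *\<^sub>R w) = n \<bullet> x" by (simp add: inner_add_right nw)
    have "x + (n \<bullet> x - c) *\<^sub>R w + ((c - n \<bullet> x) / (n \<bullet> e)) *\<^sub>R e =
      x - (n \<bullet> x - c) *\<^sub>R n + ((n \<bullet> x - c) / (n \<bullet> e) + (c - n \<bullet> x) / (n \<bullet> e)) *\<^sub>R e"
      unfolding w_def by (simp add: scaleR_add_left scaleR_diff_right)
    also have "(n \<bullet> x - c) / (n \<bullet> e) + (c - n \<bullet> x) / (n \<bullet> e) = 0"
      by (simp add: add_divide_distrib[symmetric])
    finally have "x + (n \<bullet> x - c) *\<^sub>R w + ((c - n \<bullet> x) / (n \<bullet> e)) *\<^sub>R e =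
      x - (n \<bullet> x - c) *\<^sub>R n" by (simp only: scaleR_zero_left add_0_right)
    then show ?thesis unfolding H_def 1 by (rule arg_cong)
  qed
  have "integral\<^sup>L (plane_area n c) \<phi> = (\<integral>x. indicator S x * \<phi> (x - (n \<bullet> x - c) *\<^sub>R n) \<partial>lborel)"
    by (simp add: integral_plane_area S_def)
  also have "\<dots> = (\<integral>x. indicator S (x + (n \<bullet> x - c) *\<^sub>R w) * H (x + (n \<bullet> x - c) *\<^sub>R w) \<partial>lborel)"
    by (rule Bochner_Integration.integral_cong)
       (auto simp: HS S_def indicator_def inner_add_right nw)
  also have "\<dots> = (\<integral>x. indicator S (x + (n \<bullet> x) *\<^sub>R w - c *\<^sub>R w) * H (x + (n \<bullet> x) *\<^sub>R w - c *\<^sub>R w) \<partial>lborel)"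
    by (simp add: algebra_simps)
  also have "\<dots> = (\<integral>x. indicator S (x - c *\<^sub>R w) * H (x - c *\<^sub>R w) \<partial>lborel)"
    by (subst (2) lborel_distr_shear[OF nw, symmetric], subst integral_distr) auto
  also have "\<dots> = (\<integral>x. indicator S x * H x \<partial>lborel)"
    by (subst (2) lborel_distr_plus[symmetric, of "- c *\<^sub>R w"], subst integral_distr) auto
  finally have 1: "integral\<^sup>L (plane_area n c) \<phi> = (\<integral>x. indicator S x * H x \<partial>lborel)" .
  have "integrable lborel (\<lambda>x. indicator S x * H x)"
  proof (rule integrable_bounded_support)
    show "\<bar>indicator S x * H x\<bar> \<le> B" for x
      using B[of "x + ((c - n \<bullet> x) / (n \<bullet> e)) *\<^sub>R e"] B[of x]
      by (auto simp: H_def indicator_def)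
    fix x assume "indicator S x * H x \<noteq> 0"
    then have x: "c \<le> n \<bullet> x" "n \<bullet> x \<le> c + 1" "\<phi> (x + ((c - n \<bullet> x) / (n \<bullet> e)) *\<^sub>R e) \<noteq> 0"
      by (auto simp: S_def H_def indicator_def split: if_splits)
    have "norm x \<le> norm (x + ((c - n \<bullet> x) / (n \<bullet> e)) *\<^sub>R e) + norm (((c - n \<bullet> x) / (n \<bullet> e)) *\<^sub>R e)"
      by (metis add_diff_cancel_right' norm_triangle_ineq4)
    also have "\<dots> \<le> M + 1 / \<bar>n \<bullet> e\<bar>"
      using M[OF x(3)] x(1,2) e by (intro add_mono) (auto simp: divide_right_mono)
    finally show "norm x \<le> M + 1 / \<bar>n \<bullet> e\<bar>" .
  qed measurable
  from integral_line_average[OF e this]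
  have "integral\<^sup>L (plane_area n c) \<phi> =
    (\<integral>x. indicator {x. 0 \<le> e \<bullet> x \<and> e \<bullet> x \<le> 1} x * (\<integral>s. indicator S (x + s *\<^sub>R e) * H (x + s *\<^sub>R e) \<partial>lborel) \<partial>lborel)"
    using 1 by simp
  also have "\<dots> = (\<integral>x. indicator {x. 0 \<le> e \<bullet> x \<and> e \<bullet> x \<le> 1} x * (H x / \<bar>n \<bullet> e\<bar>) \<partial>lborel)"
  proof (rule Bochner_Integration.integral_cong[OF refl])
    fix x :: "real^3"
    define p q where "p = (if n \<bullet> e > 0 then (c - n \<bullet> x)/(n \<bullet> e) else (c + 1 - n \<bullet> x)/(n \<bullet> e))"
      and "q = (if n \<bullet> e > 0 then (c + 1 - n \<bullet> x)/(n \<bullet> e) else (c - n \<bullet> x)/(n \<bullet> e))"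
    have ind: "indicator S (x + s *\<^sub>R e) = indicator {p..q} s" for s
      using ne by (auto simp: S_def indicator_def inner_add_right p_def q_def field_simps split: if_splits)
    \<comment> \<open>A line in direction \<open>e\<close> crosses the slab of thickness 1 in a
      parameter interval of length \<open>1 / |n . e|\<close>, the source of the shadow
      factor.\<close>
    have pq: "q - p = 1 / \<bar>n \<bullet> e\<bar>" "p \<le> q"
      using ne by (auto simp: p_def q_def diff_divide_distrib[symmetric] divide_right_mono divide_right_mono_neg)
    have "(\<integral>s. indicator S (x + s *\<^sub>R e) * H (x + s *\<^sub>R e) \<partial>lborel) = H x / \<bar>n \<bullet> e\<bar>"
      using pq by (simp add: ind Hline)
    then show "indicator {x. 0 \<le> e \<bullet> x \<and> e \<bullet> x \<le> 1} x * (\<integral>s. indicator S (x + s *\<^sub>R e) * H (x + s *\<^sub>R e) \<partial>lborel) =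
      indicator {x. 0 \<le> e \<bullet> x \<and> e \<bullet> x \<le> 1} x * (H x / \<bar>n \<bullet> e\<bar>)" by simp
  qed
  finally show ?thesis using ne by (simp add: H_def)
qed

subsection \<open>The divergence theorem on polytopes\<close>

text \<open>The line meets \<open>R\<close> in an interval. The hypotheses \<open>par\<close> and
  \<open>sep\<close> put it in general position: it lies in no plane parallel to it and crosses no
  two planes at the same point. So each end point belongs to exactly one constraint, entered against
  its normal and left along it, while every other crossing lies outside \<open>R\<close>; the sum
  collapses to the two boundary values of the fundamental theorem.\<close>

lemma line_FTC:
  fixes A :: "((real^3) \<times> real) set" and x e :: "real^3"
  defines "t \<equiv> \<lambda>i. (snd i - fst i \<bullet> x) / (fst i \<bullet> e)"
  assumes fin: "finite A" and R: "R = {x. \<forall>i\<in>A. fst i \<bullet> x \<le> snd i}" and comp: "compact R"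
    and e: "norm e = 1"
    and par: "\<And>i. i \<in> A \<Longrightarrow> fst i \<bullet> e = 0 \<Longrightarrow> fst i \<bullet> x \<noteq> snd i"
    and sep: "\<And>i j. i \<in> A \<Longrightarrow> j \<in> A \<Longrightarrow> i \<noteq> j \<Longrightarrow> fst i \<bullet> e \<noteq> 0 \<Longrightarrow> fst j \<bullet> e \<noteq> 0 \<Longrightarrow> t i \<noteq> t j"
    and V: "\<And>y. y \<in> R \<Longrightarrow> ((\<lambda>s. V (y + s *\<^sub>R e)) has_real_derivative D y) (at 0)"
    and D: "continuous_on R D"
  shows "(\<integral>s. indicator R (x + s *\<^sub>R e) * D (x + s *\<^sub>R e) \<partial>lborel) =
    (\<Sum>i\<in>A. sgn (fst i \<bullet> e) * (indicator R (x + t i *\<^sub>R e) * V (x + t i *\<^sub>R e)))"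
proof -
  define J where "J = {s. x + s *\<^sub>R e \<in> R}"
  \<comment> \<open>Slack of constraint \<open>i\<close> at parameter \<open>s\<close>; it is affine
    in \<open>s\<close> and nonpositive on the half-space.\<close>
  define g where "g i s = fst i \<bullet> x + s * (fst i \<bullet> e) - snd i" for i s
  have J: "s \<in> J \<longleftrightarrow> (\<forall>i\<in>A. g i s \<le> 0)" for s
    by (auto simp: J_def R g_def inner_add_right)
  have gt: "fst i \<bullet> e \<noteq> 0 \<Longrightarrow> g i s = 0 \<longleftrightarrow> s = t i" for i s
    by (auto simp: g_def t_def field_simps)
  have "closed J"
  proof -
    have "J = (\<lambda>s. x + s *\<^sub>R e) -` R" by (auto simp: J_def)
    moreover have "closed ((\<lambda>s. x + s *\<^sub>R e) -` R)"
      by (intro continuous_closed_vimage compact_imp_closed comp) (auto intro!: continuous_intros)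
    ultimately show ?thesis by simp
  qed
  moreover have "bounded J"
  proof -
    obtain B where B: "\<And>y. y \<in> R \<Longrightarrow> norm y \<le> B"
      using compact_imp_bounded[OF comp] by (auto simp: bounded_iff)
    have "norm s \<le> B + norm x" if "s \<in> J" for s
    proof -
      have "norm s = norm ((x + s *\<^sub>R e) - x)" using e by simp
      also have "\<dots> \<le> norm (x + s *\<^sub>R e) + norm x" by (rule norm_triangle_ineq4)
      also have "\<dots> \<le> B + norm x" using B that by (auto simp: J_def)
      finally show ?thesis .
    qed
    then show ?thesis by (auto simp: bounded_iff)
  qed
  ultimately have "compact J" by (simp add: compact_eq_bounded_closed)
  moreover have "convex J"
  proof (rule convexI)
    fix p q u v :: real assume *: "p \<in> J" "q \<in> J" "0 \<le> u" "0 \<le> v" "u + v = 1"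
    have "g i (u *\<^sub>R p + v *\<^sub>R q) = u * g i p + v * g i q" for i
    proof -
      have "u * g i p + v * g i q = (u + v) * (fst i \<bullet> x - snd i) + (u * p + v * q) * (fst i \<bullet> e)"
        by (simp add: g_def algebra_simps)
      then show ?thesis using *(5) by (simp add: g_def)
    qed
    then show "u *\<^sub>R p + v *\<^sub>R q \<in> J"
      using * by (auto simp: J intro!: add_nonpos_nonpos mult_nonneg_nonpos)
  qed
  ultimately obtain a b where ab: "J = {a..b}"
    using connected_compact_interval_1[of J] convex_connected by blast
  \<comment> \<open>For a constraint parallel to \<open>e\<close> the division by zero yields
    \<open>t i = 0\<close>, but \<open>sgn 0 = 0\<close> removes that summand.\<close>
  have trm: "sgn (fst i \<bullet> e) * (indicator R (x + t i *\<^sub>R e) * V (x + t i *\<^sub>R e)) =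
    (if fst i \<bullet> e \<noteq> 0 \<and> t i \<in> J then sgn (fst i \<bullet> e) * V (x + t i *\<^sub>R e) else 0)" for i
    by (auto simp: J_def indicator_def)
  have ind: "indicator R (x + s *\<^sub>R e) = (indicator J s :: real)" for s
    by (auto simp: J_def indicator_def)
  show ?thesis
  proof (cases "J = {}")
    case True
    then show ?thesis by (simp add: trm ind)
  next
    case False
    then have "a \<le> b" using ab by auto
    have neg: "g i s < 0" if "i \<in> A" "s \<in> J" "fst i \<bullet> e \<noteq> 0 \<Longrightarrow> s \<noteq> t i" for i s
    proof (cases "fst i \<bullet> e = 0")
      case True
      then have "g i s \<noteq> 0" using par[OF that(1)] by (auto simp: g_def)
      then show ?thesis using that J by force
    next
      case False
      then have "g i s \<noteq> 0" using gt[of i s] that(3) by auto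
      then show ?thesis using that J by force
    qed
    have near: "\<exists>\<delta>>0. \<forall>u. \<bar>u - s\<bar> < \<delta> \<longrightarrow> (\<forall>i\<in>A. g i s < 0 \<longrightarrow> g i u < 0)" for s
    proof -
      have "eventually (\<lambda>u. g i s < 0 \<longrightarrow> g i u < 0) (nhds s)" for i
      proof (cases "g i s < 0")
        case True
        have "isCont (g i) s" unfolding g_def by (intro continuous_intros)
        then have "(g i \<longlongrightarrow> g i s) (nhds s)" by (simp add: isCont_def tendsto_at_iff_tendsto_nhds)
        then show ?thesis using order_tendstoD(2)[OF _ True] by (auto elim: eventually_mono)
      qed auto
      then have "eventually (\<lambda>u. \<forall>i\<in>A. g i s < 0 \<longrightarrow> g i u < 0) (nhds s)"
        using fin by (simp add: eventually_ball_finite_distrib)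
      then show ?thesis by (auto simp: eventually_nhds_metric dist_real_def)
    qed
    \<comment> \<open>By \<open>sep\<close> at most one constraint is active at the supposed only
      point of the interval, so a small move to the inner side of that constraint stays in
      \<open>R\<close>.\<close>
    have lt: "a < b"
    proof (rule ccontr)
      assume "\<not> a < b"
      then have Ja: "J = {a}" using \<open>a \<le> b\<close> ab by auto
      obtain \<delta> where \<delta>: "\<delta> > 0" "\<And>u. \<bar>u - a\<bar> < \<delta> \<Longrightarrow> (\<forall>i\<in>A. g i a < 0 \<longrightarrow> g i u < 0)"
        using near[of a] by auto
      show False
      proof (cases "\<exists>i\<in>A. fst i \<bullet> e \<noteq> 0 \<and> a = t i")
        case False
        then have "\<forall>i\<in>A. g i a < 0" using neg Ja by blast
        then have "a + \<delta>/2 \<in> J" using \<delta>(2)[of "a + \<delta>/2"] \<delta>(1) by (auto simp: J less_imp_le)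
        then show False using Ja \<delta>(1) by auto
      next
        case True
        then obtain i where i: "i \<in> A" "fst i \<bullet> e \<noteq> 0" "a = t i" by auto
        \<comment> \<open>Moving against the sign of the active normal component lowers the only
          slack that is zero; \<open>near\<close> keeps the others negative.\<close>
        define u where "u = a - sgn (fst i \<bullet> e) * (\<delta> / 2)"
        have u: "\<bar>u - a\<bar> < \<delta>" "u \<noteq> a" using \<delta>(1) i(2) by (auto simp: u_def abs_mult sgn_if)
        have "g j u \<le> 0" if "j \<in> A" for j
        proof (cases "j = i")
          case True
          have "g i u = g i a - \<bar>fst i \<bullet> e\<bar> * (\<delta>/2)"
            by (simp add: g_def u_def sgn_if algebra_simps)
          also have "g i a = 0" using gt i by auto
          finally show ?thesis using True \<delta>(1) by simp
        next
          case False
          then have "g j a < 0" using neg[OF that, of a] sep[OF i(1) that] i Ja by auto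
          then show ?thesis using \<delta>(2)[OF u(1)] that by (simp add: less_imp_le)
        qed
        then have "u \<in> J" by (simp add: J)
        then show False using Ja u by auto
      qed
    qed
    \<comment> \<open>Without an active constraint at \<open>s\<close> the interval would extend
      beyond \<open>s\<close> on both sides.\<close>
    have endpt: "\<exists>i\<in>A. fst i \<bullet> e \<noteq> 0 \<and> s = t i" if "s = a \<or> s = b" for s
    proof (rule ccontr)
      assume "\<not> ?thesis"
      moreover have "s \<in> J" using that ab \<open>a \<le> b\<close> by auto
      ultimately have n: "\<forall>i\<in>A. g i s < 0" using neg by blast
      obtain \<delta> where \<delta>: "\<delta> > 0" "\<And>u. \<bar>u - s\<bar> < \<delta> \<Longrightarrow> (\<forall>i\<in>A. g i s < 0 \<longrightarrow> g i u < 0)"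
        using near[of s] by auto
      have "s + \<delta>/2 \<in> J" "s - \<delta>/2 \<in> J"
        using \<delta>(2)[of "s + \<delta>/2"] \<delta>(2)[of "s - \<delta>/2"] \<delta>(1) n by (auto simp: J less_imp_le)
      then show False using that ab \<delta>(1) by auto
    qed
    obtain i where i: "i \<in> A" "fst i \<bullet> e \<noteq> 0" "a = t i" using endpt[of a] by auto
    obtain j where j: "j \<in> A" "fst j \<bullet> e \<noteq> 0" "b = t j" using endpt[of b] by auto
    have gi: "g i a = 0" "g i b \<le> 0" "g j b = 0" "g j a \<le> 0"
      using i j gt[OF i(2)] gt[OF j(2)] J[of a] J[of b] \<open>a \<le> b\<close> by (simp_all only: ab) simp_all
    have "g i b - g i a = (b - a) * (fst i \<bullet> e)" "g j b - g j a = (b - a) * (fst j \<bullet> e)"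
      by (auto simp: g_def algebra_simps)
    then have sg: "fst i \<bullet> e < 0" "fst j \<bullet> e > 0"
      using gi lt i(2) j(2) by (smt (verit) mult_pos_pos mult_pos_neg)+
    have ij: "i \<noteq> j" using lt i j by auto
    \<comment> \<open>An affine slack that is nonpositive on the whole interval and not constant
      cannot vanish in its interior; at the ends \<open>sep\<close> identifies the
      constraint.\<close>
    have mid: "k = i \<or> k = j" if k: "k \<in> A" "fst k \<bullet> e \<noteq> 0" "t k \<in> J" for k
    proof -
      have g0: "g k (t k) = 0" using gt k by auto
      have "g k a \<le> 0" "g k b \<le> 0" using k(1) ab J \<open>a \<le> b\<close> by auto
      moreover have "g k a = g k (t k) - (t k - a) * (fst k \<bullet> e)" "g k b = g k (t k) + (b - t k) * (fst k \<bullet> e)"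
        by (auto simp: g_def algebra_simps)
      ultimately have 1: "(t k - a) * (fst k \<bullet> e) \<ge> 0" "(b - t k) * (fst k \<bullet> e) \<le> 0" using g0 by auto
      have "t k = a \<or> t k = b"
      proof (rule ccontr)
        assume "\<not> ?thesis"
        then have "t k - a > 0" "b - t k > 0" using k(3) ab by auto
        then show False using 1 k(2)
          by (metis linorder_not_less mult_pos_pos mult_pos_neg not_less_iff_gr_or_eq)
      qed
      then show ?thesis using sep[OF k(1) i(1) _ k(2) i(2)] sep[OF k(1) j(1) _ k(2) j(2)] i(3) j(3) by auto
    qed
    have inR: "x + s *\<^sub>R e \<in> R" if "a \<le> s" "s \<le> b" for s using that ab by (auto simp: J_def)
    have "(\<integral>s. indicator R (x + s *\<^sub>R e) * D (x + s *\<^sub>R e) \<partial>lborel) =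
      (\<integral>s. indicator {a..b} s *\<^sub>R D (x + s *\<^sub>R e) \<partial>lborel)"
      by (simp add: ind ab)
    also have "\<dots> = V (x + b *\<^sub>R e) - V (x + a *\<^sub>R e)"
    proof (rule integral_FTC_atLeastAtMost[OF \<open>a \<le> b\<close>])
      fix s assume s: "a \<le> s" "s \<le> b"
      have V1: "((\<lambda>u. V ((x + s *\<^sub>R e) + u *\<^sub>R e)) has_real_derivative D (x + s *\<^sub>R e)) (at (s - s))"
        using V[OF inR[OF s]] by simp
      have "((\<lambda>u. u - s) has_real_derivative 1) (at s)" by (auto intro!: derivative_eq_intros)
      from DERIV_chain2[where f="\<lambda>u. V (x + s *\<^sub>R e + u *\<^sub>R e)" and g="\<lambda>u. u - s", OF V1 this]
      have "((\<lambda>u. V ((x + s *\<^sub>R e) + (u - s) *\<^sub>R e)) has_real_derivative D (x + s *\<^sub>R e)) (at s)"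
        by simp
      then have "((\<lambda>u. V (x + u *\<^sub>R e)) has_real_derivative D (x + s *\<^sub>R e)) (at s)"
        by (simp add: algebra_simps)
      then show "((\<lambda>s. V (x + s *\<^sub>R e)) has_vector_derivative D (x + s *\<^sub>R e)) (at s within {a..b})"
        by (simp add: has_real_derivative_iff_has_vector_derivative has_vector_derivative_at_within)
    next
      show "continuous_on {a..b} (\<lambda>s. D (x + s *\<^sub>R e))"
        by (rule continuous_on_compose2[OF D]) (auto intro!: continuous_intros inR)
    qed
    also have "\<dots> = (\<Sum>k\<in>{i,j}. if fst k \<bullet> e \<noteq> 0 \<and> t k \<in> J then sgn (fst k \<bullet> e) * V (x + t k *\<^sub>R e) else 0)"
      using ij i j sg ab \<open>a \<le> b\<close> by simp
    also have "\<dots> = (\<Sum>k\<in>A. if fst k \<bullet> e \<noteq> 0 \<and> t k \<in> J then sgn (fst k \<bullet> e) * V (x + t k *\<^sub>R e) else 0)"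
      using fin i(1) j(1) mid by (intro sum.mono_neutral_left) auto
    finally show ?thesis by (simp add: trm)
  qed
qed

text \<open>Averages \<open>line_FTC\<close> over all lines in direction \<open>e\<close>. The
  summand of constraint \<open>i\<close> is then an integral over the shadow of its plane, and the
  sign times the shadow factor is \<open>fst i \<bullet> e\<close>. The hypothesis
  \<open>anti\<close> excludes opposite constraints on a common plane, the one way in which two
  different constraints could be crossed simultaneously by all lines.\<close>

lemma gauss_directional:
  fixes A :: "((real^3) \<times> real) set" and e :: "real^3"
  assumes fin: "finite A" and R: "R = {x. \<forall>i\<in>A. fst i \<bullet> x \<le> snd i}" and comp: "compact R"
    and unit: "\<And>i. i \<in> A \<Longrightarrow> norm (fst i) = 1"
    and anti: "\<And>i. i \<in> A \<Longrightarrow> (- fst i, - snd i) \<notin> A"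
    and e: "norm e = 1"
    and V: "\<And>y. y \<in> R \<Longrightarrow> ((\<lambda>s. V (y + s *\<^sub>R e)) has_real_derivative D y) (at 0)"
    and D: "continuous_on R D" and Vc: "continuous_on R V"
  shows "(\<integral>x. indicator R x * D x \<partial>lborel) =
    (\<Sum>i\<in>A. (fst i \<bullet> e) * (\<integral>x. indicator R x * V x \<partial>plane_area (fst i) (snd i)))"
proof -
  define t where "t x i = (snd i - fst i \<bullet> x) / (fst i \<bullet> e)" for x and i :: "(real^3) \<times> real"
  define G :: "real^3 \<Rightarrow> real" where "G = indicator {x. 0 \<le> e \<bullet> x \<and> e \<bullet> x \<le> 1}"
  define \<phi> where "\<phi> x = indicator R x * V x" for x
  have Rb: "R \<in> sets borel" using comp by (simp add: borel_compact)
  obtain B where B: "\<And>y. y \<in> R \<Longrightarrow> norm y \<le> B"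
    using compact_imp_bounded[OF comp] by (auto simp: bounded_iff)
  have bd: "\<exists>C. \<forall>x. \<bar>indicator R x * W x\<bar> \<le> C" if "continuous_on R W" for W :: "real^3 \<Rightarrow> real"
  proof -
    have "bounded (W ` R)" using compact_continuous_image[OF that comp] compact_imp_bounded by blast
    then obtain C where "\<And>x. x \<in> R \<Longrightarrow> \<bar>W x\<bar> \<le> C" by (auto simp: bounded_iff)
    then have "\<bar>indicator R x * W x\<bar> \<le> max C 0" for x 
      by (cases "x \<in> R") (auto simp: le_max_iff_disj)
    then show ?thesis by blast
  qed
  have meas: "(\<lambda>x. indicator R x * W x) \<in> borel_measurable borel" if "continuous_on R W" for W :: "real^3 \<Rightarrow> real"
    using borel_measurable_continuous_on_indicator[OF Rb that] by simp
  have \<phi>m[measurable]: "\<phi> \<in> borel_measurable borel" unfolding \<phi>_def by (rule meas[OF Vc])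
  obtain C where C: "\<And>x. \<bar>\<phi> x\<bar> \<le> C" using bd[OF Vc] unfolding \<phi>_def by auto
  have \<phi>B: "norm x \<le> B" if "\<phi> x \<noteq> 0" for x using that B by (auto simp: \<phi>_def indicator_def split: if_splits)
  have [measurable]: "(\<lambda>x. indicator R x * D x) \<in> borel_measurable borel" by (rule meas[OF D])
  have G1[measurable]: "G \<in> borel_measurable borel" unfolding G_def by measurable
  define P where "P = {p \<in> A \<times> A. fst p \<noteq> snd p \<and> fst (fst p) \<bullet> e \<noteq> 0 \<and> fst (snd p) \<bullet> e \<noteq> 0}"
  \<comment> \<open>The lines not in general position. Each of the finitely many conditions confines
    \<open>x\<close> to a hyperplane or to the empty set.\<close>
  define N where "N = (\<Union>i\<in>{i\<in>A. fst i \<bullet> e = 0}. {x. fst i \<bullet> x = snd i}) \<union>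
     (\<Union>p\<in>P. {x. t x (fst p) = t x (snd p)})"
  have "negligible N"
  proof -
    have n1: "negligible {x. fst i \<bullet> x = snd i}" if "i \<in> A" for i
      using unit[OF that] by (intro negligible_hyperplane) auto
    have n2: "negligible {x. t x (fst p) = t x (snd p)}" if "p \<in> P" for p
    proof -
      obtain n c m c' where p: "p = ((n,c),(m,c'))" by (metis prod.collapse)
      have *: "(n,c) \<in> A" "(m,c') \<in> A" "(n,c) \<noteq> (m,c')" "fst (n,c) \<bullet> e \<noteq> 0" "fst (m,c') \<bullet> e \<noteq> 0"
        using that by (auto simp: P_def p)
    define v where "v = (m \<bullet> e) *\<^sub>R n - (n \<bullet> e) *\<^sub>R m"
    have eq: "{x. t x (n,c) = t x (m,c')} = {x. v \<bullet> x = c * (m \<bullet> e) - c' * (n \<bullet> e)}"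
    proof -
      have "t x (n,c) = t x (m,c') \<longleftrightarrow> (c - n \<bullet> x) * (m \<bullet> e) = (c' - m \<bullet> x) * (n \<bullet> e)" for x
        using *(4,5) unfolding t_def by (simp add: frac_eq_eq)
      moreover have "(c - n \<bullet> x) * (m \<bullet> e) = (c' - m \<bullet> x) * (n \<bullet> e) \<longleftrightarrow>
        v \<bullet> x = c * (m \<bullet> e) - c' * (n \<bullet> e)" for x
        unfolding v_def by (simp add: inner_diff_left left_diff_distrib) (smt (verit) mult.commute)
      ultimately show ?thesis by simp
    qed
    \<comment> \<open>If both sides of the linear equation degenerated, unit length would force
      \<open>m = n\<close> or \<open>m = - n\<close> with matching offsets, that is, equal or
      antipodal constraints.\<close>
    have "v \<noteq> 0 \<or> c * (m \<bullet> e) - c' * (n \<bullet> e) \<noteq> 0"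
    proof (rule ccontr)
      assume "\<not> ?thesis"
      then have v: "(m \<bullet> e) *\<^sub>R n = (n \<bullet> e) *\<^sub>R m" and c: "c * (m \<bullet> e) = c' * (n \<bullet> e)" by (auto simp: v_def)
      have "\<bar>m \<bullet> e\<bar> * norm n = \<bar>n \<bullet> e\<bar> * norm m" using arg_cong[OF v, of norm] by simp
      then have "\<bar>m \<bullet> e\<bar> = \<bar>n \<bullet> e\<bar>" using unit[OF *(1)] unit[OF *(2)] by simp
      then consider "m \<bullet> e = n \<bullet> e" | "m \<bullet> e = - (n \<bullet> e)" by linarith
      then show False
      proof cases
        case 1
        from v have "(n \<bullet> e) *\<^sub>R n = (n \<bullet> e) *\<^sub>R m" unfolding 1 .
        then have "n = m" using *(4) unfolding scaleR_cancel_left by simp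
        moreover from c have "c * (n \<bullet> e) = c' * (n \<bullet> e)" unfolding 1 .
        then have "c = c'" using *(4) unfolding mult_cancel_right by simp
        ultimately show False using *(3) by simp
      next
        case 2
        from v have "(n \<bullet> e) *\<^sub>R m = (n \<bullet> e) *\<^sub>R (- n)"
          unfolding 2 scaleR_minus_left scaleR_minus_right by (rule sym)
        then have "m = - n" using *(4) unfolding scaleR_cancel_left by simp
        moreover from c have "c' * (n \<bullet> e) = (- c) * (n \<bullet> e)" unfolding 2 by simp
        then have "c' = - c" using *(4) unfolding mult_cancel_right by simp
        ultimately show False using anti[OF *(1)] *(2) by simp
      qed
    qed
    then show ?thesis unfolding p fst_conv snd_conv eq by (rule negligible_hyperplane)
  qed
  have "finite P" unfolding P_def using fin by simp
  then show ?thesis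
    unfolding N_def using fin n1 n2 by (auto intro!: negligible_Un negligible_Union)
  qed
  then have "AE x in lebesgue. x \<notin> N"
    by (simp add: negligible_iff_null_sets AE_not_in)
  then have AEN: "AE x in lborel. x \<notin> N" by (simp add: AE_completion_iff)
  define T where "T i x = sgn (fst i \<bullet> e) * \<phi> (x + t x i *\<^sub>R e)" for i x
  have Tm[measurable]: "T i \<in> borel_measurable borel" for i unfolding T_def t_def by measurable
  have Ti: "integrable lborel (\<lambda>x. G x * T i x)" if "i \<in> A" for i
  proof (rule integrable_bounded_support)
    show "\<bar>G x * T i x\<bar> \<le> C" for x
      using C[of "x + t x i *\<^sub>R e"] C[of x] by (auto simp: T_def G_def indicator_def abs_mult sgn_if)
    fix x assume "G x * T i x \<noteq> 0"
    then have x: "0 \<le> e \<bullet> x" "e \<bullet> x \<le> 1" "\<phi> (x + t x i *\<^sub>R e) \<noteq> 0"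
      by (auto simp: G_def T_def indicator_def split: if_splits)
    let ?y = "x + t x i *\<^sub>R e"
    \<comment> \<open>The line parameter is the difference of the \<open>e\<close>-coordinates of a
      point of \<open>R\<close> and of a point of the unit slab, so it is at most
      \<open>B + 1\<close> in size.\<close>
    have "e \<bullet> ?y = e \<bullet> x + t x i" using e by (simp add: inner_add_right dot_square_norm)
    moreover have "\<bar>e \<bullet> ?y\<bar> \<le> B" using \<phi>B[OF x(3)] Cauchy_Schwarz_ineq2[of e ?y] e by simp
    ultimately have "\<bar>t x i\<bar> \<le> B + 1" using x by linarith
    moreover have "norm x \<le> norm ?y + norm (t x i *\<^sub>R e)"
      by (metis add_diff_cancel_right' norm_triangle_ineq4)
    ultimately show "norm x \<le> B + (B + 1)" using \<phi>B[OF x(3)] e by simp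
  qed measurable
  obtain CD where CD: "\<And>x. \<bar>indicator R x * D x\<bar> \<le> CD" using bd[OF D] by auto
  have "integrable lborel (\<lambda>x. indicator R x * D x)"
  proof (rule integrable_bounded_support)
    show "norm x \<le> B" if "indicator R x * D x \<noteq> 0" for x
      using that B by (cases "x \<in> R") auto
  qed (use CD in auto)
  from integral_line_average[OF e this]
  have "(\<integral>x. indicator R x * D x \<partial>lborel) =
    (\<integral>x. G x * (\<integral>s. indicator R (x + s *\<^sub>R e) * D (x + s *\<^sub>R e) \<partial>lborel) \<partial>lborel)"
    by (simp add: G_def)
  also have "\<dots> = (\<integral>x. G x * (\<Sum>i\<in>A. T i x) \<partial>lborel)"
  proof (rule integral_cong_AE)
    have "(\<lambda>(x, s). indicator R (x + s *\<^sub>R e) * D (x + s *\<^sub>R e)) \<in> borel_measurable (borel \<Otimes>\<^sub>M lborel)"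
      using measurable_compose[of "\<lambda>(x::real^3, s). x + s *\<^sub>R e" "borel \<Otimes>\<^sub>M lborel" borel "\<lambda>x. indicator R x * D x" borel]
      by (simp add: split_beta')
    then show "(\<lambda>x. G x * (\<integral>s. indicator R (x + s *\<^sub>R e) * D (x + s *\<^sub>R e) \<partial>lborel)) \<in> borel_measurable lborel"
      by (intro borel_measurable_times lborel.borel_measurable_lebesgue_integral) auto
    show "AE x in lborel. G x * (\<integral>s. indicator R (x + s *\<^sub>R e) * D (x + s *\<^sub>R e) \<partial>lborel) = G x * (\<Sum>i\<in>A. T i x)"
      using AEN
    proof eventually_elim
      case (elim x)
      have "(\<integral>s. indicator R (x + s *\<^sub>R e) * D (x + s *\<^sub>R e) \<partial>lborel) = (\<Sum>i\<in>A. T i x)"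
        unfolding T_def \<phi>_def t_def
      proof (rule line_FTC[OF fin R comp e _ _ V D])
        show "fst i \<bullet> x \<noteq> snd i" if "i \<in> A" "fst i \<bullet> e = 0" for i
          using that elim by (auto simp: N_def)
        show "(snd i - fst i \<bullet> x) / (fst i \<bullet> e) \<noteq> (snd j - fst j \<bullet> x) / (fst j \<bullet> e)"
          if "i \<in> A" "j \<in> A" "i \<noteq> j" "fst i \<bullet> e \<noteq> 0" "fst j \<bullet> e \<noteq> 0" for i j
        proof -
          have "(i, j) \<in> P" using that by (auto simp: P_def)
          then show ?thesis using elim by (force simp: N_def t_def)
        qed
      qed
      then show ?case by simp
    qed
  qed measurable
  also have "\<dots> = (\<Sum>i\<in>A. \<integral>x. G x * T i x \<partial>lborel)"
    unfolding sum_distrib_left by (rule Bochner_Integration.integral_sum) (rule Ti)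
  also have "\<dots> = (\<Sum>i\<in>A. (fst i \<bullet> e) * (\<integral>x. indicator R x * V x \<partial>plane_area (fst i) (snd i)))"
  proof (rule sum.cong[OF refl])
    fix i assume i: "i \<in> A"
    show "(\<integral>x. G x * T i x \<partial>lborel) = (fst i \<bullet> e) * (\<integral>x. indicator R x * V x \<partial>plane_area (fst i) (snd i))"
    proof (cases "fst i \<bullet> e = 0")
      case True then show ?thesis by (simp add: T_def)
    next
      case False
      have "(\<integral>x. G x * T i x \<partial>lborel) = sgn (fst i \<bullet> e) * (\<integral>x. G x * \<phi> (x + t x i *\<^sub>R e) \<partial>lborel)"
        unfolding T_def by (subst integral_mult_right_zero[symmetric]) (simp add: algebra_simps)
      also have "\<dots> = sgn (fst i \<bullet> e) * (\<bar>fst i \<bullet> e\<bar> * (\<integral>x. \<phi> x \<partial>plane_area (fst i) (snd i)))"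
        using plane_area_shadow[OF unit[OF i] e False \<phi>m C \<phi>B, of "snd i"] by (simp add: G_def t_def)
      also have "sgn (fst i \<bullet> e) * (\<bar>fst i \<bullet> e\<bar> * (\<integral>x. \<phi> x \<partial>plane_area (fst i) (snd i))) =
        (fst i \<bullet> e) * (\<integral>x. \<phi> x \<partial>plane_area (fst i) (snd i))"
        by (simp add: sgn_mult_abs mult.assoc[symmetric])
      finally show ?thesis by (simp add: \<phi>_def)
    qed
  qed
  finally show ?thesis .
qed

section \<open>Planes, facets and null sets of the area measure\<close>

lemma hyperplane_unique:
  fixes S :: "(real^3) set"
  assumes S: "aff_dim S = 2" "S \<subseteq> {x. n \<bullet> x = c}" "S \<subseteq> {x. m \<bullet> x = c'}"
    and n: "norm n = 1" and m: "norm m = 1"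
  shows "(m = n \<and> c' = c) \<or> (m = - n \<and> c' = - c)"
proof -
  \<comment> \<open>A two-dimensional set spans every plane that contains it, so both planes are the
    affine hull of \<open>S\<close>.\<close>
  have hull: "affine hull S = {x. k \<bullet> x = r}" if "S \<subseteq> {x. k \<bullet> x = r}" "norm k = 1" for k r
  proof -
    have "k \<noteq> 0" using that by auto
    then have "aff_dim {x. k \<bullet> x = r} = aff_dim S" using S(1) by simp
    then have "affine hull S = affine hull {x. k \<bullet> x = r}" using aff_dim_eq_full_gen[OF that(1)] by simp
    also have "\<dots> = {x. k \<bullet> x = r}" by (simp add: affine_hyperplane)
    finally show ?thesis .
  qed
  have eq: "{x. n \<bullet> x = c} = {x. m \<bullet> x = c'}" using hull[OF S(2) n] hull[OF S(3) m] by simp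
  have nn: "n \<bullet> n = 1" "m \<bullet> m = 1" using n m by (simp_all add: dot_square_norm)
  have p: "n \<bullet> x = c \<Longrightarrow> m \<bullet> x = c'" for x using eq by blast
  \<comment> \<open>Inserting two points of the first plane into the equation of the second gives
    \<open>q * q = 1\<close>, the equality case of Cauchy-Schwarz for unit vectors, hence
    \<open>m = q n\<close>.\<close>
  define q where "q = m \<bullet> n"
  have "m \<bullet> (c *\<^sub>R n) = c'" by (rule p) (simp add: nn)
  then have c: "c * q = c'" by (simp add: q_def)
  have "m \<bullet> (c *\<^sub>R n + (m - q *\<^sub>R n)) = c'"
    by (rule p) (simp add: nn inner_add_right inner_diff_right q_def inner_commute)
  then have "q * q = 1" using c by (simp add: nn inner_add_right inner_diff_right q_def)
  then have q: "q = 1 \<or> q = -1" by (simp add: square_eq_1_iff)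
  have "(m - q *\<^sub>R n) \<bullet> (m - q *\<^sub>R n) = 1 - q * q"
    by (simp add: inner_diff_left inner_diff_right nn q_def inner_commute)
  then have "m = q *\<^sub>R n" using \<open>q * q = 1\<close> by simp
  then show ?thesis using q c by auto
qed

lemma facets_props:
  assumes "i \<in> facets R"
  shows "norm (fst i) = 1" "\<And>x. x \<in> R \<Longrightarrow> fst i \<bullet> x \<le> snd i"
    "(R \<inter> {x. fst i \<bullet> x = snd i}) facet_of R"
  using assms by (auto simp: facets_def)

text \<open>Two antipodal constraints would squeeze \<open>R\<close> into a plane. This provides the
  hypothesis \<open>anti\<close> of \<open>gauss_directional\<close>.\<close>

lemma facets_no_antipode:
  assumes R: "interior R \<noteq> {}" and i: "i \<in> facets R"
  shows "(- fst i, - snd i) \<notin> facets R"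
proof
  assume j: "(- fst i, - snd i) \<in> facets R"
  have "R \<subseteq> {x. fst i \<bullet> x = snd i}"
    using facets_props(2)[OF i] facets_props(2)[OF j] by (force intro: antisym)
  then have "interior R \<subseteq> interior {x. fst i \<bullet> x = snd i}" by (rule interior_mono)
  moreover have "fst i \<noteq> 0" using facets_props(1)[OF i] by auto
  ultimately show False using R by simp
qed

lemma aff_dim_facet:
  fixes R :: "(real^3) set"
  assumes "interior R \<noteq> {}" "C facet_of R"
  shows "aff_dim C = 2"
  using assms aff_dim_nonempty_interior[of R] by (simp add: facet_of_def)

lemma facets_determined:
  assumes R: "interior R \<noteq> {}" and i: "i \<in> facets R" and j: "j \<in> facets R"
    and S: "aff_dim S = 2" "S \<subseteq> {x. fst i \<bullet> x = snd i}" "S \<subseteq> {x. fst j \<bullet> x = snd j}"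
  shows "i = j"
  using hyperplane_unique[OF S facets_props(1)[OF i] facets_props(1)[OF j]]
    facets_no_antipode[OF R i] j by (metis prod.collapse)

text \<open>The elements of \<open>facets R\<close> are pairs of normal and offset, so besides the
  finiteness of the set of facets it matters that a facet determines its pair.\<close>

lemma finite_facets:
  assumes R: "polytope R" "interior R \<noteq> {}"
  shows "finite (facets R)"
proof (rule inj_on_finite)
  show "inj_on (\<lambda>i. R \<inter> {x. fst i \<bullet> x = snd i}) (facets R)"
  proof (rule inj_onI)
    fix i j assume ij: "i \<in> facets R" "j \<in> facets R" "R \<inter> {x. fst i \<bullet> x = snd i} = R \<inter> {x. fst j \<bullet> x = snd j}"
    show "i = j"
      by (rule facets_determined[OF R(2) ij(1,2) aff_dim_facet[OF R(2) facets_props(3)[OF ij(1)]]])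
        (use ij(3) in auto)
  qed
  show "(\<lambda>i. R \<inter> {x. fst i \<bullet> x = snd i}) ` facets R \<subseteq> {C. C facet_of R}"
    using facets_props(3) by auto
  show "finite {C. C facet_of R}" using R(1) by (rule finite_polytope_facets)
qed

text \<open>In a minimal representation by half-spaces each of them cuts out a facet; dividing by
  the norm of its normal gives a member of \<open>facets R\<close>.\<close>

lemma polytope_eq_facets:
  assumes R: "polytope R" "interior R \<noteq> {}"
  shows "R = {x. \<forall>i\<in>facets R. fst i \<bullet> x \<le> snd i}"
proof -
  have aff: "affine hull R = UNIV" using R(2) by (rule affine_hull_nonempty_interior)
  obtain F where F: "finite F" "R = affine hull R \<inter> \<Inter>F"
    "\<forall>h\<in>F. \<exists>a b. a \<noteq> 0 \<and> h = {x. a \<bullet> x \<le> b}" "\<forall>F'. F' \<subset> F \<longrightarrow> R \<subset> (affine hull R) \<inter> \<Inter>F'"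
    using polytope_imp_polyhedron[OF R(1)] unfolding polyhedron_Int_affine_minimal by blast
  obtain a b where ab: "\<And>h. h \<in> F \<Longrightarrow> a h \<noteq> 0 \<and> h = {x. a h \<bullet> x \<le> b h}"
    using F(3) by metis
  have RF: "R = \<Inter>F" using F(2) aff by simp
  have fac: "(a h /\<^sub>R norm (a h), b h / norm (a h)) \<in> facets R" if h: "h \<in> F" for h
  proof -
    have "(R \<inter> {x. a h \<bullet> x = b h}) facet_of R"
      using facet_of_polyhedron_explicit[OF F(1,2) ab] F(4) h by blast
    moreover have "{x. (a h /\<^sub>R norm (a h)) \<bullet> x = b h / norm (a h)} = {x. a h \<bullet> x = b h}"
      "{x. (a h /\<^sub>R norm (a h)) \<bullet> x \<le> b h / norm (a h)} = {x. a h \<bullet> x \<le> b h}"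
      using ab[OF h] by (auto simp: field_simps)
    moreover have "R \<subseteq> {x. a h \<bullet> x \<le> b h}" using RF h ab[OF h] by blast
    ultimately show ?thesis using ab[OF h] unfolding facets_def by (simp del: inner_scaleR_left)
  qed
  have "x \<in> R" if x: "\<forall>i\<in>facets R. fst i \<bullet> x \<le> snd i" for x
  proof -
    have "x \<in> h" if h: "h \<in> F" for h
    proof -
      have "(a h /\<^sub>R norm (a h)) \<bullet> x \<le> b h / norm (a h)" using x fac[OF h] by fastforce
      then have "a h \<bullet> x \<le> b h" using ab[OF h] by (simp add: field_simps)
      then show ?thesis using ab[OF h] by blast
    qed
    then show ?thesis using RF by blast
  qed
  then show ?thesis using facets_props(2) by blast
qed

lemma AE_plane_area_on_plane:
  assumes n: "norm n = 1"
  shows "AE x in plane_area n c. n \<bullet> x = c"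
proof -
  have nn: "n \<bullet> n = 1" using n by (simp add: dot_square_norm)
  have m: "{x. n \<bullet> x \<noteq> c} \<in> sets borel" by measurable
  have "{x. n \<bullet> x \<noteq> c} \<in> null_sets (plane_area n c)"
    using m by (simp add: null_sets_def emeasure_plane_area inner_diff_right nn)
  then show ?thesis by (rule AE_I'[where P="\<lambda>x. n \<bullet> x = c"]) auto
qed

text \<open>The slab points above the affine hull of \<open>S\<close> lie in the hull of
  \<open>S\<close> with the single point \<open>y + n\<close> added, which has one dimension more
  and is still a null set for volume.\<close>

lemma AE_plane_area_lowdim:
  fixes S :: "(real^3) set"
  assumes n: "norm n = 1" and S: "aff_dim S < 2"
  shows "AE x in plane_area n c. x \<notin> S"
proof -
  define L where "L = affine hull S"
  have m: "L \<in> sets borel" unfolding L_def by (rule borel_closed) simp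
  let ?P = "{x. c \<le> n \<bullet> x \<and> n \<bullet> x \<le> c + 1 \<and> x - (n \<bullet> x - c) *\<^sub>R n \<in> L}"
  have "negligible ?P"
  proof (cases "L = {}")
    case True then show ?thesis by simp
  next
    case False
    then obtain y where y: "y \<in> L" by auto
    have "?P \<subseteq> affine hull (insert (y + n) S)"
    proof
      fix x assume "x \<in> ?P"
      then have x: "x - (n \<bullet> x - c) *\<^sub>R n \<in> L" by auto
      let ?A = "affine hull (insert (y + n) S)"
      have aff: "affine ?A" by simp
      have LA: "L \<subseteq> ?A" unfolding L_def by (rule hull_mono) auto
      have 1: "x - (n \<bullet> x - c) *\<^sub>R n \<in> ?A" "y \<in> ?A" "y + n \<in> ?A"
        using x y LA by (auto intro: hull_inc)
      have "1 *\<^sub>R (x - (n \<bullet> x - c) *\<^sub>R n) + (n \<bullet> x - c) *\<^sub>R (y + n) + (- (n \<bullet> x - c)) *\<^sub>R y \<in> ?A"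
        using aff[unfolded affine_hull_explicit] mem_affine_3[OF aff 1(1) 1(3) 1(2), of 1 "n \<bullet> x - c" "- (n \<bullet> x - c)"]
        by simp
      then show "x \<in> ?A" by (simp add: algebra_simps)
    qed
    moreover have "aff_dim (insert (y + n) S) < 3"
      using S aff_dim_insert[of "y + n" S] by (auto split: if_splits)
    then have "negligible (affine hull (insert (y + n) S))"
    proof -
      have "aff_dim (affine hull (insert (y + n) S)) < DIM(real^3)"
        using \<open>aff_dim (insert (y + n) S) < 3\<close> by simp
      then obtain a b where "a \<noteq> 0" "affine hull (insert (y + n) S) \<subseteq> {x. a \<bullet> x = b}"
        by (rule aff_lowdim_subset_hyperplane)
      then show ?thesis using negligible_hyperplane[of a b] negligible_subset by blast
    qed
    ultimately show ?thesis using negligible_subset by blast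
  qed
  moreover have "?P \<in> sets borel" using m by measurable
  ultimately have "emeasure lborel ?P = 0"
    by (simp add: negligible_iff_null_sets null_sets_completion_iff null_sets_def)
  then have "L \<in> null_sets (plane_area n c)"
    using m by (simp add: null_sets_def emeasure_plane_area)
  then show ?thesis by (rule AE_I'[where P="\<lambda>x. x \<notin> S"]) (auto simp: L_def hull_inc)
qed

lemma set_integrable_plane_area:
  fixes w :: "real^3 \<Rightarrow> real"
  assumes n: "norm n = 1" and K: "compact K" "continuous_on K w" and S: "S \<subseteq> K" "S \<in> sets borel"
  shows "set_integrable (plane_area n c) S w"
proof -
  have Kb: "K \<in> sets borel" using K(1) by (simp add: borel_compact)
  have "bounded (w ` K)" using compact_continuous_image[OF K(2,1)] compact_imp_bounded by blast
  then obtain C where C: "\<And>x. x \<in> K \<Longrightarrow> \<bar>w x\<bar> \<le> C" by (auto simp: bounded_iff)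
  have m: "(\<lambda>x. indicator K x *\<^sub>R w x) \<in> borel_measurable borel"
    using borel_measurable_continuous_on_indicator[OF Kb K(2)] .
  have "set_integrable (plane_area n c) K w"
    unfolding set_integrable_def
  proof (rule Bochner_Integration.integrable_bound)
    show "integrable (plane_area n c) (\<lambda>x. indicator K x * C)"
      by (intro integrable_mult_left integrable_real_indicator)
        (use Kb emeasure_plane_area_bounded[OF n Kb compact_imp_bounded[OF K(1)]] in auto)
    show "AE x in plane_area n c. norm (indicator K x *\<^sub>R w x) \<le> norm (indicator K x * C)"
    proof (intro AE_I2)
      fix x show "norm (indicator K x *\<^sub>R w x) \<le> norm (indicator K x * C)"
        using C[of x] by (cases "x \<in> K") auto
    qed
  qed (use m in simp)
  then show ?thesis by (rule set_integrable_subset) (use S in auto)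
qed

section \<open>Traces from inside an element\<close>

lemma polytope_limpt:
  fixes R :: "(real^3) set"
  assumes R: "polytope R" "interior R \<noteq> {}" and x: "x \<in> R"
  shows "at x within interior R \<noteq> bot"
proof -
  have "x \<in> closure (interior R)"
    using convex_closure_interior[OF polytope_imp_convex[OF R(1)] R(2)] x closure_subset by blast
  then show ?thesis
    by (metis closure_def UnE interior_limit_point islimpt_in_closure
        mem_Collect_eq trivial_limit_within interior_interior)
qed

lemma trace_in_eq:
  assumes R: "polytope R" "interior R \<noteq> {}" and x: "x \<in> R" and l: "(g \<longlongrightarrow> l) (at x within interior R)"
  shows "trace_in R g x = l"
  unfolding trace_in_def using polytope_limpt[OF R x] l by (rule tendsto_Lim)

lemma trace_in_tendsto:
  assumes R: "polytope R" "interior R \<noteq> {}" and x: "x \<in> R" and l: "\<exists>l. (g \<longlongrightarrow> l) (at x within interior R)"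
  shows "(g \<longlongrightarrow> trace_in R g x) (at x within interior R)"
  using l trace_in_eq[OF R x] by auto

text \<open>Existence of the inner limit at every point already forces continuity: near
  \<open>x\<close> all inner values are within \<open>\<epsilon> / 2\<close> of the trace at
  \<open>x\<close>, and the trace at a nearby point is itself a limit of such values.\<close>

lemma continuous_on_trace_in:
  fixes g :: "_ \<Rightarrow> 'b::metric_space"
  assumes R: "polytope R" "interior R \<noteq> {}" and l: "\<And>x. x \<in> R \<Longrightarrow> \<exists>l. (g \<longlongrightarrow> l) (at x within interior R)"
  shows "continuous_on R (trace_in R g)"
  unfolding continuous_on_iff
proof (intro ballI allI impI)
  fix x and \<epsilon> :: real assume x: "x \<in> R" and \<epsilon>: "\<epsilon> > 0"
  have "eventually (\<lambda>y. dist (g y) (trace_in R g x) < \<epsilon> / 2) (at x within interior R)"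
    using tendstoD[OF trace_in_tendsto[OF R x l[OF x]], of "\<epsilon>/2"] \<epsilon> by simp
  then obtain \<delta> where \<delta>: "\<delta> > 0" "\<And>y. y \<in> interior R \<Longrightarrow> y \<noteq> x \<Longrightarrow> dist y x < \<delta> \<Longrightarrow> dist (g y) (trace_in R g x) < \<epsilon> / 2"
    unfolding eventually_at by blast
  show "\<exists>d>0. \<forall>z\<in>R. dist z x < d \<longrightarrow> dist (trace_in R g z) (trace_in R g x) < \<epsilon>"
  proof (intro exI conjI ballI impI)
    fix z assume z: "z \<in> R" "dist z x < \<delta>"
    show "dist (trace_in R g z) (trace_in R g x) < \<epsilon>"
    proof (cases "z = x")
      case False
      \<comment> \<open>The second radius \<open>dist z x\<close> keeps \<open>y\<close> away from
        \<open>x\<close>, where the value of \<open>g\<close> is not controlled by its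
        limit.\<close>
      have "eventually (\<lambda>y. y \<in> ball z (min (\<delta> - dist z x) (dist z x))) (at z within interior R)"
        using z False by (intro eventually_at_in_open'[THEN filter_leD[OF at_le[OF subset_UNIV]]]) auto
      moreover have "eventually (\<lambda>y. y \<in> interior R) (at z within interior R)"
        by (simp add: eventually_at_filter)
      ultimately have "eventually (\<lambda>y. dist (g y) (trace_in R g x) \<le> \<epsilon> / 2) (at z within interior R)"
      proof eventually_elim
        case (elim y)
        have "dist y x \<le> dist y z + dist z x" by (rule dist_triangle)
        then have "dist y x < \<delta>" "y \<noteq> x" using elim(1) by (auto simp: dist_commute)
        then show ?case using \<delta>(2)[OF elim(2)] by (simp add: less_imp_le)
      qed
      moreover have "((\<lambda>y. dist (g y) (trace_in R g x)) \<longlongrightarrow> dist (trace_in R g z) (trace_in R g x)) (at z within interior R)"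
        by (intro tendsto_intros trace_in_tendsto[OF R z(1) l[OF z(1)]])
      ultimately have "dist (trace_in R g z) (trace_in R g x) \<le> \<epsilon> / 2"
        using tendsto_upperbound polytope_limpt[OF R z(1)] by blast
      then show ?thesis using \<epsilon> by simp
    qed (use \<epsilon> in simp)
  qed (rule \<delta>(1))
qed

lemma trace_in_interior:
  assumes R: "polytope R" "interior R \<noteq> {}" and x: "x \<in> interior R" and g: "isCont g x"
  shows "trace_in R g x = g x"
  using g x by (intro trace_in_eq[OF R]) (auto simp: isCont_def interior_subset[THEN subsetD] intro: filterlim_mono[OF _ order_refl at_le])

section \<open>Derivatives by components, scaling of integrals and changes on null sets\<close>

lemma has_derivative_vec_components:
  fixes V :: "'a::real_normed_vector \<Rightarrow> real^3"
  assumes "\<And>i. ((\<lambda>x. V x $ i) has_derivative f' i) (at x)"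
  shows "(V has_derivative (\<lambda>h. \<chi> i. f' i h)) (at x)"
proof -
  have 1: "V = (\<lambda>x. \<Sum>i\<in>UNIV. V x $ i *\<^sub>R axis i 1)"
    using basis_expansion[of "V _"] by (simp add: scalar_mult_eq_scaleR)
  have 2: "(\<lambda>h. \<chi> i. f' i h) = (\<lambda>h. \<Sum>i\<in>UNIV. f' i h *\<^sub>R axis i 1)"
    using basis_expansion[of "\<chi> i. f' i _"] by (auto simp: scalar_mult_eq_scaleR)
  show ?thesis unfolding 2
    by (subst 1) (intro has_derivative_sum has_derivative_scaleR_left assms)
qed

lemma divergence_eq_grad:
  assumes "\<And>i. (\<lambda>x. V x $ i) differentiable (at x)"
  shows "divergence V x = (\<Sum>i\<in>UNIV. grad (\<lambda>x. V x $ i) x $ i)"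
proof -
  have "(V has_derivative (\<lambda>h. \<chi> i. frechet_derivative (\<lambda>x. V x $ i) (at x) h)) (at x)"
    by (rule has_derivative_vec_components) (use assms in \<open>simp add: frechet_derivative_works\<close>)
  then have "frechet_derivative V (at x) = (\<lambda>h. \<chi> i. frechet_derivative (\<lambda>x. V x $ i) (at x) h)"
    by (rule frechet_derivative_at[symmetric])
  then show ?thesis by (simp add: divergence_def grad_def)
qed

lemma lborel_integral_affine:
  fixes F :: "'a::euclidean_space \<Rightarrow> real"
  assumes c: "c > 0" and [measurable]: "F \<in> borel_measurable borel"
  shows "integral\<^sup>L lborel F = c ^ DIM('a) * (\<integral>x. F (t + c *\<^sub>R x) \<partial>lborel)"
proof -
  have "integral\<^sup>L lborel F = integral\<^sup>L (density (distr lborel borel (\<lambda>x. t + c *\<^sub>R x)) (\<lambda>_. ennreal (\<bar>c\<bar>^DIM('a)))) F"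
    using c lborel_affine[of c t] by simp
  also have "\<dots> = (\<integral>x. \<bar>c\<bar>^DIM('a) * F x \<partial>distr lborel borel (\<lambda>x. t + c *\<^sub>R x))"
    by (subst integral_density) auto
  also have "\<dots> = c ^ DIM('a) * (\<integral>x. F (t + c *\<^sub>R x) \<partial>lborel)"
    using c by (simp add: integral_distr)
  finally show ?thesis .
qed

lemma LINT_plane_area_eq:
  fixes w :: "real^3 \<Rightarrow> real"
  assumes n: "norm n = 1" and K: "compact K" "continuous_on K w"
  shows "(\<integral>x. indicator K x * w x \<partial>plane_area n c) = (LINT x:(K \<inter> {x. n \<bullet> x = c})|plane_area n c. w x)"
proof -
  have Kb: "K \<in> sets borel" using K(1) by (simp add: borel_compact)
  have K': "K \<inter> {x. n \<bullet> x = c} \<in> sets borel" using Kb by measurable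
  show ?thesis unfolding set_lebesgue_integral_def
  proof (rule integral_cong_AE)
    show "(\<lambda>x. indicator K x * w x) \<in> borel_measurable (plane_area n c)"
      using borel_measurable_continuous_on_indicator[OF Kb K(2)] by simp
    show "(\<lambda>x. indicator (K \<inter> {x. n \<bullet> x = c}) x *\<^sub>R w x) \<in> borel_measurable (plane_area n c)"
      using borel_measurable_continuous_on_indicator[OF K' continuous_on_subset[OF K(2)]] by simp
    show "AE x in plane_area n c. indicator K x * w x = indicator (K \<inter> {x. n \<bullet> x = c}) x *\<^sub>R w x"
      using AE_plane_area_on_plane[OF n] by eventually_elim (auto simp: indicator_def)
  qed
qed

text \<open>Completeness makes even measurability insensitive to changes on a negligible set, so the
  two functions are integrable together; otherwise both integrals have the default value 0. Skeleton
  values can thus be ignored without measurability arguments.\<close>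

lemma LINT_lebesgue_cong:
  fixes f g :: "'a::euclidean_space \<Rightarrow> 'b::euclidean_space"
  assumes N: "negligible N" and fg: "\<And>x. x \<notin> N \<Longrightarrow> f x = g x"
  shows "integrable lebesgue f \<longleftrightarrow> integrable lebesgue g" "integral\<^sup>L lebesgue f = integral\<^sup>L lebesgue g"
proof -
  have ae: "AE x in lebesgue. f x = g x"
    using N fg unfolding negligible_iff_null_sets by (intro AE_I'[of N]) auto
  have m: "g \<in> borel_measurable lebesgue"
    if fm: "f \<in> borel_measurable lebesgue" and eq: "\<And>x. x \<notin> N \<Longrightarrow> f x = g x" for f g :: "'a \<Rightarrow> 'b"
  proof (rule measurableI)
    fix A :: "'b set" assume "A \<in> sets borel"
    then have "f -` A \<in> sets lebesgue" using measurable_sets[OF fm] by simp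
    moreover have N': "N \<in> null_sets lebesgue" using N by (simp add: negligible_iff_null_sets)
    moreover have "g -` A \<inter> N \<in> sets lebesgue"
      using completion.complete2[OF _ N', of "g -` A \<inter> N"] by (auto simp: null_setsD2)
    moreover have "g -` A \<inter> space lebesgue = (f -` A - N) \<union> (g -` A \<inter> N)" using eq by auto
    ultimately show "g -` A \<inter> space lebesgue \<in> sets lebesgue" by (metis null_setsD2 sets.Diff sets.Un)
  qed simp
  have mm: "f \<in> borel_measurable lebesgue \<longleftrightarrow> g \<in> borel_measurable lebesgue"
  proof
    assume "f \<in> borel_measurable lebesgue" then show "g \<in> borel_measurable lebesgue" by (rule m) (rule fg)
  next
    assume "g \<in> borel_measurable lebesgue" then show "f \<in> borel_measurable lebesgue" by (rule m) (rule fg[symmetric])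
  qed
  show 1: "integrable lebesgue f \<longleftrightarrow> integrable lebesgue g"
  proof (cases "f \<in> borel_measurable lebesgue")
    case True
    then show ?thesis using mm by (intro integrable_cong_AE ae) auto
  next
    case False
    then show ?thesis using mm borel_measurable_integrable by metis
  qed
  show "integral\<^sup>L lebesgue f = integral\<^sup>L lebesgue g"
  proof (cases "integrable lebesgue f")
    case True
    then show ?thesis using 1 ae by (intro integral_cong_AE) auto
  next
    case False
    then show ?thesis using 1 by (simp add: not_integrable_integral_eq)
  qed
qed

lemma negligible_polytope_boundary: "polytope R \<Longrightarrow> negligible (R - interior R)"
  by (rule negligible_subset[OF negligible_convex_frontier[OF polytope_imp_convex]])
     (auto simp: frontier_def closure_subset[THEN subsetD])

theorem divergence_theorem:
  fixes V :: "real^3 \<Rightarrow> real^3"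
  assumes R: "polytope R" "interior R \<noteq> {}"
    and C1: "\<And>i. (\<lambda>x. V x $ i) \<in> C1 (interior R)"
    and lims: "\<And>x. x \<in> R \<Longrightarrow> \<exists>l. (V \<longlongrightarrow> l) (at x within interior R)"
    and int: "set_integrable lebesgue R (divergence V)"
  shows "(LINT x:R|lebesgue. divergence V x) =
    (\<Sum>(n, c)\<in>facets R. LINT x:(R \<inter> {x. n \<bullet> x = c})|plane_area n c. trace_in R V x \<bullet> n)"
proof -
  obtain x0 where x0: "x0 \<in> interior R" using R(2) by auto
  note conv = polytope_imp_convex[OF R(1)] and comp = polytope_imp_compact[OF R(1)]
  \<comment> \<open>Cutting off at the open interior makes the divergence a Borel function and
    alters it on \<open>R\<close> only on a null set.\<close>
  define h where "h x = indicator (interior R) x * divergence V x" for x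
  define G where "G i = grad (\<lambda>x. V x $ i)" for i
  \<comment> \<open>Contraction towards \<open>x0\<close>: for \<open>0 < s < 1\<close> it maps all
    of \<open>R\<close> into the interior, so the contracted field is continuously differentiable up
    to the boundary and \<open>gauss_directional\<close> applies.\<close>
  define \<sigma> where "\<sigma> s x = (x0 - s *\<^sub>R x0) + s *\<^sub>R x" for s x
  have diff: "(\<lambda>x. V x $ i) differentiable (at x)" if "x \<in> interior R" for x i
    using C1[of i] that by (auto simp: C1_def)
  have Gc: "continuous_on (interior R) (G i)" for i
    using C1[of i] by (auto simp: C1_def G_def)
  have dG: "divergence V x = (\<Sum>i\<in>UNIV. G i x $ i)" if "x \<in> interior R" for x
    unfolding G_def by (rule divergence_eq_grad) (rule diff[OF that])
  have \<sigma>in: "\<sigma> s x \<in> interior R" if "x \<in> R" "0 < s" "s < 1" for s x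
  proof -
    have "x - (1 - s) *\<^sub>R (x - x0) \<in> interior R"
      using that by (intro mem_interior_convex_shrink[OF conv x0]) auto
    moreover have "x - (1 - s) *\<^sub>R (x - x0) = \<sigma> s x" by (simp add: \<sigma>_def algebra_simps)
    ultimately show ?thesis by simp
  qed
  have \<sigma>c: "continuous_on S (\<sigma> s)" for S s unfolding \<sigma>_def by (intro continuous_intros)
  have Vcont: "isCont V x" if "x \<in> interior R" for x
  proof -
    have "(V has_derivative (\<lambda>h. \<chi> i. frechet_derivative (\<lambda>x. V x $ i) (at x) h)) (at x)"
      by (rule has_derivative_vec_components) (use diff[OF that] in \<open>simp add: frechet_derivative_works\<close>)
    then show ?thesis by (rule has_derivative_continuous)
  qed
  have tr: "trace_in R V x = V x" if "x \<in> interior R" for x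
    using trace_in_interior[OF R that Vcont[OF that]] .
  have trc: "continuous_on R (trace_in R V)" by (rule continuous_on_trace_in[OF R lims])
  have V\<sigma>: "continuous_on R (\<lambda>x. V (\<sigma> s x))" if "0 < s" "s < 1" for s
    by (rule continuous_on_compose2[of "interior R" V])
       (use Vcont \<sigma>in[OF _ that] in \<open>auto intro!: \<sigma>c continuous_at_imp_continuous_on\<close>)
  have fin: "finite (facets R)" by (rule finite_facets[OF R])
  have hm: "h \<in> borel_measurable borel"
  proof -
    have "continuous_on (interior R) (\<lambda>x. \<Sum>i\<in>UNIV. G i x $ i)" by (intro continuous_intros Gc)
    then have "continuous_on (interior R) (divergence V)" by (simp add: dG cong: continuous_on_cong)
    from borel_measurable_continuous_on_indicator[OF _ this] show ?thesis unfolding h_def by simp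
  qed
  have hR: "indicator R x *\<^sub>R divergence V x = h x" if "x \<notin> R - interior R" for x
    using that interior_subset[of R] by (auto simp: h_def indicator_def)
  have hi: "integrable lborel h"
    using LINT_lebesgue_cong(1)[OF negligible_polytope_boundary[OF R(1)] hR] int hm
    by (simp add: set_integrable_def integrable_completion)
  have hI: "(LINT x:R|lebesgue. divergence V x) = integral\<^sup>L lborel h"
    using LINT_lebesgue_cong(2)[OF negligible_polytope_boundary[OF R(1)] hR] hm
    by (simp add: set_lebesgue_integral_def integral_completion)
  \<comment> \<open>The factor \<open>s\<close> on the left is the chain rule for the
    contraction.\<close>
  have step: "s * (\<integral>x. indicator R x * h (\<sigma> s x) \<partial>lborel) =
     (\<Sum>i\<in>facets R. \<integral>x. indicator R x * (V (\<sigma> s x) \<bullet> fst i) \<partial>plane_area (fst i) (snd i))"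
    if s: "0 < s" "s < 1" for s
  proof -
    have G\<sigma>: "continuous_on R (\<lambda>x. G j (\<sigma> s x) $ j)" for j
      by (intro continuous_intros continuous_on_compose2[OF Gc \<sigma>c]) (use \<sigma>in[OF _ s] in auto)
    have 1: "(\<integral>x. indicator R x * (s * G j (\<sigma> s x) $ j) \<partial>lborel) =
      (\<Sum>i\<in>facets R. (fst i \<bullet> axis j 1) * (\<integral>x. indicator R x * V (\<sigma> s x) $ j \<partial>plane_area (fst i) (snd i)))" for j
    proof (rule gauss_directional[OF fin polytope_eq_facets[OF R] comp])
      fix y assume y: "y \<in> R"
      have "((\<lambda>x. V x $ j) has_derivative frechet_derivative (\<lambda>x. V x $ j) (at (\<sigma> s y))) (at (\<sigma> s y))"
        using diff[OF \<sigma>in[OF y s]] by (simp add: frechet_derivative_works)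
      then have D: "((\<lambda>x. V x $ j) has_derivative frechet_derivative (\<lambda>x. V x $ j) (at (\<sigma> s y))) (at (\<sigma> s y + (s * 0) *\<^sub>R axis j 1))"
        by simp
      have "((\<lambda>u. \<sigma> s y + (s * u) *\<^sub>R axis j 1) has_derivative (\<lambda>u. (s * u) *\<^sub>R axis j 1)) (at 0)"
        by (auto intro!: derivative_eq_intros)
      from has_derivative_compose[OF this D]
      have "((\<lambda>u. V (\<sigma> s y + (s * u) *\<^sub>R axis j 1) $ j) has_derivative
         (\<lambda>u. frechet_derivative (\<lambda>x. V x $ j) (at (\<sigma> s y)) ((s * u) *\<^sub>R axis j 1))) (at 0)" .
      moreover have "\<sigma> s y + (s * u) *\<^sub>R axis j 1 = \<sigma> s (y + u *\<^sub>R axis j 1)" for u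
        by (simp add: \<sigma>_def algebra_simps)
      moreover have "frechet_derivative (\<lambda>x. V x $ j) (at (\<sigma> s y)) ((s * u) *\<^sub>R axis j 1) = s * G j (\<sigma> s y) $ j * u" for u
        using linear_frechet_derivative[OF diff[OF \<sigma>in[OF y s]], of j]
        by (simp add: linear_scale G_def grad_def)
      ultimately show "((\<lambda>u. V (\<sigma> s (y + u *\<^sub>R axis j 1)) $ j) has_real_derivative s * G j (\<sigma> s y) $ j) (at 0)"
        by (simp add: has_field_derivative_def)
    next
      show "continuous_on R (\<lambda>x. V (\<sigma> s x) $ j)" by (intro continuous_intros V\<sigma> s)
      show "continuous_on R (\<lambda>x. s * G j (\<sigma> s x) $ j)" by (intro continuous_intros G\<sigma>)
    qed (use facets_props(1) facets_no_antipode[OF R(2)] in auto)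
    have Rb: "R \<in> sets borel" using comp by (simp add: borel_compact)
    have int_vol: "integrable lborel (\<lambda>x. indicator R x * (s * G j (\<sigma> s x) $ j))" for j
      using borel_integrable_compact[OF comp continuous_on_mult_left[OF G\<sigma>, of s j]] by (simp add: indicator_scaleR_eq_if indicator_def if_distrib cong: if_cong)
    have int_srf: "integrable (plane_area (fst i) (snd i)) (\<lambda>x. indicator R x * (V (\<sigma> s x) $ j))" if "i \<in> facets R" for i j
      using set_integrable_plane_area[OF facets_props(1)[OF that] comp, of "\<lambda>x. V (\<sigma> s x) $ j" R] Rb
      by (simp add: set_integrable_def V\<sigma> s continuous_intros)
    have "s * (\<integral>x. indicator R x * h (\<sigma> s x) \<partial>lborel) = (\<integral>x. (\<Sum>j\<in>UNIV. indicator R x * (s * G j (\<sigma> s x) $ j)) \<partial>lborel)"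
      by (subst integral_mult_right_zero[symmetric], rule Bochner_Integration.integral_cong)
         (auto simp: h_def \<sigma>in[OF _ s] dG sum_distrib_left indicator_def)
    also have "\<dots> = (\<Sum>j\<in>UNIV. \<integral>x. indicator R x * (s * G j (\<sigma> s x) $ j) \<partial>lborel)"
      by (rule Bochner_Integration.integral_sum) (rule int_vol)
    also have "\<dots> = (\<Sum>i\<in>facets R. \<Sum>j\<in>UNIV. (fst i \<bullet> axis j 1) * (\<integral>x. indicator R x * V (\<sigma> s x) $ j \<partial>plane_area (fst i) (snd i)))"
      unfolding 1 by (rule sum.swap)
    also have "\<dots> = (\<Sum>i\<in>facets R. \<integral>x. indicator R x * (V (\<sigma> s x) \<bullet> fst i) \<partial>plane_area (fst i) (snd i))"
    proof (rule sum.cong[OF refl])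
      fix i assume i: "i \<in> facets R"
      have "(\<Sum>j\<in>UNIV. (fst i \<bullet> axis j 1) * (\<integral>x. indicator R x * V (\<sigma> s x) $ j \<partial>plane_area (fst i) (snd i))) =
        (\<Sum>j\<in>UNIV. (\<integral>x. (fst i \<bullet> axis j 1) * (indicator R x * V (\<sigma> s x) $ j) \<partial>plane_area (fst i) (snd i)))"
        by simp
      also have "\<dots> = (\<integral>x. (\<Sum>j\<in>UNIV. (fst i \<bullet> axis j 1) * (indicator R x * V (\<sigma> s x) $ j)) \<partial>plane_area (fst i) (snd i))"
        by (rule Bochner_Integration.integral_sum[symmetric]) (intro integrable_mult_right int_srf i)
      also have "\<dots> = (\<integral>x. indicator R x * (V (\<sigma> s x) \<bullet> fst i) \<partial>plane_area (fst i) (snd i))"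
      proof -
        have "fst i \<bullet> axis j 1 = fst i $ j" for j by (simp add: inner_axis)
        then have "(\<Sum>j\<in>UNIV. (fst i \<bullet> axis j 1) * (indicator R x * V (\<sigma> s x) $ j)) =
          indicator R x * (V (\<sigma> s x) \<bullet> fst i)" for x
          by (simp add: inner_vec_def sum_distrib_left mult_ac)
        then show ?thesis by simp
      qed
      finally show "(\<Sum>j\<in>UNIV. (fst i \<bullet> axis j 1) * (\<integral>x. indicator R x * V (\<sigma> s x) $ j \<partial>plane_area (fst i) (snd i))) =
         (\<integral>x. indicator R x * (V (\<sigma> s x) \<bullet> fst i) \<partial>plane_area (fst i) (snd i))" .
    qed
    finally show ?thesis .
  qed
  \<comment> \<open>A sequence of admissible factors tending to 1; the \<open>+ 2\<close> gives
    \<open>S 0 = 1/2\<close>, so all members are positive.\<close>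
  define S where "S k = 1 - 1 / (real k + 2)" for k :: nat
  have S: "0 < S k" "S k < 1" for k by (auto simp: S_def field_simps)
  have Slim: "S \<longlonglongrightarrow> 1"
  proof -
    have "(\<lambda>k. 1 / (real k + 2)) \<longlonglongrightarrow> 0"
      using LIMSEQ_ignore_initial_segment[OF lim_1_over_n, of 2] by (simp add: add.commute)
    from tendsto_diff[OF tendsto_const this, of 1] show ?thesis by (simp add: S_def[abs_def])
  qed
  have \<sigma>lim: "(\<lambda>k. \<sigma> (S k) x) \<longlonglongrightarrow> x" for x
  proof -
    have "(\<lambda>k. (x0 - S k *\<^sub>R x0) + S k *\<^sub>R x) \<longlonglongrightarrow> (x0 - 1 *\<^sub>R x0) + 1 *\<^sub>R x"
      by (intro tendsto_intros Slim)
    then show ?thesis by (simp add: \<sigma>_def)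
  qed
  define IV where "IV k = (\<integral>x. indicator R x * h (\<sigma> (S k) x) \<partial>lborel)" for k
  \<comment> \<open>The divergence is integrable but possibly unbounded near the boundary, so the
    contracted integrands have no obvious common majorant. Substituting with the inverse
    \<open>\<tau>\<close> leaves \<open>h\<close> in place and moves only the indicator; then
    \<open>|h|\<close> dominates, at the cost of the Jacobian \<open>S k ^ 3\<close>, which tends to
    1.\<close>
  have IVlim: "IV \<longlonglongrightarrow> integral\<^sup>L lborel h"
  proof -
    define \<tau> where "\<tau> k y = (1 / S k) *\<^sub>R (y - (x0 - S k *\<^sub>R x0))" for k y
    have \<tau>\<sigma>: "\<tau> k (\<sigma> (S k) x) = x" for k x using S(1)[of k] by (simp add: \<tau>_def \<sigma>_def)
    have \<tau>lim: "(\<lambda>k. \<tau> k y) \<longlonglongrightarrow> y" for y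
    proof -
      have "(\<lambda>k. (1 / S k) *\<^sub>R (y - (x0 - S k *\<^sub>R x0))) \<longlonglongrightarrow> (1/1) *\<^sub>R (y - (x0 - 1 *\<^sub>R x0))"
        by (intro tendsto_intros Slim) auto
      then show ?thesis by (simp add: \<tau>_def)
    qed
    have Rb: "R \<in> sets borel" using comp by (simp add: borel_compact)
    have \<tau>m: "\<tau> k \<in> borel_measurable borel" for k unfolding \<tau>_def by measurable
    have Fm: "(\<lambda>y. indicator R (\<tau> k y) * h y) \<in> borel_measurable borel" for k
      using hm \<tau>m[of k] Rb by measurable
    have "(\<integral>y. indicator R (\<tau> k y) * h y \<partial>lborel) = S k ^ 3 * IV k" for k
      using lborel_integral_affine[OF S(1)[of k] Fm[of k], of "x0 - S k *\<^sub>R x0"]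
      by (simp add: \<tau>\<sigma>[unfolded \<sigma>_def] IV_def \<sigma>_def)
    then have IV: "IV k = (\<integral>y. indicator R (\<tau> k y) * h y \<partial>lborel) / S k ^ 3" for k
      using S(1)[of k] by simp
    have "(\<lambda>k. \<integral>y. indicator R (\<tau> k y) * h y \<partial>lborel) \<longlonglongrightarrow> integral\<^sup>L lborel h"
    proof (rule integral_dominated_convergence)
      show "integrable lborel (\<lambda>x. norm (h x))" using hi by simp
      show "AE y in lborel. (\<lambda>k. indicator R (\<tau> k y) * h y) \<longlonglongrightarrow> h y"
      proof (intro AE_I2)
        fix y
        show "(\<lambda>k. indicator R (\<tau> k y) * h y) \<longlonglongrightarrow> h y"
        proof (cases "y \<in> interior R")
          case True
          have "eventually (\<lambda>k. \<tau> k y \<in> interior R) sequentially"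
            using topological_tendstoD[OF \<tau>lim open_interior True] .
          then have "eventually (\<lambda>k. indicator R (\<tau> k y) * h y = h y) sequentially"
            by eventually_elim (use interior_subset[of R] in \<open>auto simp: indicator_def\<close>)
          then show ?thesis by (rule tendsto_eventually)
        qed (simp add: h_def)
      qed
      show "AE y in lborel. norm (indicator R (\<tau> k y) * h y) \<le> norm (h y)" for k
        by (intro AE_I2) (auto simp: indicator_def)
    qed (use hm Fm in auto)
    from tendsto_divide[OF this tendsto_power[OF Slim, of 3]]
    have "(\<lambda>k. (\<integral>y. indicator R (\<tau> k y) * h y \<partial>lborel) / S k ^ 3) \<longlonglongrightarrow> integral\<^sup>L lborel h"
      by simp
    moreover have "IV = (\<lambda>k. (\<integral>y. indicator R (\<tau> k y) * h y \<partial>lborel) / S k ^ 3)"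
      by (rule ext) (rule IV)
    ultimately show ?thesis by (simp only:)
  qed
  have lim1: "(\<lambda>k. S k * IV k) \<longlonglongrightarrow> integral\<^sup>L lborel h"
    using tendsto_mult[OF Slim IVlim] unfolding mult_1 .
  \<comment> \<open>On the surface the trace is continuous on the compact element, hence bounded. It
    coincides with \<open>V\<close> at the contracted points, which gives both convergence and the
    majorant.\<close>
  have lim2: "(\<lambda>k. \<integral>x. indicator R x * (V (\<sigma> (S k) x) \<bullet> fst i) \<partial>plane_area (fst i) (snd i)) \<longlonglongrightarrow>
     (\<integral>x. indicator R x * (trace_in R V x \<bullet> fst i) \<partial>plane_area (fst i) (snd i))" if i: "i \<in> facets R" for i
  proof -
    have Rb: "R \<in> sets borel" using comp by (simp add: borel_compact)
    have "bounded (trace_in R V ` R)" using compact_continuous_image[OF trc comp] compact_imp_bounded by blast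
    then obtain C where C: "\<And>x. x \<in> R \<Longrightarrow> norm (trace_in R V x) \<le> C" by (auto simp: bounded_iff)
    show ?thesis
    proof (rule integral_dominated_convergence)
      show "integrable (plane_area (fst i) (snd i)) (\<lambda>x. indicator R x * C)"
        by (intro integrable_mult_left integrable_real_indicator)
          (use Rb emeasure_plane_area_bounded[OF facets_props(1)[OF i] Rb compact_imp_bounded[OF comp]] in auto)
      show "(\<lambda>x. indicator R x * (trace_in R V x \<bullet> fst i)) \<in> borel_measurable (plane_area (fst i) (snd i))"
        using borel_measurable_continuous_on_indicator[OF Rb continuous_on_inner[OF trc continuous_on_const, of "fst i"]]
        by simp
      show "(\<lambda>x. indicator R x * (V (\<sigma> (S k) x) \<bullet> fst i)) \<in> borel_measurable (plane_area (fst i) (snd i))" for k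
        using borel_measurable_continuous_on_indicator[OF Rb continuous_on_inner[OF V\<sigma>[OF S, of k] continuous_on_const, of "fst i"]]
        by simp
      show "AE x in plane_area (fst i) (snd i). (\<lambda>k. indicator R x * (V (\<sigma> (S k) x) \<bullet> fst i)) \<longlonglongrightarrow> indicator R x * (trace_in R V x \<bullet> fst i)"
      proof (intro AE_I2)
        fix x
        show "(\<lambda>k. indicator R x * (V (\<sigma> (S k) x) \<bullet> fst i)) \<longlonglongrightarrow> indicator R x * (trace_in R V x \<bullet> fst i)"
        proof (cases "x \<in> R")
          case True
          have in_R: "\<sigma> (S k) x \<in> R" for k using \<sigma>in[OF True S] interior_subset by blast
          have "(\<lambda>k. trace_in R V (\<sigma> (S k) x)) \<longlonglongrightarrow> trace_in R V x"
            using continuous_on_tendsto_compose[OF trc \<sigma>lim True] in_R by simp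
          then have "(\<lambda>k. V (\<sigma> (S k) x)) \<longlonglongrightarrow> trace_in R V x"
            using tr[OF \<sigma>in[OF True S]] by simp
          then show ?thesis by (intro tendsto_intros)
        qed simp
      qed
      show "AE x in plane_area (fst i) (snd i). norm (indicator R x * (V (\<sigma> (S k) x) \<bullet> fst i)) \<le> indicator R x * C" for k
      proof (intro AE_I2)
        fix x
        show "norm (indicator R x * (V (\<sigma> (S k) x) \<bullet> fst i)) \<le> indicator R x * C"
        proof (cases "x \<in> R")
          case True
          have "\<bar>V (\<sigma> (S k) x) \<bullet> fst i\<bar> \<le> norm (V (\<sigma> (S k) x)) * norm (fst i)" by (rule Cauchy_Schwarz_ineq2)
          also have "\<dots> = norm (trace_in R V (\<sigma> (S k) x))" using tr[OF \<sigma>in[OF True S]] facets_props(1)[OF i] by simp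
          also have "\<dots> \<le> C" using C \<sigma>in[OF True S] interior_subset by blast
          finally show ?thesis using True by simp
        qed simp
      qed
    qed
  qed
  have "(\<lambda>k. S k * IV k) \<longlonglongrightarrow> (\<Sum>i\<in>facets R. \<integral>x. indicator R x * (trace_in R V x \<bullet> fst i) \<partial>plane_area (fst i) (snd i))"
    unfolding IV_def step[OF S] by (intro tendsto_sum lim2)
  from LIMSEQ_unique[OF lim1 this]
  have "integral\<^sup>L lborel h = (\<Sum>i\<in>facets R. \<integral>x. indicator R x * (trace_in R V x \<bullet> fst i) \<partial>plane_area (fst i) (snd i))" .
  also have "\<dots> = (\<Sum>i\<in>facets R. LINT x:(R \<inter> {x. fst i \<bullet> x = snd i})|plane_area (fst i) (snd i). trace_in R V x \<bullet> fst i)"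
    by (intro sum.cong[OF refl] LINT_plane_area_eq comp continuous_intros trc facets_props(1))
  finally show ?thesis using hI by (simp add: split_beta')
qed

subsection \<open>Interfaces of the mesh\<close>

locale admissible_discretization =
  fixes k :: nat and rg :: regime and d :: discretization
  assumes adm: "admissible k rg d"
begin

abbreviation "\<Omega> \<equiv> Omega d"
abbreviation "T \<equiv> mesh d"

text \<open>The domain up to the mesh skeleton, a null set. Members of the broken space are
  constrained only here, so pointwise identities between them are claimed only here.\<close>

definition inner_region :: "(real^3) set" where
  "inner_region = (\<Union>R\<in>T. interior R)"

lemma finite_mesh: "finite T" and open_domain: "open \<Omega>" and mesh_cover: "\<Union>T = closure \<Omega>"
  and interior_subset_domain: "R \<in> T \<Longrightarrow> interior R \<subseteq> \<Omega>"
  and interior_disjoint: "R \<in> T \<Longrightarrow> R' \<in> T \<Longrightarrow> R \<noteq> R' \<Longrightarrow> interior R \<inter> interior R' = {}"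
  and refdir_transverse: "(R, R', n, c) \<in> oriented_faces d \<Longrightarrow> n \<bullet> refdir d \<noteq> 0"
  using adm by (auto simp: admissible_def is_mesh_def)

lemma element_polytope: "R \<in> T \<Longrightarrow> polytope R"
  using adm simplex_imp_polytope[of 3 R]
  by (auto simp: admissible_def is_mesh_def cartesian_box_def polytope_interval)

lemma element_interior: assumes "R \<in> T" shows "interior R \<noteq> {}"
proof -
  consider "cartesian_box R" | "3 simplex R"
    using adm assms by (auto simp: admissible_def is_mesh_def)
  then show ?thesis
  proof cases
    case 1
    then obtain a b where ab: "\<And>i. a $ i < b $ i" "R = cbox a b" by (auto simp: cartesian_box_def)
    then have "box a b \<noteq> {}"
      by (auto simp: box_ne_empty Basis_vec_def inner_axis)
    then show ?thesis using ab(2) by simp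
  next
    case 2
    then have "aff_dim R = 3" by (rule aff_dim_simplex)
    then have "affine hull R = UNIV" by (simp add: aff_dim_eq_full[symmetric])
    moreover have "rel_interior R \<noteq> {}"
      using 2 \<open>aff_dim R = 3\<close> by (auto simp: rel_interior_eq_empty convex_simplex)
    ultimately show ?thesis by (simp add: rel_interior_interior)
  qed
qed

lemmas element = element_polytope element_interior

lemma element_convex: "R \<in> T \<Longrightarrow> convex R"
  and element_compact: "R \<in> T \<Longrightarrow> compact R"
  and element_closed: "R \<in> T \<Longrightarrow> closed R"
  using element_polytope polytope_imp_convex polytope_imp_compact polytope_imp_closed by blast+

lemma element_sets [measurable]: "R \<in> T \<Longrightarrow> R \<in> sets borel"
  by (simp add: element_closed borel_closed)

lemma domain_sets [measurable]: "\<Omega> \<in> sets borel"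
  by (simp add: open_domain)

lemma element_not_in_plane: assumes "R \<in> T" "norm n = 1" shows "\<not> R \<subseteq> {x. n \<bullet> x = c}"
proof
  assume "R \<subseteq> {x. n \<bullet> x = c}"
  then have "interior R \<subseteq> interior {x. n \<bullet> x = c}" by (rule interior_mono)
  moreover have "n \<noteq> 0" using assms(2) by auto
  ultimately show False using element_interior[OF assms(1)] by simp
qed

text \<open>Disjoint convex interiors are separated by a plane, and each element is the closure of
  its interior. Together with \<open>hyperplane_unique\<close> this pins down the plane of a shared
  face, also in the presence of hanging nodes.\<close>

lemma elements_separated:
  assumes R: "R \<in> T" "R' \<in> T" "R \<noteq> R'"
  obtains n c where "norm n = 1" "R \<subseteq> {x. n \<bullet> x \<le> c}" "R' \<subseteq> {x. c \<le> n \<bullet> x}"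
proof -
  obtain a b where ab: "a \<noteq> 0" "\<forall>x\<in>interior R. a \<bullet> x \<le> b" "\<forall>x\<in>interior R'. b \<le> a \<bullet> x"
    using separating_hyperplane_sets[of "interior R" "interior R'"] R
    by (meson convex_interior element_convex element_interior interior_disjoint)
  have cl: "S \<subseteq> H" if "S \<in> T" "interior S \<subseteq> H" "closed H" for S H
  proof -
    have "S \<subseteq> closure (interior S)"
      using convex_closure_interior[OF element_convex element_interior] that(1) closure_subset by blast
    also have "\<dots> \<subseteq> H" using that(2,3) by (simp add: closure_minimal)
    finally show ?thesis .
  qed
  have "R \<subseteq> {x. a \<bullet> x \<le> b}" by (rule cl) (use R ab closed_halfspace_le in auto)
  moreover have "R' \<subseteq> {x. b \<le> a \<bullet> x}"
    by (rule cl) (use R ab closed_halfspace_ge[of b a] in auto)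
  ultimately show ?thesis
    using ab(1) that[of "a /\<^sub>R norm a" "b / norm a"] by (auto simp: field_simps subset_iff)
qed

section \<open>Orientation of interfaces\<close>

lemma oriented_facesD:
  assumes "(R, R', n, c) \<in> oriented_faces d"
  shows "R \<in> T" "R' \<in> T" "R \<noteq> R'" "(n, c) \<in> facets R" "norm n = 1" "R \<inter> R' \<subseteq> {x. n \<bullet> x = c}"
    "aff_dim (R \<inter> R' \<inter> \<Omega>) = 2" "R \<subseteq> {x. n \<bullet> x \<le> c}"
  using assms facets_props(1)[of "(n,c)" R] facets_props(2)[of "(n,c)" R]
  by (auto simp: oriented_faces_def)

text \<open>Any plane separating the two elements contains their two-dimensional intersection and so
  is the plane of the face; the opposite orientation would flatten \<open>R\<close>.\<close>

lemma neighbour_above: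
  assumes "(R, R', n, c) \<in> oriented_faces d"
  shows "R' \<subseteq> {x. c \<le> n \<bullet> x}"
proof -
  note D = oriented_facesD[OF assms]
  obtain m r where m: "norm m = 1" "R \<subseteq> {x. m \<bullet> x \<le> r}" "R' \<subseteq> {x. r \<le> m \<bullet> x}"
    using elements_separated[OF D(1-3)] by blast
  have "R \<inter> R' \<inter> \<Omega> \<subseteq> {x. m \<bullet> x = r}" using m by force
  moreover have "R \<inter> R' \<inter> \<Omega> \<subseteq> {x. n \<bullet> x = c}" using D(6) by blast
  ultimately consider "m = n" "r = c" | "m = - n" "r = - c"
    using hyperplane_unique[OF D(7) _ _ D(5) m(1)] by blast
  then show ?thesis
  proof cases
    case 1 then show ?thesis using m by simp
  next
    case 2
    then have "R \<subseteq> {x. n \<bullet> x = c}" using m(2) D(8) by force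
    then show ?thesis using element_not_in_plane[OF D(1,5)] by blast
  qed
qed

text \<open>The definition demands a facet on the minus side only. The plane supports the neighbour
  too, and the face it cuts out there contains the two-dimensional interface, hence is a
  facet.\<close>

lemma oriented_faces_swap:
  assumes "(R, R', n, c) \<in> oriented_faces d"
  shows "(R', R, - n, - c) \<in> oriented_faces d"
proof -
  note D = oriented_facesD[OF assms] and A = neighbour_above[OF assms]
  let ?F = "R' \<inter> {x. n \<bullet> x = c}"
  have F: "?F face_of R'"
    using A by (intro face_of_Int_supporting_hyperplane_ge element_convex D) auto
  have sub: "R \<inter> R' \<inter> \<Omega> \<subseteq> ?F" using D(6) by blast
  have "n \<noteq> 0" using D(5) by auto
  have "aff_dim ?F \<le> aff_dim {x. n \<bullet> x = c}" by (rule aff_dim_subset) auto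
  also have "\<dots> = 2" using \<open>n \<noteq> 0\<close> by simp
  finally have "aff_dim ?F = 2" using aff_dim_subset[OF sub] D(7) by simp
  moreover have "aff_dim R' = 3" using aff_dim_nonempty_interior[OF element_interior[OF D(2)]] by simp
  ultimately have "?F facet_of R'" using F by (auto simp: facet_of_def)
  then have "(- n, - c) \<in> facets R'" using A D(5) by (auto simp: facets_def)
  then show ?thesis using D by (auto simp: oriented_faces_def Int_commute)
qed

lemma oriented_faces_Sigma:
  "oriented_faces d = (\<lambda>((R, i), R'). (R, R', i)) `
     (SIGMA p:(SIGMA R:T. facets R). {R'. (fst p, R', snd p) \<in> oriented_faces d})"
  (is "?L = ?f ` ?S")
proof
  show "?L \<subseteq> ?f ` ?S"
  proof
    fix e assume e: "e \<in> ?L"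
    obtain R R' n c where E: "e = (R, R', n, c)" by (metis prod.collapse)
    have "((R, (n, c)), R') \<in> ?S" using e oriented_facesD(1,4)[of R R' n c] by (simp add: E)
    then show "e \<in> ?f ` ?S" by (rule rev_image_eqI) (simp add: E)
  qed
  show "?f ` ?S \<subseteq> ?L" by auto
qed

lemma finite_neighbours: "finite {R'. (R, R', i) \<in> oriented_faces d}"
  by (rule finite_subset[OF _ finite_mesh]) (use oriented_facesD in \<open>cases i, auto\<close>)

lemma finite_element_facets: "R \<in> T \<Longrightarrow> finite (facets R)"
  by (rule finite_facets[OF element])

lemma finite_oriented_faces: "finite (oriented_faces d)"
  by (subst oriented_faces_Sigma)
     (intro finite_imageI finite_SigmaI finite_mesh finite_element_facets finite_neighbours)

text \<open>Regroups the interfaces by element and facet, the form in which the divergence theorem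
  delivers boundary terms.\<close>

lemma sum_oriented_faces:
  "(\<Sum>e\<in>oriented_faces d. g e) = (\<Sum>R\<in>T. \<Sum>i\<in>facets R. \<Sum>R' | (R, R', i) \<in> oriented_faces d. g (R, R', i))"
proof -
  have "(\<Sum>e\<in>oriented_faces d. g e) =
    (\<Sum>((R, i), R')\<in>(SIGMA p:(SIGMA R:T. facets R). {R'. (fst p, R', snd p) \<in> oriented_faces d}). g (R, R', i))"
    by (subst oriented_faces_Sigma, subst sum.reindex) (auto simp: inj_on_def split_beta' intro!: sum.cong)
  also have "\<dots> = (\<Sum>(R, i)\<in>(SIGMA R:T. facets R). \<Sum>R' | (R, R', i) \<in> oriented_faces d. g (R, R', i))"
    by (subst sum.Sigma[symmetric])
       (auto simp: split_beta' finite_neighbours intro!: finite_SigmaI finite_mesh finite_element_facets)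
  also have "\<dots> = (\<Sum>R\<in>T. \<Sum>i\<in>facets R. \<Sum>R' | (R, R', i) \<in> oriented_faces d. g (R, R', i))"
    by (subst sum.Sigma) (auto simp: split_beta' finite_mesh finite_element_facets)
  finally show ?thesis .
qed

text \<open>If no other element contained \<open>x\<close>, a small step along the outward normal
  would leave \<open>R\<close>, stay in the domain and avoid the other elements, which are finitely
  many closed sets; the mesh would not cover that point.\<close>

lemma face_covered:
  assumes R: "R \<in> T" and i: "(n, c) \<in> facets R" and x: "x \<in> R" "n \<bullet> x = c" "x \<in> \<Omega>"
  shows "\<exists>R'\<in>T. R' \<noteq> R \<and> x \<in> R'"
proof (rule ccontr)
  assume "\<not> ?thesis"
  then have "x \<in> \<Omega> - \<Union>(T - {R})" using x by auto
  moreover have "open (\<Omega> - \<Union>(T - {R}))"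
    using finite_mesh element_closed by (intro open_Diff open_domain closed_Union) auto
  ultimately obtain \<epsilon> where \<epsilon>: "\<epsilon> > 0" "ball x \<epsilon> \<subseteq> \<Omega> - \<Union>(T - {R})" using open_contains_ball by blast
  have n: "norm n = 1" using facets_props(1)[OF i] by simp
  define y where "y = x + (\<epsilon> / 2) *\<^sub>R n"
  have "y \<in> ball x \<epsilon>" using \<epsilon>(1) n by (simp add: y_def dist_norm)
  then have y: "y \<in> \<Omega>" "y \<notin> \<Union>(T - {R})" using \<epsilon>(2) by auto
  then have "y \<in> \<Union>T" using mesh_cover closure_subset by blast
  then have "y \<in> R" using y(2) by auto
  then have "n \<bullet> y \<le> c" using facets_props(2)[OF i] by simp
  moreover have "n \<bullet> y = c + \<epsilon> / 2" using n x(2) by (simp add: y_def inner_add_right dot_square_norm)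
  ultimately show False using \<epsilon>(1) by simp
qed

text \<open>Up to area-null sets a facet is the disjoint union of its interfaces and of its part on
  the boundary of the domain. With hanging nodes one facet may carry several interfaces, so both
  coverage and disjointness have to be shown almost everywhere.\<close>

lemma facet_integral_split:
  fixes w :: "real^3 \<Rightarrow> real"
  assumes R: "R \<in> T" and i: "(n, c) \<in> facets R" and w: "continuous_on R w"
  shows "(LINT x:(R \<inter> {x. n \<bullet> x = c})|plane_area n c. w x) =
    (\<Sum>R' | (R, R', n, c) \<in> oriented_faces d. LINT x:(R \<inter> R' \<inter> \<Omega>)|plane_area n c. w x) +
    (LINT x:(R \<inter> {x. n \<bullet> x = c} \<inter> frontier \<Omega>)|plane_area n c. w x)"
proof -
  define N where "N = {R'. (R, R', n, c) \<in> oriented_faces d}"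
  have finN: "finite N" unfolding N_def by (rule finite_neighbours)
  have NT: "R' \<in> T" "R' \<noteq> R" if "R' \<in> N" for R' using that oriented_facesD unfolding N_def by blast+
  have n: "norm n = 1" using facets_props(1)[OF i] by simp
  then have n0: "n \<noteq> 0" by auto
  let ?P = "{x. n \<bullet> x = c}"
  have inP: "aff_dim S \<le> 2" if "S \<subseteq> ?P" for S
    using aff_dim_subset[OF that] n0 by simp
  \<comment> \<open>Contact of full dimension makes an element a neighbour across this facet;
    contacts of lower dimension are null sets.\<close>
  have nb: "R' \<in> N" if R': "R' \<in> T" "R' \<noteq> R" and a: "\<not> aff_dim (R \<inter> ?P \<inter> R' \<inter> \<Omega>) < 2" for R'
  proof -
    have a2: "aff_dim (R \<inter> ?P \<inter> R' \<inter> \<Omega>) = 2" using inP[of "R \<inter> ?P \<inter> R' \<inter> \<Omega>"] a by force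
    obtain m r where m: "norm m = 1" "R \<subseteq> {x. m \<bullet> x \<le> r}" "R' \<subseteq> {x. r \<le> m \<bullet> x}"
      using elements_separated[OF R R'(1)] R'(2) by metis
    have RR: "R \<inter> R' \<subseteq> {x. m \<bullet> x = r}" using m by force
    then have "(m = n \<and> r = c) \<or> (m = - n \<and> r = - c)"
      by (intro hyperplane_unique[OF a2 _ _ n m(1)]) auto
    then have RP: "R \<inter> R' \<subseteq> ?P" using RR by auto
    then have "R \<inter> R' \<inter> \<Omega> = R \<inter> ?P \<inter> R' \<inter> \<Omega>" by auto
    then show ?thesis using a2 RP R R' i by (auto simp: N_def oriented_faces_def)
  qed
  \<comment> \<open>Two neighbours with a two-dimensional common part would be separated by the
    plane of the facet, although both lie above it; one of them would be flat.\<close>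
  have ov: "aff_dim (R \<inter> R1 \<inter> R2) < 2" if N12: "R1 \<in> N" "R2 \<in> N" "R1 \<noteq> R2" for R1 R2
  proof (rule ccontr)
    assume "\<not> ?thesis"
    moreover have sub: "R \<inter> R1 \<inter> R2 \<subseteq> ?P" using N12(1) oriented_facesD(6) unfolding N_def by blast
    ultimately have a2: "aff_dim (R \<inter> R1 \<inter> R2) = 2" using inP[OF sub] by simp
    obtain m r where m: "norm m = 1" "R1 \<subseteq> {x. m \<bullet> x \<le> r}" "R2 \<subseteq> {x. r \<le> m \<bullet> x}"
      using elements_separated[OF NT(1)[OF N12(1)] NT(1)[OF N12(2)] N12(3)] by metis
    have "(m = n \<and> r = c) \<or> (m = - n \<and> r = - c)"
      by (rule hyperplane_unique[OF a2 sub _ n m(1)]) (use m in force)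
    moreover have "R1 \<subseteq> {x. c \<le> n \<bullet> x}" "R2 \<subseteq> {x. c \<le> n \<bullet> x}"
      using neighbour_above N12 unfolding N_def by blast+
    ultimately have "R1 \<subseteq> ?P \<or> R2 \<subseteq> ?P" using m by force
    then show False using element_not_in_plane[OF _ n] NT N12 by blast
  qed
  have "AE x in plane_area n c. \<forall>R'\<in>{R'\<in>T. aff_dim (R \<inter> ?P \<inter> R' \<inter> \<Omega>) < 2}. x \<notin> R \<inter> ?P \<inter> R' \<inter> \<Omega>"
    using finite_mesh by (intro AE_finite_allI AE_plane_area_lowdim[OF n]) auto
  moreover have "AE x in plane_area n c. \<forall>p\<in>{p\<in>N\<times>N. fst p \<noteq> snd p}. x \<notin> R \<inter> fst p \<inter> snd p"
  proof (rule AE_finite_allI)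
    show "finite {p\<in>N\<times>N. fst p \<noteq> snd p}" using finN by simp
    show "AE x in plane_area n c. x \<notin> R \<inter> fst p \<inter> snd p" if "p \<in> {p\<in>N\<times>N. fst p \<noteq> snd p}" for p
      using that by (intro AE_plane_area_lowdim[OF n] ov) auto
  qed
  ultimately have ae: "AE x in plane_area n c. indicator (R \<inter> ?P) x *\<^sub>R w x =
     (\<Sum>R'\<in>N. indicator (R \<inter> R' \<inter> \<Omega>) x *\<^sub>R w x) + indicator (R \<inter> ?P \<inter> frontier \<Omega>) x *\<^sub>R w x"
  proof eventually_elim
    case (elim x)
    show ?case
    proof (cases "x \<in> R \<inter> ?P")
      case False
      then have "x \<notin> R \<inter> R' \<inter> \<Omega>" if "R' \<in> N" for R'
        using that oriented_facesD(6) unfolding N_def by blast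
      then have "(\<Sum>R'\<in>N. indicator (R \<inter> R' \<inter> \<Omega>) x *\<^sub>R w x) = 0" by (intro sum.neutral) auto
      then show ?thesis using False by auto
    next
      case True
      show ?thesis
      proof (cases "x \<in> \<Omega>")
        case False
        have "x \<in> frontier \<Omega>"
          using True False R mesh_cover by (auto simp: frontier_def interior_open[OF open_domain])
        then show ?thesis using True False by simp
      next
        case in\<Omega>: True
        then have nf: "x \<notin> frontier \<Omega>" by (simp add: frontier_def interior_open[OF open_domain])
        obtain R' where R': "R' \<in> T" "R' \<noteq> R" "x \<in> R'"
          using face_covered[OF R i] True in\<Omega> by auto
        then have "R' \<in> N" using nb elim(1) True in\<Omega> by auto
        have "(\<Sum>R''\<in>N. indicator (R \<inter> R'' \<inter> \<Omega>) x *\<^sub>R w x) = (\<Sum>R''\<in>{R'}. indicator (R \<inter> R'' \<inter> \<Omega>) x *\<^sub>R w x)"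
        proof (rule sum.mono_neutral_right[OF finN])
          show "\<forall>R''\<in>N - {R'}. indicator (R \<inter> R'' \<inter> \<Omega>) x *\<^sub>R w x = 0"
          proof
            fix R'' assume "R'' \<in> N - {R'}"
            then have "x \<notin> R \<inter> R' \<inter> R''" using elim(2) \<open>R' \<in> N\<close> by fastforce
            then show "indicator (R \<inter> R'' \<inter> \<Omega>) x *\<^sub>R w x = 0" using True R' by auto
          qed
        qed (use \<open>R' \<in> N\<close> in auto)
        also have "\<dots> = w x" using True in\<Omega> R' by (subst sum.insert) auto
        finally show ?thesis using True nf by simp
      qed
    qed
  qed
  have Rb: "R \<in> sets borel" using R by simp
  have PB: "?P \<in> sets borel" by measurable
  have fr: "frontier \<Omega> \<in> sets borel" by (simp add: borel_closed)
  have si: "set_integrable (plane_area n c) S w" if "S \<subseteq> R" "S \<in> sets borel" for S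
    using set_integrable_plane_area[OF n element_compact[OF R] w that] .
  have I1: "set_integrable (plane_area n c) (R \<inter> R' \<inter> \<Omega>) w" if "R' \<in> N" for R'
    by (rule si) (use NT[OF that] Rb in auto)
  have I2: "set_integrable (plane_area n c) (R \<inter> ?P \<inter> frontier \<Omega>) w"
    by (rule si) (use Rb PB fr in auto)
  have I3: "set_integrable (plane_area n c) (R \<inter> ?P) w"
    by (rule si) (use Rb PB in auto)
  have I4: "integrable (plane_area n c) (\<lambda>x. \<Sum>R'\<in>N. indicator (R \<inter> R' \<inter> \<Omega>) x *\<^sub>R w x)"
    using I1 unfolding set_integrable_def by (intro Bochner_Integration.integrable_sum)
  have "(LINT x:(R \<inter> ?P)|plane_area n c. w x) =
    (\<integral>x. (\<Sum>R'\<in>N. indicator (R \<inter> R' \<inter> \<Omega>) x *\<^sub>R w x) + indicator (R \<inter> ?P \<inter> frontier \<Omega>) x *\<^sub>R w x \<partial>plane_area n c)"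
    unfolding set_lebesgue_integral_def
    using I2 I3 I4 ae unfolding set_integrable_def by (intro integral_cong_AE) (auto intro!: borel_measurable_add)
  also have "\<dots> = (\<integral>x. (\<Sum>R'\<in>N. indicator (R \<inter> R' \<inter> \<Omega>) x *\<^sub>R w x) \<partial>plane_area n c) +
    (LINT x:(R \<inter> ?P \<inter> frontier \<Omega>)|plane_area n c. w x)"
    unfolding set_lebesgue_integral_def
    by (rule Bochner_Integration.integral_add[OF I4 I2[unfolded set_integrable_def]])
  also have "(\<integral>x. (\<Sum>R'\<in>N. indicator (R \<inter> R' \<inter> \<Omega>) x *\<^sub>R w x) \<partial>plane_area n c) =
    (\<Sum>R'\<in>N. LINT x:(R \<inter> R' \<inter> \<Omega>)|plane_area n c. w x)"
    unfolding set_lebesgue_integral_def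
    using I1 unfolding set_integrable_def by (intro Bochner_Integration.integral_sum)
  finally show ?thesis unfolding N_def .
qed

lemma boundary_integral_split:
  assumes w: "\<And>R i. R \<in> T \<Longrightarrow> i \<in> facets R \<Longrightarrow> continuous_on R (w R (fst i))"
  shows "(\<Sum>R\<in>T. \<Sum>(n, c)\<in>facets R. LINT x:(R \<inter> {x. n \<bullet> x = c})|plane_area n c. w R n x) =
    (\<Sum>e\<in>oriented_faces d. face_integral d e (\<lambda>R R' n x. w R n x)) + Gamma_integral d w"
proof -
  have "(\<Sum>R\<in>T. \<Sum>(n, c)\<in>facets R. LINT x:(R \<inter> {x. n \<bullet> x = c})|plane_area n c. w R n x) =
    (\<Sum>R\<in>T. \<Sum>i\<in>facets R. (\<Sum>R' | (R, R', i) \<in> oriented_faces d. face_integral d (R, R', i) (\<lambda>R R' n x. w R n x)) +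
      (LINT x:(R \<inter> {x. fst i \<bullet> x = snd i} \<inter> frontier \<Omega>)|plane_area (fst i) (snd i). w R (fst i) x))"
  proof (intro sum.cong refl)
    fix R i assume R: "R \<in> T" "i \<in> facets R"
    then show "(case i of (n, c) \<Rightarrow> LINT x:(R \<inter> {x. n \<bullet> x = c})|plane_area n c. w R n x) =
      (\<Sum>R' | (R, R', i) \<in> oriented_faces d. face_integral d (R, R', i) (\<lambda>R R' n x. w R n x)) +
      (LINT x:(R \<inter> {x. fst i \<bullet> x = snd i} \<inter> frontier \<Omega>)|plane_area (fst i) (snd i). w R (fst i) x)"
      using facet_integral_split[OF R(1), of "fst i" "snd i" "w R (fst i)"] w[OF R]
      by (simp add: face_integral_def split_beta')
  qed
  also have "\<dots> = (\<Sum>e\<in>oriented_faces d. face_integral d e (\<lambda>R R' n x. w R n x)) + Gamma_integral d w"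
    by (simp add: sum_oriented_faces Gamma_integral_def sum.distrib split_beta')
  finally show ?thesis .
qed

text \<open>Reversing the view of an interface is an involution that flips the sign of
  \<open>n \<bullet> refdir d\<close>, so it matches the orientations left out of
  \<open>interior_faces\<close> with those kept; the area measure is common to both views.\<close>

lemma sum_oriented_pairs:
  assumes w: "\<And>R R' n c. (R, R', n, c) \<in> oriented_faces d \<Longrightarrow>
    set_integrable (plane_area n c) (R \<inter> R' \<inter> \<Omega>) (w R R' n)"
  shows "(\<Sum>e\<in>oriented_faces d. face_integral d e w) =
    (\<Sum>e\<in>interior_faces d. face_integral d e (\<lambda>R R' n x. w R R' n x + w R' R (- n) x))"
proof -
  define rev where "rev e = (case e of (R, R', n, c) \<Rightarrow> (R', R, - n, - c))"
    for e :: "(real^3) set \<times> (real^3) set \<times> (real^3) \<times> real"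
  let ?A = "interior_faces d" and ?B = "{(R, R', n, c) \<in> oriented_faces d. n \<bullet> refdir d < 0}"
  have sub: "?A \<subseteq> oriented_faces d" "?B \<subseteq> oriented_faces d" by (auto simp: interior_faces_def)
  have "e \<in> ?A \<union> ?B" if e: "e \<in> oriented_faces d" for e
  proof -
    obtain R R' n c where E: "e = (R, R', n, c)" by (metis prod.collapse)
    show ?thesis using refdir_transverse[of R R' n c] e by (auto simp: E interior_faces_def)
  qed
  then have AB: "oriented_faces d = ?A \<union> ?B" using sub by blast
  have disj: "?A \<inter> ?B = {}" by (auto simp: interior_faces_def)
  have fin: "finite ?A" "finite ?B"
    using sub finite_oriented_faces by (blast intro: finite_subset)+
  have "(\<Sum>e\<in>oriented_faces d. face_integral d e w) = (\<Sum>e\<in>?A. face_integral d e w) + (\<Sum>e\<in>?B. face_integral d e w)"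
    by (subst AB) (rule sum.union_disjoint[OF fin disj])
  also have "(\<Sum>e\<in>?B. face_integral d e w) = (\<Sum>e\<in>?A. face_integral d (rev e) w)"
    by (rule sum.reindex_bij_witness[of _ rev rev])
       (auto simp: rev_def interior_faces_def dest: oriented_faces_swap)
  also have "(\<Sum>e\<in>?A. face_integral d e w) + (\<Sum>e\<in>?A. face_integral d (rev e) w) =
    (\<Sum>e\<in>?A. face_integral d e (\<lambda>R R' n x. w R R' n x + w R' R (- n) x))"
    unfolding sum.distrib[symmetric]
  proof (rule sum.cong[OF refl])
    fix e assume "e \<in> ?A"
    then obtain R R' n c where e: "e = (R, R', n, c)" "(R, R', n, c) \<in> oriented_faces d"
      by (auto simp: interior_faces_def)
    have eq: "plane_area (- n) (- c) = plane_area n c"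
      by (rule plane_area_minus) (rule oriented_facesD(5)[OF e(2)])
    have "set_integrable (plane_area n c) (R \<inter> R' \<inter> \<Omega>) (w R' R (- n))"
      using w[OF oriented_faces_swap[OF e(2)]] by (simp add: eq Int_commute)
    then show "face_integral d e w + face_integral d (rev e) w =
      face_integral d e (\<lambda>R R' n x. w R R' n x + w R' R (- n) x)"
      using w[OF e(2)] by (simp add: face_integral_def e(1) rev_def eq Int_commute)
  qed
  finally show ?thesis .
qed

section \<open>The skeleton as a null set\<close>

lemma negligible_skeleton: "negligible (\<Union>R\<in>T. R - interior R)"
  using finite_mesh negligible_polytope_boundary[OF element_polytope]
  by (intro negligible_Union) auto

lemma domain_minus_inner: "\<Omega> - inner_region \<subseteq> (\<Union>R\<in>T. R - interior R)"
  using mesh_cover closure_subset[of \<Omega>] by (fastforce simp: inner_region_def)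

lemma open_inner_region: "open inner_region"
  by (auto simp: inner_region_def)

lemma inner_region_subset: "inner_region \<subseteq> \<Omega>"
  using interior_subset_domain by (auto simp: inner_region_def)

lemma LINT_domain:
  fixes F :: "real^3 \<Rightarrow> 'b::euclidean_space"
  shows "(LINT x:\<Omega>|lebesgue. F x) = (LINT x:inner_region|lebesgue. F x)"
    and "set_integrable lebesgue \<Omega> F \<longleftrightarrow> set_integrable lebesgue inner_region F"
proof -
  have "indicator \<Omega> x *\<^sub>R F x = indicator inner_region x *\<^sub>R F x" if "x \<notin> (\<Union>R\<in>T. R - interior R)" for x
    using that domain_minus_inner inner_region_subset by (auto simp: indicator_def)
  from LINT_lebesgue_cong[OF negligible_skeleton this]
  show "(LINT x:\<Omega>|lebesgue. F x) = (LINT x:inner_region|lebesgue. F x)"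
    "set_integrable lebesgue \<Omega> F \<longleftrightarrow> set_integrable lebesgue inner_region F"
    by (auto simp: set_lebesgue_integral_def set_integrable_def)
qed

lemma LINT_element_cong:
  fixes f g :: "real^3 \<Rightarrow> 'b::euclidean_space"
  assumes R: "R \<in> T" and fg: "\<And>x. x \<in> interior R \<Longrightarrow> f x = g x"
  shows "(LINT x:R|lebesgue. f x) = (LINT x:R|lebesgue. g x)"
    and "set_integrable lebesgue R f \<longleftrightarrow> set_integrable lebesgue R g"
proof -
  have "indicator R x *\<^sub>R f x = indicator R x *\<^sub>R g x" if "x \<notin> R - interior R" for x
    using that fg by (auto simp: indicator_def)
  from LINT_lebesgue_cong[OF negligible_polytope_boundary[OF element_polytope[OF R]] this]
  show "(LINT x:R|lebesgue. f x) = (LINT x:R|lebesgue. g x)" "set_integrable lebesgue R f \<longleftrightarrow> set_integrable lebesgue R g"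
    by (auto simp: set_lebesgue_integral_def set_integrable_def)
qed

lemma ip_cong:
  assumes "\<And>R x. R \<in> T \<Longrightarrow> x \<in> interior R \<Longrightarrow> g x \<bullet> h x = g' x \<bullet> h' x"
  shows "ip d g h = ip d g' h'"
  unfolding ip_def by (intro sum.cong refl LINT_element_cong) (use assms in auto)

lemma indicator_inner_region:
  assumes "x \<notin> (\<Union>R\<in>T. R - interior R)"
  shows "(\<Sum>R\<in>T. indicator R x) = (indicator inner_region x :: real)"
proof (cases "x \<in> inner_region")
  case False
  then have "x \<notin> R" if "R \<in> T" for R using that assms by (auto simp: inner_region_def)
  then show ?thesis using False by simp
next
  case True
  then obtain R where R: "R \<in> T" "x \<in> interior R" by (auto simp: inner_region_def)
  then have "x \<in> R" using interior_subset by blast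
  have "x \<notin> R'" if "R' \<in> T - {R}" for R'
    using that assms interior_disjoint[OF R(1), of R'] R(2) by blast
  then have "(\<Sum>R\<in>T. indicator R x) = (\<Sum>R\<in>{R}. indicator R x :: real)"
    using R(1) by (intro sum.mono_neutral_right[OF finite_mesh]) auto
  then show ?thesis using True \<open>x \<in> R\<close> by simp
qed

lemma sum_elements:
  fixes F :: "real^3 \<Rightarrow> real"
  assumes F: "set_integrable lebesgue inner_region F"
  shows "(\<Sum>R\<in>T. LINT x:R|lebesgue. F x) = (LINT x:inner_region|lebesgue. F x)"
    and "R \<in> T \<Longrightarrow> set_integrable lebesgue R F"
proof -
  have I: "set_integrable lebesgue R F" if R: "R \<in> T" for R
  proof -
    have "set_integrable lebesgue (interior R) F"
      by (rule set_integrable_subset[OF F]) (use R in \<open>auto simp: inner_region_def\<close>)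
    moreover have "indicator R x *\<^sub>R F x = indicator (interior R) x *\<^sub>R F x" if "x \<notin> R - interior R" for x
      using that interior_subset[of R] by (auto simp: indicator_def)
    then have "integrable lebesgue (\<lambda>x. indicator R x *\<^sub>R F x) \<longleftrightarrow>
        integrable lebesgue (\<lambda>x. indicator (interior R) x *\<^sub>R F x)"
      by (rule LINT_lebesgue_cong(1)[OF negligible_polytope_boundary[OF element_polytope[OF R]]])
    ultimately show ?thesis unfolding set_integrable_def by (simp only:)
  qed
  have "(\<Sum>R\<in>T. LINT x:R|lebesgue. F x) = (\<integral>x. (\<Sum>R\<in>T. indicator R x *\<^sub>R F x) \<partial>lebesgue)"
    unfolding set_lebesgue_integral_def
    using I by (intro Bochner_Integration.integral_sum[symmetric]) (auto simp: set_integrable_def)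
  also have "\<dots> = (LINT x:inner_region|lebesgue. F x)"
    unfolding set_lebesgue_integral_def
    by (rule LINT_lebesgue_cong(2)[OF negligible_skeleton])
       (simp add: scaleR_left.sum[symmetric] indicator_inner_region del: real_scaleR_def UN_iff)
  finally show "(\<Sum>R\<in>T. LINT x:R|lebesgue. F x) = (LINT x:inner_region|lebesgue. F x)" .
  show "R \<in> T \<Longrightarrow> set_integrable lebesgue R F" by (rule I)
qed

end

subsection \<open>Polynomials and finite-dimensional systems\<close>

definition multi_idx :: "nat \<Rightarrow> (nat \<times> nat \<times> nat) set" where
  "multi_idx k = {..k} \<times> {..k} \<times> {..k}"

definition monomial3 :: "nat \<times> nat \<times> nat \<Rightarrow> real^3 \<Rightarrow> real" where
  "monomial3 a x = (x $ 1) ^ fst a * (x $ 2) ^ fst (snd a) * (x $ 3) ^ snd (snd a)"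

lemma finite_multi_idx [simp]: "finite (multi_idx k)"
  by (simp add: multi_idx_def)

text \<open>A single flat index set replaces the triple sum, so that closure properties become
  manipulations of finite linear combinations.\<close>

lemma Qpoly_iff: "P \<in> Qpoly k \<longleftrightarrow> (\<exists>c. \<forall>x. P x = (\<Sum>a\<in>multi_idx k. c a * monomial3 a x))"
proof
  assume "P \<in> Qpoly k"
  then obtain c where "\<forall>x. P x = (\<Sum>i\<le>k. \<Sum>j\<le>k. \<Sum>l\<le>k. c i j l * (x $ 1) ^ i * (x $ 2) ^ j * (x $ 3) ^ l)"
    by (auto simp: Qpoly_def)
  then have "\<forall>x. P x = (\<Sum>a\<in>multi_idx k. c (fst a) (fst (snd a)) (snd (snd a)) * monomial3 a x)"
    by (simp add: multi_idx_def monomial3_def sum.cartesian_product split_beta' mult.assoc)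
  then show "\<exists>c. \<forall>x. P x = (\<Sum>a\<in>multi_idx k. c a * monomial3 a x)"
    by (intro exI[of _ "\<lambda>a. c (fst a) (fst (snd a)) (snd (snd a))"])
next
  assume "\<exists>c. \<forall>x. P x = (\<Sum>a\<in>multi_idx k. c a * monomial3 a x)"
  then obtain c where "\<forall>x. P x = (\<Sum>a\<in>multi_idx k. c a * monomial3 a x)" by blast
  then have "\<forall>x. P x = (\<Sum>i\<le>k. \<Sum>j\<le>k. \<Sum>l\<le>k. (\<lambda>i j l. c (i, j, l)) i j l * (x $ 1) ^ i * (x $ 2) ^ j * (x $ 3) ^ l)"
    by (simp add: multi_idx_def monomial3_def sum.cartesian_product split_beta' mult.assoc)
  then show "P \<in> Qpoly k" unfolding Qpoly_def mem_Collect_eq by (intro exI[of _ "\<lambda>i j l. c (i, j, l)"])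
qed

lemma Qpoly_sum:
  assumes P: "\<And>a. a \<in> A \<Longrightarrow> P a \<in> Qpoly k"
  shows "(\<lambda>x. \<Sum>a\<in>A. c a * P a x) \<in> Qpoly k"
proof -
  have "\<exists>b. \<forall>x. P a x = (\<Sum>m\<in>multi_idx k. b m * monomial3 m x)" if "a \<in> A" for a
    using P[OF that] by (simp add: Qpoly_iff)
  then obtain b where b: "\<And>a x. a \<in> A \<Longrightarrow> P a x = (\<Sum>m\<in>multi_idx k. b a m * monomial3 m x)" by metis
  have "(\<Sum>a\<in>A. c a * P a x) = (\<Sum>m\<in>multi_idx k. (\<Sum>a\<in>A. c a * b a m) * monomial3 m x)" for x
    by (simp add: b sum_distrib_left sum_distrib_right mult.assoc sum.swap[of _ A])
  then show ?thesis unfolding Qpoly_iff by (intro exI[of _ "\<lambda>m. \<Sum>a\<in>A. c a * b a m"] allI) simp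
qed

lemma Qpoly_scale: "P \<in> Qpoly k \<Longrightarrow> (\<lambda>x. c * P x) \<in> Qpoly k"
  using Qpoly_sum[of "{()}" "\<lambda>_. P" k "\<lambda>_. c"] by simp

lemma Qpoly_0: "(\<lambda>x. 0) \<in> Qpoly k"
  using Qpoly_sum[of "{}" "\<lambda>_ _. 0" k "\<lambda>_. 0"] by simp

lemma Qpoly_monomial: assumes "a \<in> multi_idx k" shows "monomial3 a \<in> Qpoly k"
  unfolding Qpoly_iff
proof (intro exI[of _ "\<lambda>b. if b = a then 1 else 0"] allI)
  fix x
  have "(\<Sum>b\<in>multi_idx k. (if b = a then 1 else 0) * monomial3 b x) = (\<Sum>b\<in>multi_idx k. if b = a then monomial3 b x else 0)"
    by (rule sum.cong) auto
  also have "\<dots> = monomial3 a x" using assms by simp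
  finally show "monomial3 a x = (\<Sum>b\<in>multi_idx k. (if b = a then 1 else 0) * monomial3 b x)" by simp
qed

lemma Qpoly_1: "(\<lambda>x. 1) \<in> Qpoly k"
  using Qpoly_monomial[of "(0,0,0)" k] by (simp add: multi_idx_def monomial3_def[abs_def])

lemma Qpoly_coordinate: assumes "k \<ge> 1" shows "(\<lambda>x. x $ i) \<in> Qpoly k"
proof -
  have "i = 1 \<or> i = 2 \<or> i = 3" using exhaust_3 by blast
  then show ?thesis
    using Qpoly_monomial[of "(1,0,0)" k] Qpoly_monomial[of "(0,1,0)" k] Qpoly_monomial[of "(0,0,1)" k] assms
    by (auto simp: multi_idx_def monomial3_def[abs_def])
qed

lemma Qpoly_monomial_derivative:
  assumes a: "a \<in> multi_idx k"
  obtains D where "\<And>i. (\<lambda>x. D x $ i) \<in> Qpoly k" "\<And>x. (monomial3 a has_derivative (\<lambda>h. D x \<bullet> h)) (at x)"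
proof -
  obtain i j l where A: "a = (i, j, l)" by (metis prod.collapse)
  \<comment> \<open>Truncated subtraction gives \<open>0 - 1 = 0\<close>, but then the factor in
    front is 0. Lowering exponents stays within the index range, so derivatives remain in the same
    polynomial space.\<close>
  define D :: "real^3 \<Rightarrow> real^3" where "D x = vector [real i * monomial3 (i-1, j, l) x,
     real j * monomial3 (i, j-1, l) x, real l * monomial3 (i, j, l-1) x]" for x
  have "(\<lambda>x. D x $ m) \<in> Qpoly k" for m
  proof -
    have "m = 1 \<or> m = 2 \<or> m = 3" using exhaust_3 by blast
    moreover have "(i-1, j, l) \<in> multi_idx k" "(i, j-1, l) \<in> multi_idx k" "(i, j, l-1) \<in> multi_idx k"
      using a by (auto simp: A multi_idx_def)
    ultimately show ?thesis by (auto simp: D_def Qpoly_scale[OF Qpoly_monomial])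
  qed
  moreover have "(monomial3 a has_derivative (\<lambda>h. D x \<bullet> h)) (at x)" for x
    unfolding monomial3_def[abs_def] A fst_conv snd_conv
    by (auto intro!: derivative_eq_intros bounded_linear.has_derivative[OF bounded_linear_vec_nth]
        simp: D_def inner_vec_def sum_3 monomial3_def algebra_simps)
  ultimately show ?thesis using that by blast
qed

lemma Qpoly_derivative:
  assumes P: "P \<in> Qpoly k"
  obtains D where "\<And>i. (\<lambda>x. D x $ i) \<in> Qpoly k" "\<And>x. (P has_derivative (\<lambda>h. D x \<bullet> h)) (at x)"
proof -
  obtain c where c: "\<forall>x. P x = (\<Sum>a\<in>multi_idx k. c a * monomial3 a x)" using P by (auto simp: Qpoly_iff)
  have "\<exists>D. (\<forall>i. (\<lambda>x. D x $ i) \<in> Qpoly k) \<and> (\<forall>x. (monomial3 a has_derivative (\<lambda>h. D x \<bullet> h)) (at x))"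
    if "a \<in> multi_idx k" for a
    using Qpoly_monomial_derivative[OF that] by metis
  then obtain D where D: "\<And>a i. a \<in> multi_idx k \<Longrightarrow> (\<lambda>x. D a x $ i) \<in> Qpoly k"
    "\<And>a x. a \<in> multi_idx k \<Longrightarrow> (monomial3 a has_derivative (\<lambda>h. D a x \<bullet> h)) (at x)" by metis
  define E where "E x = (\<Sum>a\<in>multi_idx k. c a *\<^sub>R D a x)" for x
  have "(\<lambda>x. E x $ i) \<in> Qpoly k" for i
    unfolding E_def using Qpoly_sum[of "multi_idx k" "\<lambda>a x. D a x $ i" k c] D(1) by simp
  moreover have "(P has_derivative (\<lambda>h. E x \<bullet> h)) (at x)" for x
  proof -
    have "((\<lambda>x. \<Sum>a\<in>multi_idx k. c a * monomial3 a x) has_derivative (\<lambda>h. \<Sum>a\<in>multi_idx k. c a * (D a x \<bullet> h))) (at x)"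
      by (intro has_derivative_sum has_derivative_mult_right D(2))
    moreover have "(\<lambda>x. \<Sum>a\<in>multi_idx k. c a * monomial3 a x) = P" using c by auto
    ultimately show ?thesis by (simp add: E_def inner_sum_left)
  qed
  ultimately show ?thesis using that by blast
qed

lemma grad_eqI:
  assumes "(g has_derivative (\<lambda>h. D \<bullet> h)) (at x)"
  shows "grad g x = D"
  using frechet_derivative_at[OF assms, symmetric] by (simp add: grad_def vec_eq_iff inner_axis)

lemma Qpoly_continuous: "P \<in> Qpoly k \<Longrightarrow> continuous_on S P"
  by (meson Qpoly_derivative continuous_at_imp_continuous_on has_derivative_continuous)

text \<open>One-dimensional Lagrange interpolation through \<open>k + 1\<close> nodes, stated for
  powers because the tensor-product version is assembled from monomials.\<close>

lemma lagrange_basis: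
  fixes a :: "nat \<Rightarrow> real"
  assumes a: "inj_on a {..k}"
  obtains L where "\<And>j. continuous_on UNIV (L j)"
    "\<And>i x. i \<le> k \<Longrightarrow> x ^ i = (\<Sum>j\<le>k. a j ^ i * L j x)"
proof -
  define p where "p j = (\<Prod>m\<in>{..k} - {j}. smult (inverse (a j - a m)) [:- a m, 1:])" for j
  have deg: "degree (p j) \<le> k" if "j \<le> k" for j
  proof -
    have "degree (p j) \<le> (\<Sum>m\<in>{..k} - {j}. degree (smult (inverse (a j - a m)) [:- a m, 1:]))"
      unfolding p_def by (rule order_trans[OF degree_prod_sum_le]) (simp_all only: comp_def finite_Diff finite_atMost order_refl)
    also have "\<dots> \<le> (\<Sum>m\<in>{..k} - {j}. 1)"
      by (intro sum_mono order_trans[OF degree_smult_le]) simp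
    also have "\<dots> = k" using that by simp
    finally show ?thesis .
  qed
  have val: "poly (p j) (a m) = (if m = j then 1 else 0)" if "j \<le> k" "m \<le> k" for j m
  proof (cases "m = j")
    case True
    have "inverse (a j - a n) * (a j - a n) = 1" if "n \<in> {..k} - {j}" for n
    proof -
      have "a j \<noteq> a n" using inj_onD[OF a, of j n] that \<open>j \<le> k\<close> by auto
      then show ?thesis by simp
    qed
    then have "(\<Prod>n\<in>{..k} - {j}. inverse (a j - a n) * (a j - a n)) = 1" by (intro prod.neutral) blast
    moreover have "poly (smult (inverse (a j - a n)) [:- a n, 1:]) (a j) = inverse (a j - a n) * (a j - a n)" for n
      by (simp add: algebra_simps)
    ultimately show ?thesis using True unfolding p_def poly_prod by (simp only: simp_thms if_True)
  next
    case False
    then have "m \<in> {..k} - {j}" using that by auto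
    then have "(\<Prod>n\<in>{..k} - {j}. poly (smult (inverse (a j - a n)) [:- a n, 1:]) (a m)) = 0"
      by (intro prod_zero) auto
    then show ?thesis using False by (simp add: p_def poly_prod)
  qed
  \<comment> \<open>Both sides have degree at most \<open>k\<close> and agree at
    \<open>k + 1\<close> distinct nodes.\<close>
  have mon: "monom 1 i = (\<Sum>j\<le>k. smult (a j ^ i) (p j))" if "i \<le> k" for i
  proof (rule poly_eqI_degree[of "a ` {..k}"])
    show "poly (monom 1 i) x = poly (\<Sum>j\<le>k. smult (a j ^ i) (p j)) x" if xa: "x \<in> a ` {..k}" for x
    proof -
      obtain m where m: "m \<le> k" "x = a m" using xa by auto
      have "(\<Sum>j\<le>k. a j ^ i * poly (p j) (a m)) = (\<Sum>j\<le>k. if j = m then a j ^ i else 0)"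
        using m by (intro sum.cong) (auto simp: val)
      then show ?thesis using m by (simp add: poly_sum poly_monom)
    qed
    have "card (a ` {..k}) = Suc k" using a by (simp add: card_image)
    moreover have "degree (monom (1::real) i) \<le> k" using that by (simp add: degree_monom_eq)
    moreover have "degree (\<Sum>j\<le>k. smult (a j ^ i) (p j)) \<le> k"
      by (intro degree_sum_le) (auto simp: deg)
    ultimately show "degree (monom (1::real) i) < card (a ` {..k})"
      "degree (\<Sum>j\<le>k. smult (a j ^ i) (p j)) < card (a ` {..k})" by auto
  qed
  have "x ^ i = (\<Sum>j\<le>k. a j ^ i * poly (p j) x)" if "i \<le> k" for i x
    using arg_cong[OF mon[OF that], of "\<lambda>q. poly q x"] by (simp add: poly_sum poly_monom)
  then show ?thesis using that[of "\<lambda>j. poly (p j)"] by (simp add: continuous_on_poly)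
qed

text \<open>Point evaluations at a tensor grid determine a polynomial, which is what turns pointwise
  differentiability in time into differentiability of integrals.\<close>

lemma Qpoly_interpolation:
  fixes S :: "(real^3) set"
  assumes S: "open S" "S \<noteq> {}"
  obtains N L where "\<And>a. a \<in> multi_idx k \<Longrightarrow> N a \<in> S" "\<And>a. continuous_on UNIV (L a)"
    "\<And>P x. P \<in> Qpoly k \<Longrightarrow> P x = (\<Sum>a\<in>multi_idx k. P (N a) * L a x)"
proof -
  obtain x0 where "x0 \<in> S" using S(2) by auto
  then obtain \<epsilon> where \<epsilon>: "\<epsilon> > 0" "ball x0 \<epsilon> \<subseteq> S" using S(1) open_contains_ball by blast
  \<comment> \<open>Up to \<open>k\<close> steps of this size change each coordinate by less than
    \<open>\<epsilon> / 3\<close>, so in the sum norm the whole grid stays in the ball; the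
    \<open>+ 1\<close> makes the bound strict and covers \<open>k = 0\<close>.\<close>
  define \<delta> where "\<delta> = (\<epsilon> / 3) / (real k + 1)"
  have \<delta>: "\<delta> > 0" using \<epsilon> by (simp add: \<delta>_def)
  define p where "p m j = x0 $ m + real j * \<delta>" for m j
  have "inj_on (p m) {..k}" for m using \<delta> by (auto simp: inj_on_def p_def)
  then have "\<exists>L. (\<forall>j. continuous_on UNIV (L j)) \<and> (\<forall>i x. i \<le> k \<longrightarrow> x ^ i = (\<Sum>j\<le>k. p m j ^ i * L j x))" for m
    by (metis lagrange_basis)
  then obtain L where L: "\<And>m j. continuous_on UNIV (L m j)"
    "\<And>m i x. i \<le> k \<Longrightarrow> x ^ i = (\<Sum>j\<le>k. p m j ^ i * L m j x)" by metis
  define N :: "nat \<times> nat \<times> nat \<Rightarrow> real^3" where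
    "N a = vector [p 1 (fst a), p 2 (fst (snd a)), p 3 (snd (snd a))]" for a
  define M where "M a x = L 1 (fst a) (x $ 1) * L 2 (fst (snd a)) (x $ 2) * L 3 (snd (snd a)) (x $ 3)"
    for a :: "nat \<times> nat \<times> nat" and x :: "real^3"
  have NS: "N a \<in> S" if "a \<in> multi_idx k" for a
  proof -
    have b: "real j * \<delta> < \<epsilon> / 3" if "j \<le> k" for j
    proof -
      have "real j * \<delta> < (real k + 1) * \<delta>" using that \<delta> by (intro mult_strict_right_mono) auto
      also have "\<dots> = \<epsilon> / 3" unfolding \<delta>_def
        using nonzero_mult_div_cancel_left[of "real k + 1" "\<epsilon> / 3"] unfolding times_divide_eq_right by linarith
      finally show ?thesis .
    qed
    have "norm (N a - x0) \<le> (\<Sum>i\<in>UNIV. \<bar>(N a - x0) $ i\<bar>)" by (rule norm_le_l1_cart)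
    also have "\<dots> = real (fst a) * \<delta> + real (fst (snd a)) * \<delta> + real (snd (snd a)) * \<delta>"
      using \<delta> by (simp add: sum_3 N_def p_def)
    also have "\<dots> < \<epsilon>" using b[of "fst a"] b[of "fst (snd a)"] b[of "snd (snd a)"] that
      by (simp add: multi_idx_def mem_Times_iff)
    finally show ?thesis using \<epsilon>(2) by (auto simp: dist_norm norm_minus_commute)
  qed
  have Mc: "continuous_on UNIV (M a)" for a
    unfolding M_def by (intro continuous_intros continuous_on_compose2[OF L(1)]) auto
  have mono: "monomial3 b x = (\<Sum>a\<in>multi_idx k. monomial3 b (N a) * M a x)" if b: "b \<in> multi_idx k" for b x
  proof -
    obtain i j l where B: "b = (i, j, l)" by (metis prod.collapse)
    have ijl: "i \<le> k" "j \<le> k" "l \<le> k" using b by (auto simp: B multi_idx_def)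
    have "monomial3 b x = (x $ 1) ^ i * ((x $ 2) ^ j * (x $ 3) ^ l)" by (simp add: monomial3_def B)
    also have "\<dots> = (\<Sum>u\<le>k. p 1 u ^ i * L 1 u (x $ 1)) * ((\<Sum>v\<le>k. p 2 v ^ j * L 2 v (x $ 2)) * (\<Sum>w\<le>k. p 3 w ^ l * L 3 w (x $ 3)))"
      using L(2)[OF ijl(1), of "x $ 1" 1] L(2)[OF ijl(2), of "x $ 2" 2] L(2)[OF ijl(3), of "x $ 3" 3] by (simp only:)
    also have "\<dots> = (\<Sum>a\<in>multi_idx k. monomial3 b (N a) * M a x)"
    proof -
      have "(\<Sum>a\<in>multi_idx k. monomial3 b (N a) * M a x) =
        (\<Sum>u\<le>k. \<Sum>v\<le>k. \<Sum>w\<le>k. monomial3 b (N (u, v, w)) * M (u, v, w) x)"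
        by (simp add: multi_idx_def sum.cartesian_product split_beta')
      also have "\<dots> = (\<Sum>u\<le>k. \<Sum>v\<le>k. \<Sum>w\<le>k. p 1 u ^ i * L 1 u (x $ 1) *
          (p 2 v ^ j * L 2 v (x $ 2) * (p 3 w ^ l * L 3 w (x $ 3))))"
        by (simp add: monomial3_def N_def M_def B mult_ac)
      finally show ?thesis by (simp only: sum_product, simp only: sum_distrib_left)
    qed
    finally show ?thesis .
  qed
  have "P x = (\<Sum>a\<in>multi_idx k. P (N a) * M a x)" if PQ: "P \<in> Qpoly k" for P x
  proof -
    obtain c where c: "\<forall>x. P x = (\<Sum>b\<in>multi_idx k. c b * monomial3 b x)" using PQ unfolding Qpoly_iff by blast
    have "P x = (\<Sum>b\<in>multi_idx k. c b * (\<Sum>a\<in>multi_idx k. monomial3 b (N a) * M a x))"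
      using c mono by simp
    also have "\<dots> = (\<Sum>a\<in>multi_idx k. (\<Sum>b\<in>multi_idx k. c b * monomial3 b (N a)) * M a x)"
      by (simp add: sum_distrib_left sum_distrib_right mult.assoc) (rule sum.swap)
    finally show ?thesis using c by simp
  qed
  then show ?thesis using that NS Mc by blast
qed

text \<open>Riesz representation on a finite-dimensional space with a possibly degenerate form, proved by
  Gram--Schmidt; working with coefficients avoids the need for a linearly independent basis.\<close>

lemma psd_system_solvable:
  fixes A :: "'i \<Rightarrow> 'i \<Rightarrow> real" and \<beta> :: "'i \<Rightarrow> real"
  assumes "finite S"
    and sym: "\<And>i j. A i j = A j i"
    and psd: "\<And>c. 0 \<le> (\<Sum>i\<in>S. \<Sum>j\<in>S. c i * c j * A i j)"
    and null: "\<And>c. (\<Sum>i\<in>S. \<Sum>j\<in>S. c i * c j * A i j) = 0 \<Longrightarrow> (\<Sum>i\<in>S. c i * \<beta> i) = 0"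
  shows "\<exists>c. \<forall>i\<in>S. (\<Sum>j\<in>S. A i j * c j) = \<beta> i"
  using assms(1) psd null
proof (induction S arbitrary: \<beta> rule: finite_induct)
  case empty
  then show ?case by simp
next
  case (insert a S)
  define Q where "Q c = (\<Sum>i\<in>S. \<Sum>j\<in>S. c i * c j * A i j)" for c
  have exp: "(\<Sum>i\<in>insert a S. \<Sum>j\<in>insert a S. c i * c j * A i j) =
    Q c + 2 * c a * (\<Sum>i\<in>S. c i * A i a) + (c a)\<^sup>2 * A a a" for c
  proof -
    have 1: "(\<Sum>j\<in>S. c a * c j * A a j) = c a * (\<Sum>i\<in>S. c i * A i a)"
      unfolding sum_distrib_left by (rule sum.cong) (simp_all add: sym[of a])
    have 2: "(\<Sum>i\<in>S. c i * c a * A i a) = c a * (\<Sum>i\<in>S. c i * A i a)"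
      unfolding sum_distrib_left by (rule sum.cong) simp_all
    show ?thesis
      unfolding sum.insert[OF insert.hyps] sum.distrib 1 2 Q_def by (simp add: power2_eq_square)
  qed
  have upd: "(\<Sum>i\<in>S. (c(a := t)) i * g i) = (\<Sum>i\<in>S. c i * g i)" "Q (c(a := t)) = Q c" for c t and g :: "'i \<Rightarrow> real"
    using insert.hyps unfolding Q_def by (auto intro!: sum.cong)
  have psdS: "0 \<le> Q c" for c
    using insert.prems(1)[of "c(a := 0)"] unfolding exp by (simp only: upd fun_upd_same) simp
  have nullS: "(\<Sum>i\<in>S. c i * \<beta> i) = 0" if "Q c = 0" for c
    using insert.prems(2)[of "c(a := 0)"] that insert.hyps unfolding exp by (simp add: upd del: fun_upd_apply) simp
  \<comment> \<open>Adding \<open>t\<close> times the new index to a null vector gives the form the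
    value \<open>2 t s + t^2 A a a\<close>, which is nonnegative for all \<open>t\<close> only if
    \<open>s = 0\<close>. The \<open>+ 1\<close> in \<open>b\<close> keeps the witness
    \<open>t = - s / b\<close> meaningful when \<open>A a a = 0\<close>.\<close>
  have nullA: "(\<Sum>i\<in>S. c i * A i a) = 0" if "Q c = 0" for c
  proof (rule ccontr)
    assume *: "(\<Sum>i\<in>S. c i * A i a) \<noteq> 0"
    define s where "s = (\<Sum>i\<in>S. c i * A i a)"
    have pos: "0 \<le> 2 * t * s + t\<^sup>2 * A a a" for t
      using insert.prems(1)[of "c(a := t)"] that unfolding exp by (simp only: upd fun_upd_same s_def[symmetric])
    define b where "b = A a a + 1"
    define t where "t = - s / b"
    have "0 \<le> A a a" using pos[of 1] pos[of "-1"] by simp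
    then have b: "b > 0" by (simp add: b_def)
    have "2 * t * s + t\<^sup>2 * A a a = 2 * (- s / b) * s + (- s / b)\<^sup>2 * (b - 1)" by (simp add: t_def b_def)
    also have "\<dots> = s\<^sup>2 / b\<^sup>2 * (- b - 1)" using b by (simp add: power2_eq_square field_simps)
    also have "\<dots> < 0" using * b by (intro mult_pos_neg) (auto simp: s_def)
    finally show False using pos[of t] by simp
  qed
  obtain g where g: "\<forall>i\<in>S. (\<Sum>j\<in>S. A i j * g j) = \<beta> i"
    using insert.IH[of \<beta>] psdS nullS unfolding Q_def by blast
  obtain p where p: "\<forall>i\<in>S. (\<Sum>j\<in>S. A i j * p j) = A i a"
    using insert.IH[of "\<lambda>i. A i a"] psdS nullA unfolding Q_def by blast
  define g' where "g' = g(a := 0)"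
  \<comment> \<open>The Gram-Schmidt step: subtracting from the new index the combination
    \<open>p\<close> that reproduces column \<open>a\<close> on \<open>S\<close> leaves a vector
    orthogonal to all of \<open>S\<close>.\<close>
  define w where "w = (\<lambda>j. - p j)(a := 1)"
  have S_cong: "(\<Sum>j\<in>S. A i j * g' j) = (\<Sum>j\<in>S. A i j * g j)" "(\<Sum>j\<in>S. A i j * w j) = - (\<Sum>j\<in>S. A i j * p j)" for i
    using insert.hyps unfolding g'_def w_def sum_negf[symmetric] by (auto intro!: sum.cong)
  have w0: "(\<Sum>j\<in>insert a S. A i j * w j) = 0" if "i \<in> S" for i
    using insert.hyps p that by (simp add: S_cong) (simp add: w_def)
  \<comment> \<open>By \<open>Qw\<close> this is the squared length of \<open>w\<close>. If it is
    nonzero, a multiple \<open>\<alpha>\<close> of \<open>w\<close> repairs the equation at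
    \<open>a\<close> without disturbing those on \<open>S\<close>.\<close>
  define \<omega> where "\<omega> = (\<Sum>j\<in>insert a S. A a j * w j)"
  have Qw: "(\<Sum>i\<in>insert a S. \<Sum>j\<in>insert a S. w i * w j * A i j) = \<omega>"
  proof -
    have "(\<Sum>i\<in>insert a S. \<Sum>j\<in>insert a S. w i * w j * A i j) = (\<Sum>i\<in>insert a S. w i * (\<Sum>j\<in>insert a S. A i j * w j))"
      by (simp add: sum_distrib_left mult_ac)
    also have "\<dots> = w a * \<omega> + (\<Sum>i\<in>S. w i * (\<Sum>j\<in>insert a S. A i j * w j))"
      unfolding \<omega>_def by (rule sum.insert[OF insert.hyps])
    also have "\<dots> = \<omega>" using w0 by (simp add: w_def)
    finally show ?thesis .
  qed
  have ga: "(\<Sum>j\<in>insert a S. A i j * g' j) = (\<Sum>j\<in>S. A i j * g j)" for i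
    using insert.hyps by (simp add: S_cong) (simp add: g'_def)
  show ?case
  proof (cases "\<omega> = 0")
    case True
    have "(\<Sum>i\<in>insert a S. w i * \<beta> i) = 0" by (rule insert.prems(2)) (use Qw True in simp)
    \<comment> \<open>In the degenerate case \<open>w\<close> is a null vector, so compatibility of
      \<open>\<beta>\<close> with null vectors is precisely what makes the old solution satisfy the
      new equation.\<close>
    then have "\<beta> a = (\<Sum>i\<in>S. p i * \<beta> i)"
    proof -
      have "(\<Sum>i\<in>S. w i * \<beta> i) = - (\<Sum>i\<in>S. p i * \<beta> i)"
        using insert.hyps unfolding w_def sum_negf[symmetric] by (auto intro!: sum.cong)
      then show ?thesis using \<open>(\<Sum>i\<in>insert a S. w i * \<beta> i) = 0\<close> insert.hyps by (simp add: w_def)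
    qed
    also have "\<dots> = (\<Sum>i\<in>S. p i * (\<Sum>j\<in>S. A i j * g j))" using g by simp
    also have "\<dots> = (\<Sum>j\<in>S. g j * (\<Sum>i\<in>S. A j i * p i))"
    proof -
      have "(\<Sum>i\<in>S. \<Sum>j\<in>S. p i * (A i j * g j)) = (\<Sum>j\<in>S. \<Sum>i\<in>S. p i * (A i j * g j))"
        by (rule sum.swap)
      also have "\<dots> = (\<Sum>j\<in>S. \<Sum>i\<in>S. g j * (A j i * p i))"
        by (intro sum.cong refl) (subst sym, simp)
      finally show ?thesis by (simp only: sum_distrib_left)
    qed
    also have "\<dots> = (\<Sum>j\<in>S. A a j * g j)" using p by (intro sum.cong) (simp_all add: sym[of a])
    finally have "\<forall>i\<in>insert a S. (\<Sum>j\<in>insert a S. A i j * g' j) = \<beta> i"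
      using g by (simp only: ga) auto
    then show ?thesis by blast
  next
    case False
    define \<alpha> where "\<alpha> = (\<beta> a - (\<Sum>j\<in>S. A a j * g j)) / \<omega>"
    have "(\<Sum>j\<in>insert a S. A i j * (g' j + \<alpha> * w j)) = (\<Sum>j\<in>S. A i j * g j) + \<alpha> * (\<Sum>j\<in>insert a S. A i j * w j)" for i
      unfolding ga[symmetric] sum_distrib_left sum.distrib[symmetric] by (simp only: algebra_simps)
    then have "\<forall>i\<in>insert a S. (\<Sum>j\<in>insert a S. A i j * (g' j + \<alpha> * w j)) = \<beta> i"
      using g w0 False unfolding \<omega>_def[symmetric] by (auto simp: \<alpha>_def \<omega>_def[symmetric])
    then show ?thesis by (intro exI[of _ "\<lambda>j. g' j + \<alpha> * w j"])
  qed
qed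

subsection \<open>Elementwise continuous functions\<close>

lemma frechet_derivative_grad:
  assumes "g differentiable (at x)"
  shows "frechet_derivative g (at x) = (\<lambda>h. grad g x \<bullet> h)"
proof
  fix h :: "real^3"
  have lin: "linear (frechet_derivative g (at x))" using assms by (rule linear_frechet_derivative)
  have "h = (\<Sum>i\<in>UNIV. h $ i *\<^sub>R axis i 1)"
    using basis_expansion[of h] by (simp add: scalar_mult_eq_scaleR)
  then have "frechet_derivative g (at x) h = frechet_derivative g (at x) (\<Sum>i\<in>UNIV. h $ i *\<^sub>R axis i 1)" by simp
  also have "\<dots> = (\<Sum>i\<in>UNIV. h $ i * frechet_derivative g (at x) (axis i 1))"
    by (simp add: linear_sum[OF lin] linear_scale[OF lin])
  also have "\<dots> = grad g x \<bullet> h" by (simp add: grad_def inner_vec_def mult.commute)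
  finally show "frechet_derivative g (at x) h = grad g x \<bullet> h" .
qed

lemma has_derivative_grad:
  assumes "g differentiable (at x)"
  shows "(g has_derivative (\<lambda>h. grad g x \<bullet> h)) (at x)"
  using assms frechet_derivative_grad[OF assms] by (simp add: frechet_derivative_works)

lemma grad_mult:
  assumes "g differentiable (at x)" "h differentiable (at x)"
  shows "grad (\<lambda>x. g x * h x) x = g x *\<^sub>R grad h x + h x *\<^sub>R grad g x"
proof (rule grad_eqI)
  show "((\<lambda>x. g x * h x) has_derivative (\<lambda>k. (g x *\<^sub>R grad h x + h x *\<^sub>R grad g x) \<bullet> k)) (at x)"
    using has_derivative_mult[OF has_derivative_grad[OF assms(1)] has_derivative_grad[OF assms(2)]]
    by (simp add: inner_add_left mult.commute)
qed

lemma C1_mult: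
  assumes g: "g \<in> C1 S" and h: "h \<in> C1 S"
  shows "(\<lambda>x. g x * h x) \<in> C1 S"
proof -
  have "continuous_on S (\<lambda>x. g x *\<^sub>R grad h x + h x *\<^sub>R grad g x)"
    using g h by (intro continuous_intros)
      (auto simp: C1_def intro!: continuous_at_imp_continuous_on differentiable_imp_continuous_within)
  then have "continuous_on S (grad (\<lambda>x. g x * h x))"
    using g h by (subst continuous_on_cong[OF refl grad_mult]) (auto simp: C1_def)
  then show ?thesis using g h by (auto simp: C1_def)
qed

context admissible_discretization
begin

text \<open>A continuous extension to each closed element is the common property of broken
  polynomials, their elementwise gradients, discrete gradients and the drift. It yields traces,
  boundedness and integrability at once.\<close>

definition elementwise_continuous :: "(real^3 \<Rightarrow> 'b::euclidean_space) \<Rightarrow> bool" where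
  "elementwise_continuous F \<longleftrightarrow> (\<forall>R\<in>T. \<exists>C. continuous_on R C \<and> (\<forall>x\<in>interior R. F x = C x))"

lemma trace_in_extension:
  fixes F :: "real^3 \<Rightarrow> 'b::euclidean_space"
  assumes R: "R \<in> T" and C: "continuous_on R C" "\<And>x. x \<in> interior R \<Longrightarrow> F x = C x" and x: "x \<in> R"
  shows "(F \<longlongrightarrow> C x) (at x within interior R)" "trace_in R F x = C x"
proof -
  have "(C \<longlongrightarrow> C x) (at x within R)" using C(1) x by (simp add: continuous_on_def)
  then have "(C \<longlongrightarrow> C x) (at x within interior R)" by (rule tendsto_within_subset) (rule interior_subset)
  then show lim: "(F \<longlongrightarrow> C x) (at x within interior R)"
    by (rule Lim_transform_eventually) (simp add: eventually_at_filter C(2))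
  show "trace_in R F x = C x" by (rule trace_in_eq[OF element[OF R] x lim])
qed

lemma elementwise_continuousD:
  assumes F: "elementwise_continuous F" and R: "R \<in> T"
  shows "continuous_on R (trace_in R F)" "x \<in> interior R \<Longrightarrow> trace_in R F x = F x"
    "x \<in> R \<Longrightarrow> \<exists>l. (F \<longlongrightarrow> l) (at x within interior R)"
proof -
  obtain C where C: "continuous_on R C" "\<And>x. x \<in> interior R \<Longrightarrow> F x = C x"
    using F R by (auto simp: elementwise_continuous_def)
  note ext = trace_in_extension[OF R C]
  show "continuous_on R (trace_in R F)" using C(1) ext(2) by (simp cong: continuous_on_cong)
  show "x \<in> interior R \<Longrightarrow> trace_in R F x = F x" using ext(2) C(2) interior_subset by fastforce
  show "x \<in> R \<Longrightarrow> \<exists>l. (F \<longlongrightarrow> l) (at x within interior R)" using ext(1) by blast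
qed

lemma elementwise_continuous_compose:
  assumes F: "elementwise_continuous F" and G: "elementwise_continuous G"
    and H: "continuous_on UNIV (\<lambda>p. H (fst p) (snd p))"
  shows "elementwise_continuous (\<lambda>x. H (F x) (G x))"
    "R \<in> T \<Longrightarrow> x \<in> R \<Longrightarrow> trace_in R (\<lambda>x. H (F x) (G x)) x = H (trace_in R F x) (trace_in R G x)"
proof -
  have c: "continuous_on R (\<lambda>x. H (trace_in R F x) (trace_in R G x))" if "R \<in> T" for R
    using continuous_on_compose2[OF H continuous_on_Pair[OF elementwise_continuousD(1)[OF F that] elementwise_continuousD(1)[OF G that]]]
    by simp
  have e: "H (F x) (G x) = H (trace_in R F x) (trace_in R G x)" if "R \<in> T" "x \<in> interior R" for R x
    using that elementwise_continuousD(2)[OF F] elementwise_continuousD(2)[OF G] by simp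
  show "elementwise_continuous (\<lambda>x. H (F x) (G x))"
    unfolding elementwise_continuous_def using c e by blast
  show "R \<in> T \<Longrightarrow> x \<in> R \<Longrightarrow> trace_in R (\<lambda>x. H (F x) (G x)) x = H (trace_in R F x) (trace_in R G x)"
    by (rule trace_in_extension(2)[OF _ c e])
qed

lemma elementwise_continuous_mult:
  fixes F G :: "real^3 \<Rightarrow> real"
  assumes "elementwise_continuous F" "elementwise_continuous G"
  shows "elementwise_continuous (\<lambda>x. F x * G x)"
    "R \<in> T \<Longrightarrow> x \<in> R \<Longrightarrow> trace_in R (\<lambda>x. F x * G x) x = trace_in R F x * trace_in R G x"
proof -
  have H: "continuous_on UNIV (\<lambda>p::real \<times> real. fst p * snd p)" by (intro continuous_intros)
  show "elementwise_continuous (\<lambda>x. F x * G x)" by (rule elementwise_continuous_compose(1)[OF assms H])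
  show "R \<in> T \<Longrightarrow> x \<in> R \<Longrightarrow> trace_in R (\<lambda>x. F x * G x) x = trace_in R F x * trace_in R G x"
    by (rule elementwise_continuous_compose(2)[OF assms H])
qed

lemma elementwise_continuous_scaleR:
  fixes G :: "real^3 \<Rightarrow> 'b::euclidean_space"
  assumes "elementwise_continuous F" "elementwise_continuous G"
  shows "elementwise_continuous (\<lambda>x. F x *\<^sub>R G x)"
    "R \<in> T \<Longrightarrow> x \<in> R \<Longrightarrow> trace_in R (\<lambda>x. F x *\<^sub>R G x) x = trace_in R F x *\<^sub>R trace_in R G x"
proof -
  have H: "continuous_on UNIV (\<lambda>p::real \<times> 'b. fst p *\<^sub>R snd p)" by (intro continuous_intros)
  show "elementwise_continuous (\<lambda>x. F x *\<^sub>R G x)" by (rule elementwise_continuous_compose(1)[OF assms H])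
  show "R \<in> T \<Longrightarrow> x \<in> R \<Longrightarrow> trace_in R (\<lambda>x. F x *\<^sub>R G x) x = trace_in R F x *\<^sub>R trace_in R G x"
    by (rule elementwise_continuous_compose(2)[OF assms H])
qed

lemma elementwise_continuous_inner:
  fixes F G :: "real^3 \<Rightarrow> 'b::euclidean_space"
  assumes "elementwise_continuous F" "elementwise_continuous G"
  shows "elementwise_continuous (\<lambda>x. F x \<bullet> G x)"
  by (rule elementwise_continuous_compose[OF assms]) (intro continuous_intros)

lemma elementwise_continuous_integrable:
  fixes F :: "real^3 \<Rightarrow> 'b::euclidean_space"
  assumes F: "elementwise_continuous F" and R: "R \<in> T"
  shows "set_integrable lebesgue R F"
proof -
  have "integrable lborel (\<lambda>x. indicator R x *\<^sub>R trace_in R F x)"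
    using borel_integrable_compact[OF element_compact[OF R] elementwise_continuousD(1)[OF F R]]
    by (simp add: indicator_scaleR_eq_if)
  then have "integrable lebesgue (\<lambda>x. indicator R x *\<^sub>R trace_in R F x)"
    by (subst integrable_completion) auto
  then have "set_integrable lebesgue R (trace_in R F)" by (simp add: set_integrable_def)
  then show ?thesis using LINT_element_cong(2)[OF R elementwise_continuousD(2)[OF F R]] by simp
qed

lemma elementwise_bounded:
  assumes F: "elementwise_continuous F"
  obtains B where "B \<ge> 0" "\<And>x. x \<in> inner_region \<Longrightarrow> norm (F x) \<le> B"
proof -
  have "\<exists>B. \<forall>x\<in>R. norm (trace_in R F x) \<le> B" if "R \<in> T" for R
    using compact_imp_bounded[OF compact_continuous_image[OF elementwise_continuousD(1)[OF F that] element_compact[OF that]]]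
    by (auto simp: bounded_iff)
  then obtain B where B: "\<And>R x. R \<in> T \<Longrightarrow> x \<in> R \<Longrightarrow> norm (trace_in R F x) \<le> B R" by metis
  have "norm (F x) \<le> (\<Sum>R\<in>T. \<bar>B R\<bar>)" if x: "x \<in> inner_region" for x
  proof -
    obtain R where R: "R \<in> T" "x \<in> interior R" using x by (auto simp: inner_region_def)
    have "norm (F x) \<le> B R" using B[OF R(1), of x] elementwise_continuousD(2)[OF F R] R(2) interior_subset by auto
    also have "\<dots> \<le> \<bar>B R\<bar>" by simp
    also have "\<dots> \<le> (\<Sum>R\<in>T. \<bar>B R\<bar>)" using finite_mesh R(1) by (intro member_le_sum) auto
    finally show ?thesis .
  qed
  moreover have "0 \<le> (\<Sum>R\<in>T. \<bar>B R\<bar>)" by (simp add: sum_nonneg)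
  ultimately show ?thesis using that by blast
qed

lemma elementwise_continuous_on_inner:
  assumes F: "elementwise_continuous F"
  shows "continuous_on inner_region F"
proof -
  have "continuous_on (interior R) F" if "R \<in> T" for R
    using continuous_on_subset[OF elementwise_continuousD(1)[OF F that] interior_subset]
      elementwise_continuousD(2)[OF F that] by (simp cong: continuous_on_cong)
  then show ?thesis unfolding inner_region_def by (intro continuous_on_open_UN) auto
qed

lemma elementwise_continuous_integrable_inner:
  fixes F :: "real^3 \<Rightarrow> 'b::euclidean_space"
  assumes F: "elementwise_continuous F"
  shows "set_integrable lebesgue inner_region F"
proof -
  have "set_integrable lebesgue (\<Union>R\<in>T. R) F"
    by (rule set_integrable_UN[OF finite_mesh elementwise_continuous_integrable[OF F]]) auto
  then show ?thesis
    by (rule set_integrable_subset) (use interior_subset open_inner_region in \<open>auto simp: inner_region_def\<close>)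
qed

text \<open>The divergence theorem for the product field \<open>g V\<close>. Integrability is asked
  of the whole integrand, which accommodates a drift whose divergence is merely integrable.\<close>

lemma element_integration_by_parts:
  assumes R: "R \<in> T"
    and g: "g \<in> C1 (interior R)" "elementwise_continuous g"
    and V: "\<And>i. (\<lambda>x. V x $ i) \<in> C1 (interior R)" "elementwise_continuous V"
    and int: "set_integrable lebesgue R (\<lambda>x. g x * divergence V x + grad g x \<bullet> V x)"
  shows "(LINT x:R|lebesgue. g x * divergence V x + grad g x \<bullet> V x) =
    (\<Sum>(n, c)\<in>facets R. LINT x:(R \<inter> {x. n \<bullet> x = c})|plane_area n c. trace_in R g x * (trace_in R V x \<bullet> n))"
proof -
  let ?W = "\<lambda>x. g x *\<^sub>R V x"
  note W = elementwise_continuous_scaleR[OF g(2) V(2)]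
  have W1: "(\<lambda>x. ?W x $ i) \<in> C1 (interior R)" for i
    using C1_mult[OF g(1) V(1)] by simp
  have div: "divergence ?W x = g x * divergence V x + grad g x \<bullet> V x" if x: "x \<in> interior R" for x
  proof -
    have gd: "g differentiable (at x)" and Vd: "(\<lambda>x. V x $ i) differentiable (at x)" for i
      using g(1) V(1) x by (auto simp: C1_def)
    have "divergence ?W x = (\<Sum>i\<in>UNIV. grad (\<lambda>x. g x * V x $ i) x $ i)"
      using divergence_eq_grad[of ?W x] gd Vd by simp
    also have "\<dots> = (\<Sum>i\<in>UNIV. g x * grad (\<lambda>x. V x $ i) x $ i + V x $ i * grad g x $ i)"
      by (simp add: grad_mult[OF gd Vd])
    also have "\<dots> = g x * divergence V x + grad g x \<bullet> V x"
      by (simp add: divergence_eq_grad[OF Vd] sum.distrib sum_distrib_left inner_vec_def mult.commute)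
    finally show ?thesis .
  qed
  have "(LINT x:R|lebesgue. g x * divergence V x + grad g x \<bullet> V x) = (LINT x:R|lebesgue. divergence ?W x)"
    by (rule LINT_element_cong[OF R]) (simp add: div)
  also have "\<dots> = (\<Sum>(n, c)\<in>facets R. LINT x:(R \<inter> {x. n \<bullet> x = c})|plane_area n c. trace_in R ?W x \<bullet> n)"
    by (rule divergence_theorem[OF element[OF R] W1 elementwise_continuousD(3)[OF W(1) R]])
      (use int LINT_element_cong(2)[OF R div] in auto)
  also have "\<dots> = (\<Sum>(n, c)\<in>facets R. LINT x:(R \<inter> {x. n \<bullet> x = c})|plane_area n c. trace_in R g x * (trace_in R V x \<bullet> n))"
  proof (intro sum.cong refl, clarify)
    fix n c
    show "(LINT x:(R \<inter> {x. n \<bullet> x = c})|plane_area n c. trace_in R ?W x \<bullet> n) =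
      (LINT x:(R \<inter> {x. n \<bullet> x = c})|plane_area n c. trace_in R g x * (trace_in R V x \<bullet> n))"
      by (auto simp: set_lebesgue_integral_def indicator_def W(2)[OF R] intro!: Bochner_Integration.integral_cong)
  qed
  finally show ?thesis .
qed

section \<open>The broken polynomial space\<close>

lemma Wh_iff: "g \<in> Wh k d \<longleftrightarrow> (\<forall>R\<in>T. \<exists>P\<in>Qpoly k. \<forall>x\<in>interior R. g x = P x)"
proof
  assume "\<forall>R\<in>T. \<exists>P\<in>Qpoly k. \<forall>x\<in>interior R. g x = P x"
  \<comment> \<open>Polynomials are bounded on the compact elements and the skeleton is negligible,
    which yields square integrability over the domain.\<close>
  then have g: "\<forall>R\<in>T. \<exists>P\<in>Qpoly k. \<forall>x\<in>interior R. g x = P x" and ec: "elementwise_continuous g"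
    unfolding elementwise_continuous_def using Qpoly_continuous by blast+
  have 1: "set_integrable lebesgue \<Omega> g"
    unfolding LINT_domain(2) by (rule elementwise_continuous_integrable_inner[OF ec])
  have 2: "set_integrable lebesgue \<Omega> (\<lambda>x. (g x)\<^sup>2)"
    unfolding LINT_domain(2) power2_eq_square
    by (rule elementwise_continuous_integrable_inner[OF elementwise_continuous_mult(1)[OF ec ec]])
  have \<Omega>m: "\<Omega> \<inter> space lebesgue \<in> sets lebesgue" by simp
  have "integrable (lebesgue_on \<Omega>) g" "integrable (lebesgue_on \<Omega>) (\<lambda>x. (g x)\<^sup>2)"
    unfolding integrable_restrict_space[OF \<Omega>m]
    using 1 2 unfolding set_integrable_def .
  then have "g \<in> L2 \<Omega>" unfolding L2_def by blast
  then show "g \<in> Wh k d" using g unfolding Wh_def by blast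
qed (simp add: Wh_def)

lemma Wh_elementwise_continuous: "g \<in> Wh k d \<Longrightarrow> elementwise_continuous g"
  unfolding elementwise_continuous_def Wh_iff by (meson Qpoly_continuous)

lemma Wh_of_Qpoly: "P \<in> Qpoly k \<Longrightarrow> P \<in> Wh k d"
  unfolding Wh_iff by blast

lemma Wh_sum:
  assumes "\<And>a. a \<in> A \<Longrightarrow> g a \<in> Wh k d"
  shows "(\<lambda>x. \<Sum>a\<in>A. c a * g a x) \<in> Wh k d"
  unfolding Wh_iff
proof
  fix R assume R: "R \<in> T"
  then have "\<exists>P. P \<in> Qpoly k \<and> (\<forall>x\<in>interior R. g a x = P x)" if "a \<in> A" for a
    using assms[OF that] unfolding Wh_iff by blast
  then obtain P where P: "\<And>a. a \<in> A \<Longrightarrow> P a \<in> Qpoly k" "\<And>a x. a \<in> A \<Longrightarrow> x \<in> interior R \<Longrightarrow> g a x = P a x"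
    by metis
  show "\<exists>Q\<in>Qpoly k. \<forall>x\<in>interior R. (\<Sum>a\<in>A. c a * g a x) = Q x"
    by (rule bexI[OF _ Qpoly_sum[of A P k c, OF P(1)]]) (simp_all add: P(2))
qed

lemma Wh_grad:
  assumes g: "g \<in> Wh k d"
  shows "R \<in> T \<Longrightarrow> g \<in> C1 (interior R)" "grad g \<in> Wh3 k d"
    "x \<in> inner_region \<Longrightarrow> g differentiable (at x)"
proof -
  have *: "\<exists>D. (\<forall>i. (\<lambda>x. D x $ i) \<in> Qpoly k) \<and> (\<forall>x\<in>interior R. (g has_derivative (\<lambda>h. D x \<bullet> h)) (at x))"
    if R: "R \<in> T" for R
  proof -
    obtain P where P: "P \<in> Qpoly k" "\<forall>x\<in>interior R. g x = P x" using g R unfolding Wh_iff by blast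
    obtain D where D: "\<And>i. (\<lambda>x. D x $ i) \<in> Qpoly k" "\<And>x. (P has_derivative (\<lambda>h. D x \<bullet> h)) (at x)"
      using Qpoly_derivative[OF P(1)] by blast
    have "(g has_derivative (\<lambda>h. D x \<bullet> h)) (at x)" if "x \<in> interior R" for x
      by (rule has_derivative_transform_within_open[OF D(2) open_interior that]) (use P(2) in auto)
    then show ?thesis using D(1) by blast
  qed
  show "g \<in> C1 (interior R)" if R: "R \<in> T" for R
  proof -
    obtain D where D: "\<forall>i. (\<lambda>x. D x $ i) \<in> Qpoly k" "\<forall>x\<in>interior R. (g has_derivative (\<lambda>h. D x \<bullet> h)) (at x)"
      using *[OF R] by blast
    have "continuous_on (interior R) D"
      using continuous_on_vec_lambda[of "interior R" "\<lambda>i x. D x $ i"] D(1) Qpoly_continuous by auto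
    then have "continuous_on (interior R) (grad g)"
      using D(2) grad_eqI by (subst continuous_on_cong[OF refl]) auto
    moreover have "\<forall>x\<in>interior R. g differentiable (at x)" using D(2) by (auto simp: differentiable_def)
    ultimately show ?thesis by (simp add: C1_def)
  qed
  show "grad g \<in> Wh3 k d"
    unfolding Wh3_def Wh_iff
  proof (intro CollectI allI ballI)
    fix i R assume R: "R \<in> T"
    obtain D where D: "\<forall>i. (\<lambda>x. D x $ i) \<in> Qpoly k" "\<forall>x\<in>interior R. (g has_derivative (\<lambda>h. D x \<bullet> h)) (at x)"
      using *[OF R] by blast
    show "\<exists>P\<in>Qpoly k. \<forall>x\<in>interior R. grad g x $ i = P x"
      using D grad_eqI by (intro bexI[of _ "\<lambda>x. D x $ i"]) auto
  qed
  show "x \<in> inner_region \<Longrightarrow> g differentiable (at x)"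
    using * unfolding inner_region_def differentiable_def by blast
qed

lemma Wh3_component: "V \<in> Wh3 k d \<Longrightarrow> (\<lambda>x. V x $ i) \<in> Wh k d"
  by (simp add: Wh3_def)

lemma Wh3_elementwise_continuous:
  assumes V: "V \<in> Wh3 k d"
  shows "elementwise_continuous V"
  unfolding elementwise_continuous_def
proof
  fix R assume R: "R \<in> T"
  let ?C = "\<lambda>x. \<chi> i. trace_in R (\<lambda>x. V x $ i) x"
  note ec = Wh_elementwise_continuous[OF Wh3_component[OF V]]
  have "continuous_on R ?C" using elementwise_continuousD(1)[OF ec R] by (intro continuous_on_vec_lambda)
  moreover have "\<forall>x\<in>interior R. V x = ?C x"
    using elementwise_continuousD(2)[OF ec R] by (simp add: vec_eq_iff)
  ultimately show "\<exists>C. continuous_on R C \<and> (\<forall>x\<in>interior R. V x = C x)" by blast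
qed

lemma Wh3_divergence:
  assumes V: "V \<in> Wh3 k d"
  shows "divergence V \<in> Wh k d" "x \<in> inner_region \<Longrightarrow> divergence V x = (\<Sum>i\<in>UNIV. grad (\<lambda>x. V x $ i) x $ i)"
proof -
  show eq: "divergence V x = (\<Sum>i\<in>UNIV. grad (\<lambda>x. V x $ i) x $ i)" if "x \<in> inner_region" for x
    by (rule divergence_eq_grad) (rule Wh_grad(3)[OF Wh3_component[OF V] that])
  have "(\<lambda>x. \<Sum>i\<in>UNIV. 1 * grad (\<lambda>x. V x $ i) x $ i) \<in> Wh k d"
    by (rule Wh_sum) (rule Wh3_component[OF Wh_grad(2)[OF Wh3_component[OF V]]])
  moreover have "interior R \<subseteq> inner_region" if "R \<in> T" for R using that by (auto simp: inner_region_def)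
  ultimately show "divergence V \<in> Wh k d" unfolding Wh_iff using eq by (simp add: subset_iff)
qed

lemma Wh_cong: "(\<And>x. x \<in> inner_region \<Longrightarrow> g x = h x) \<Longrightarrow> g \<in> Wh k d \<longleftrightarrow> h \<in> Wh k d"
  unfolding Wh_iff inner_region_def by (intro ball_cong refl bex_cong) force

end

subsection \<open>The discrete gradient\<close>

lemma set_integral_lincomb:
  fixes f :: "'i \<Rightarrow> 'a \<Rightarrow> real"
  assumes "\<And>s. s \<in> S \<Longrightarrow> set_integrable M A (f s)"
  shows "(LINT x:A|M. \<Sum>s\<in>S. c s * f s x) = (\<Sum>s\<in>S. c s * (LINT x:A|M. f s x))"
proof -
  have "(LINT x:A|M. \<Sum>s\<in>S. c s * f s x) = (\<integral>x. (\<Sum>s\<in>S. c s * (indicator A x *\<^sub>R f s x)) \<partial>M)"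
    unfolding set_lebesgue_integral_def
    by (rule Bochner_Integration.integral_cong) (auto simp: sum_distrib_left mult_ac)
  also have "\<dots> = (\<Sum>s\<in>S. \<integral>x. c s * (indicator A x *\<^sub>R f s x) \<partial>M)"
    using assms unfolding set_integrable_def
    by (intro Bochner_Integration.integral_sum integrable_mult_right)
  finally show ?thesis by (simp add: set_lebesgue_integral_def)
qed

lemma set_integral_cong_set:
  assumes "\<And>x. x \<in> A \<Longrightarrow> f x = g x"
  shows "(LINT x:A|M. f x) = (LINT x:A|M. g x)"
  unfolding set_lebesgue_integral_def
  by (rule Bochner_Integration.integral_cong) (auto simp: indicator_def assms)

lemma frechet_derivative_cong_open:
  assumes "open S" "x \<in> S" "\<And>y. y \<in> S \<Longrightarrow> f y = g y"
  shows "frechet_derivative f (at x) = frechet_derivative g (at x)"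
proof -
  have "(f has_derivative D) (at x) \<longleftrightarrow> (g has_derivative D) (at x)" for D
    using has_derivative_transform_within_open[OF _ assms(1,2), of f D UNIV g]
      has_derivative_transform_within_open[OF _ assms(1,2), of g D UNIV f] assms(3) by auto
  then show ?thesis by (simp add: frechet_derivative_def)
qed

context admissible_discretization
begin

lemma interior_subset_inner: "R \<in> T \<Longrightarrow> interior R \<subseteq> inner_region"
  by (auto simp: inner_region_def)

lemma check_flux_integrable:
  assumes e: "(R, R', n, c) \<in> oriented_faces d"
    and g: "elementwise_continuous g" and V: "elementwise_continuous V"
  shows "set_integrable (plane_area n c) (R \<inter> R' \<inter> \<Omega>) (\<lambda>x. check_flux d g R R' n x * (trace_in R V x \<bullet> n))"
proof (rule set_integrable_plane_area[of _ "R \<inter> R'"])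
  note D = oriented_facesD[OF e]
  show "norm n = 1" by (rule D)
  show "compact (R \<inter> R')" using element_compact[OF D(1)] element_closed[OF D(2)] by (rule compact_Int_closed)
  have "continuous_on (R \<inter> R') (trace_in R g)" "continuous_on (R \<inter> R') (trace_in R' g)"
    "continuous_on (R \<inter> R') (trace_in R V)"
    by (rule continuous_on_subset[OF elementwise_continuousD(1)[OF g D(1)]]
        continuous_on_subset[OF elementwise_continuousD(1)[OF g D(2)]]
        continuous_on_subset[OF elementwise_continuousD(1)[OF V D(1)]]; simp)+
  then show "continuous_on (R \<inter> R') (\<lambda>x. check_flux d g R R' n x * (trace_in R V x \<bullet> n))"
    unfolding check_flux_def by (cases "n \<bullet> refdir d < 0") (auto intro!: continuous_intros)
  show "R \<inter> R' \<inter> \<Omega> \<in> sets borel" using D(1,2) by simp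
qed auto

lemma boundary_flux_integrable:
  assumes R: "R \<in> T" and i: "i \<in> facets R"
    and g: "elementwise_continuous g" and V: "elementwise_continuous V"
  shows "set_integrable (plane_area (fst i) (snd i)) (R \<inter> {x. fst i \<bullet> x = snd i} \<inter> frontier \<Omega>)
    (\<lambda>x. trace_in R g x * (trace_in R V x \<bullet> fst i))"
proof (rule set_integrable_plane_area[of _ R])
  show "norm (fst i) = 1" by (rule facets_props(1)[OF i])
  show "compact R" by (rule element_compact[OF R])
  show "continuous_on R (\<lambda>x. trace_in R g x * (trace_in R V x \<bullet> fst i))"
    by (intro continuous_intros elementwise_continuousD(1)[OF _ R] g V)
  have "R \<in> sets borel" "{x. fst i \<bullet> x = snd i} \<in> sets borel" "frontier \<Omega> \<in> sets borel"
    using R by (auto simp: borel_closed closed_hyperplane)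
  then show "R \<inter> {x. fst i \<bullet> x = snd i} \<inter> frontier \<Omega> \<in> sets borel" by blast
qed auto

text \<open>The share of element \<open>R\<close> in the right-hand side of the equation of the
  discrete gradient. It sees the test field only through its divergence and inner trace on
  \<open>R\<close>, so the equation decouples in \<open>V\<close>; the neighbours enter only through
  \<open>g\<close>.\<close>

definition dgrad_functional :: "(real^3 \<Rightarrow> real) \<Rightarrow> (real^3) set \<Rightarrow> (real^3 \<Rightarrow> real^3) \<Rightarrow> real" where
  "dgrad_functional g R V = - (LINT x:R|lebesgue. g x * divergence V x) +
     (\<Sum>i\<in>facets R. (\<Sum>R' | (R, R', i) \<in> oriented_faces d.
        LINT x:(R \<inter> R' \<inter> \<Omega>)|plane_area (fst i) (snd i). check_flux d g R R' (fst i) x * (trace_in R V x \<bullet> fst i)) +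
      (LINT x:(R \<inter> {x. fst i \<bullet> x = snd i} \<inter> frontier \<Omega>)|plane_area (fst i) (snd i).
        trace_in R g x * (trace_in R V x \<bullet> fst i)))"

lemma is_discrete_gradient_iff:
  "is_discrete_gradient k d g G \<longleftrightarrow> G \<in> Wh3 k d \<and> (\<forall>V\<in>Wh3 k d. ip d G V = (\<Sum>R\<in>T. dgrad_functional g R V))"
  unfolding is_discrete_gradient_def
  by (simp add: ip_def dgrad_functional_def sum_oriented_faces face_integral_def Gamma_integral_def
      sum.distrib sum_negf sum_subtractf split_beta')

lemma divergence_cong:
  assumes "R \<in> T" "\<And>x. x \<in> interior R \<Longrightarrow> V x = W x" "x \<in> interior R"
  shows "divergence V x = divergence W x"
  using frechet_derivative_cong_open[OF open_interior assms(3), of V W] assms(2) by (simp add: divergence_def)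

lemma dgrad_functional_cong:
  assumes R: "R \<in> T" and V: "elementwise_continuous V" and W: "\<And>x. x \<in> interior R \<Longrightarrow> W x = V x"
  shows "dgrad_functional g R W = dgrad_functional g R V"
proof -
  have tr: "trace_in R W x = trace_in R V x" if "x \<in> R" for x
    by (rule trace_in_extension(2)[OF R elementwise_continuousD(1)[OF V R] _ that])
       (simp add: W elementwise_continuousD(2)[OF V R])
  have vol: "(LINT x:R|lebesgue. g x * divergence W x) = (LINT x:R|lebesgue. g x * divergence V x)"
    by (rule LINT_element_cong[OF R]) (simp add: divergence_cong[OF R W])
  show ?thesis unfolding dgrad_functional_def vol
    by (intro arg_cong2[of _ _ _ _ "(+)"] sum.cong refl set_integral_cong_set) (auto simp: tr)
qed

lemma dgrad_functional_lincomb: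
  assumes R: "R \<in> T" and g: "elementwise_continuous g" and b: "\<And>s. s \<in> S \<Longrightarrow> b s \<in> Wh3 k d"
  shows "dgrad_functional g R (\<lambda>x. \<Sum>s\<in>S. c s *\<^sub>R b s x) = (\<Sum>s\<in>S. c s * dgrad_functional g R (b s))"
proof -
  let ?V = "\<lambda>x. \<Sum>s\<in>S. c s *\<^sub>R b s x"
  note ec = Wh3_elementwise_continuous[OF b]
  have tr: "trace_in R ?V x = (\<Sum>s\<in>S. c s *\<^sub>R trace_in R (b s) x)" if "x \<in> R" for x
    by (rule trace_in_extension(2)[OF R _ _ that])
       (auto intro!: continuous_intros elementwise_continuousD(1)[OF ec R] simp: elementwise_continuousD(2)[OF ec R])
  have div: "divergence ?V x = (\<Sum>s\<in>S. c s * divergence (b s) x)" if x: "x \<in> interior R" for x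
  proof -
    have xi: "x \<in> inner_region" using x interior_subset_inner[OF R] by blast
    have der: "((\<lambda>x. \<Sum>s\<in>S. c s * b s x $ i) has_derivative (\<lambda>h. (\<Sum>s\<in>S. c s *\<^sub>R grad (\<lambda>x. b s x $ i) x) \<bullet> h)) (at x)" for i
    proof -
      have "((\<lambda>x. \<Sum>s\<in>S. c s * b s x $ i) has_derivative (\<lambda>h. \<Sum>s\<in>S. c s * (grad (\<lambda>x. b s x $ i) x \<bullet> h))) (at x)"
        by (intro has_derivative_sum has_derivative_mult_right has_derivative_grad Wh_grad(3)[OF Wh3_component[OF b] xi])
      then show ?thesis by (simp add: inner_sum_left)
    qed
    have "divergence ?V x = (\<Sum>i\<in>UNIV. grad (\<lambda>x. ?V x $ i) x $ i)"
      by (rule divergence_eq_grad) (use der in \<open>auto simp: differentiable_def\<close>)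
    also have "\<dots> = (\<Sum>i\<in>UNIV. \<Sum>s\<in>S. c s * grad (\<lambda>x. b s x $ i) x $ i)"
      using grad_eqI[OF der] by simp
    also have "\<dots> = (\<Sum>s\<in>S. c s * divergence (b s) x)"
      by (subst sum.swap) (simp add: Wh3_divergence(2)[OF b xi] sum_distrib_left)
    finally show ?thesis .
  qed
  have 1: "(LINT x:R|lebesgue. g x * divergence ?V x) = (\<Sum>s\<in>S. c s * (LINT x:R|lebesgue. g x * divergence (b s) x))"
  proof -
    have "(LINT x:R|lebesgue. g x * divergence ?V x) = (LINT x:R|lebesgue. \<Sum>s\<in>S. c s * (g x * divergence (b s) x))"
      by (rule LINT_element_cong[OF R]) (simp add: div sum_distrib_left mult_ac)
    also have "\<dots> = (\<Sum>s\<in>S. c s * (LINT x:R|lebesgue. g x * divergence (b s) x))"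
      by (intro set_integral_lincomb elementwise_continuous_integrable[OF _ R] elementwise_continuous_mult(1) g
          Wh_elementwise_continuous Wh3_divergence b)
    finally show ?thesis .
  qed
  have flux: "(LINT x:A|M. \<phi> x * (trace_in R ?V x \<bullet> n)) = (\<Sum>s\<in>S. c s * (LINT x:A|M. \<phi> x * (trace_in R (b s) x \<bullet> n)))"
    if "\<And>s. s \<in> S \<Longrightarrow> set_integrable M A (\<lambda>x. \<phi> x * (trace_in R (b s) x \<bullet> n))" "A \<subseteq> R" for A M \<phi> n
  proof -
    have "(LINT x:A|M. \<phi> x * (trace_in R ?V x \<bullet> n)) = (LINT x:A|M. \<Sum>s\<in>S. c s * (\<phi> x * (trace_in R (b s) x \<bullet> n)))"
      using that(2) by (intro set_integral_cong_set) (auto simp: tr inner_sum_left sum_distrib_left mult_ac)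
    also have "\<dots> = (\<Sum>s\<in>S. c s * (LINT x:A|M. \<phi> x * (trace_in R (b s) x \<bullet> n)))"
      by (rule set_integral_lincomb) (rule that(1))
    finally show ?thesis .
  qed
  let ?I = "\<lambda>V R' i. LINT x:(R \<inter> R' \<inter> \<Omega>)|plane_area (fst i) (snd i). check_flux d g R R' (fst i) x * (trace_in R V x \<bullet> fst i)"
    and ?B = "\<lambda>V i. LINT x:(R \<inter> {x. fst i \<bullet> x = snd i} \<inter> frontier \<Omega>)|plane_area (fst i) (snd i).
        trace_in R g x * (trace_in R V x \<bullet> fst i)"
  have 2: "?I ?V R' i = (\<Sum>s\<in>S. c s * ?I (b s) R' i)" if "(R, R', i) \<in> oriented_faces d" for R' i
    by (rule flux) (use that in \<open>auto intro: check_flux_integrable g ec\<close>)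
  have 3: "?B ?V i = (\<Sum>s\<in>S. c s * ?B (b s) i)" if "i \<in> facets R" for i
    by (rule flux) (auto intro: boundary_flux_integrable R that g ec)
  have "dgrad_functional g R ?V = - (\<Sum>s\<in>S. c s * (LINT x:R|lebesgue. g x * divergence (b s) x)) +
     (\<Sum>i\<in>facets R. (\<Sum>R' | (R, R', i) \<in> oriented_faces d. \<Sum>s\<in>S. c s * ?I (b s) R' i) +
      (\<Sum>s\<in>S. c s * ?B (b s) i))"
    unfolding dgrad_functional_def 1
    by (intro arg_cong2[of _ _ _ _ "(+)"] sum.cong refl) (simp_all add: 2 3)
  also have "\<dots> = (\<Sum>s\<in>S. c s * dgrad_functional g R (b s))"
    unfolding dgrad_functional_def distrib_left sum.distrib sum_distrib_left sum_negf mult_minus_right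
    by (simp only: sum.swap[of _ S "facets R"] sum.swap[of _ S "{R'. _ R'}"])
  finally show ?thesis .
qed

section \<open>Existence and uniqueness of the discrete gradient\<close>

lemma Wh3_lincomb:
  assumes "\<And>s. s \<in> S \<Longrightarrow> b s \<in> Wh3 k d"
  shows "(\<lambda>x. \<Sum>s\<in>S. c s *\<^sub>R b s x) \<in> Wh3 k d"
  unfolding Wh3_def using Wh_sum[of S "\<lambda>s x. b s x $ _" c] Wh3_component[OF assms] by simp

text \<open>The squared length vanishes almost everywhere; inside \<open>R\<close> the set where
  \<open>F\<close> is nonzero is open, and a nonempty open set is not null.\<close>

lemma zero_if_integral_zero:
  assumes F: "elementwise_continuous F" and R: "R \<in> T" and z: "(LINT x:R|lebesgue. F x \<bullet> F x) = 0"
    and x: "x \<in> interior R"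
  shows "F x = 0"
proof (rule ccontr)
  assume Fx: "F x \<noteq> 0"
  have "integrable lebesgue (\<lambda>x. indicator R x *\<^sub>R (F x \<bullet> F x))"
    using elementwise_continuous_integrable[OF elementwise_continuous_inner[OF F F] R] by (simp add: set_integrable_def)
  moreover have "AE x in lebesgue. 0 \<le> indicator R x *\<^sub>R (F x \<bullet> F x)" by simp
  ultimately have "AE x in lebesgue. indicator R x *\<^sub>R (F x \<bullet> F x) = 0"
    using z integral_nonneg_eq_0_iff_AE unfolding set_lebesgue_integral_def by blast
  then have ae: "AE y in lebesgue. y \<in> R \<longrightarrow> F y = 0" by eventually_elim (auto simp: indicator_def)
  have cont: "continuous_on (interior R) F"
    by (rule continuous_on_subset[OF elementwise_continuous_on_inner[OF F] interior_subset_inner[OF R]])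
  define U where "U = interior R \<inter> F -` (- {0})"
  have oU: "open U" unfolding U_def
    by (rule continuous_open_preimage[OF cont]) (simp_all add: open_Compl)
  have "x \<in> U" using x Fx by (simp add: U_def)
  moreover have "negligible U"
  proof -
    have "AE y in lebesgue. y \<notin> U"
      using ae by eventually_elim (use interior_subset[of R] in \<open>auto simp: U_def\<close>)
    moreover have "U \<in> sets lebesgue" using oU by (simp add: borel_open)
    ultimately have "U \<in> null_sets lebesgue" by (simp add: AE_iff_null_sets)
    then show ?thesis by (simp add: negligible_iff_null_sets)
  qed
  ultimately show False using open_not_negligible[OF oU] by blast
qed

text \<open>Riesz representation of the element functional in the span of monomials times unit
  vectors. The Gram system is compatible because a combination of length zero vanishes inside
  \<open>R\<close>, where the functional cannot tell it from the zero field.\<close>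

lemma element_riesz:
  assumes R: "R \<in> T" and g: "elementwise_continuous g"
  obtains W where "\<And>i. (\<lambda>x. W x $ i) \<in> Qpoly k" "\<And>V. V \<in> Wh3 k d \<Longrightarrow> (LINT x:R|lebesgue. W x \<bullet> V x) = dgrad_functional g R V"
proof -
  define S where "S = multi_idx k \<times> (UNIV :: 3 set)"
  define b where "b s x = monomial3 (fst s) x *\<^sub>R (axis (snd s) 1 :: real^3)" for s :: "(nat \<times> nat \<times> nat) \<times> 3" and x
  have bQ: "(\<lambda>x. b s x $ i) \<in> Qpoly k" if "s \<in> S" for s i
    using that Qpoly_monomial[of "fst s" k] Qpoly_0[of k]
    by (cases "i = snd s") (auto simp: b_def S_def axis_def)
  have b3: "b s \<in> Wh3 k d" if "s \<in> S" for s
    unfolding Wh3_def using bQ[OF that] Wh_of_Qpoly by blast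
  note ecb = Wh3_elementwise_continuous[OF b3]
  define A where "A s s' = (LINT x:R|lebesgue. b s x \<bullet> b s' x)" for s s'
  define W where "W c x = (\<Sum>s\<in>S. c s *\<^sub>R b s x)" for c :: "(nat \<times> nat \<times> nat) \<times> 3 \<Rightarrow> real" and x
  have W3: "W c \<in> Wh3 k d" for c unfolding W_def by (rule Wh3_lincomb[OF b3])
  have inner: "(LINT x:R|lebesgue. b s x \<bullet> W c x) = (\<Sum>s'\<in>S. c s' * A s s')" if "s \<in> S" for s c
    unfolding W_def A_def inner_sum_right inner_scaleR_right
    by (intro set_integral_lincomb elementwise_continuous_integrable[OF _ R] elementwise_continuous_inner ecb that)
  have inner2: "(LINT x:R|lebesgue. W e x \<bullet> W c x) = (\<Sum>s\<in>S. \<Sum>s'\<in>S. e s * c s' * A s s')" for e c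
  proof -
    have "(LINT x:R|lebesgue. W e x \<bullet> W c x) = (LINT x:R|lebesgue. \<Sum>s\<in>S. e s * (b s x \<bullet> W c x))"
      by (simp add: W_def[of e] inner_sum_left)
    also have "\<dots> = (\<Sum>s\<in>S. e s * (LINT x:R|lebesgue. b s x \<bullet> W c x))"
      by (intro set_integral_lincomb elementwise_continuous_integrable[OF _ R] elementwise_continuous_inner ecb
          Wh3_elementwise_continuous W3)
    finally show ?thesis by (simp add: inner sum_distrib_left mult_ac)
  qed
  have "\<exists>c. \<forall>s\<in>S. (\<Sum>s'\<in>S. A s s' * c s') = dgrad_functional g R (b s)"
  proof (rule psd_system_solvable)
    show "finite S" by (simp add: S_def)
    show "A s s' = A s' s" for s s' by (simp add: A_def inner_commute)
    show "0 \<le> (\<Sum>i\<in>S. \<Sum>j\<in>S. c i * c j * A i j)" for c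
      unfolding inner2[symmetric] set_lebesgue_integral_def by (rule integral_nonneg_AE) simp
    fix c assume "(\<Sum>i\<in>S. \<Sum>j\<in>S. c i * c j * A i j) = 0"
    then have z: "(LINT x:R|lebesgue. W c x \<bullet> W c x) = 0" by (simp add: inner2)
    have "W c x = 0" if "x \<in> interior R" for x
      by (rule zero_if_integral_zero[OF Wh3_elementwise_continuous[OF W3] R z that])
    \<comment> \<open>The zero field is written as an empty combination, so that linearity evaluates
      the functional to 0.\<close>
    then have "dgrad_functional g R (W c) = dgrad_functional g R (\<lambda>x. \<Sum>s\<in>{}. 0 *\<^sub>R b s x)"
      using Wh3_elementwise_continuous[OF Wh3_lincomb[of "{}" b "\<lambda>_. 0"]]
      by (intro dgrad_functional_cong R) auto
    also have "\<dots> = 0" using dgrad_functional_lincomb[OF R g, of "{}" b "\<lambda>_. 0"] by simp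
    finally show "(\<Sum>i\<in>S. c i * dgrad_functional g R (b i)) = 0"
      unfolding W_def by (simp add: dgrad_functional_lincomb[OF R g b3])
  qed
  then obtain c where c: "\<forall>s\<in>S. (\<Sum>s'\<in>S. A s s' * c s') = dgrad_functional g R (b s)" by blast
  show ?thesis
  proof
    show "(\<lambda>x. W c x $ i) \<in> Qpoly k" for i
      unfolding W_def using Qpoly_sum[of S "\<lambda>s x. b s x $ i" k c] bQ by simp
    fix V assume V: "V \<in> Wh3 k d"
    have "\<exists>e. \<forall>x\<in>interior R. V x $ i = (\<Sum>a\<in>multi_idx k. e a * monomial3 a x)" for i
    proof -
      obtain P where "P \<in> Qpoly k" "\<forall>x\<in>interior R. V x $ i = P x"
        using Wh3_component[OF V, of i] R unfolding Wh_iff by blast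
      then show ?thesis unfolding Qpoly_iff by auto
    qed
    then obtain e where e: "\<And>i x. x \<in> interior R \<Longrightarrow> V x $ i = (\<Sum>a\<in>multi_idx k. e i a * monomial3 a x)" by metis
    define e' where "e' s = e (snd s) (fst s)" for s :: "(nat \<times> nat \<times> nat) \<times> 3"
    have VW: "V x = W e' x" if x: "x \<in> interior R" for x
    proof (rule vec_eq_iff[THEN iffD2], rule allI)
      fix i
      have "W e' x $ i = (\<Sum>a\<in>multi_idx k. \<Sum>j\<in>UNIV. e j a * (monomial3 a x * axis j 1 $ i))"
        by (simp add: W_def b_def e'_def S_def sum.cartesian_product split_beta' mult.assoc)
      also have "\<dots> = (\<Sum>a\<in>multi_idx k. \<Sum>j\<in>UNIV. if j = i then e j a * monomial3 a x else 0)"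
        by (intro sum.cong refl) (auto simp: axis_def)
      finally show "V x $ i = W e' x $ i" using e[OF x] by simp
    qed
    have "(LINT x:R|lebesgue. W c x \<bullet> V x) = (LINT x:R|lebesgue. W e' x \<bullet> W c x)"
      by (rule LINT_element_cong[OF R]) (simp add: VW inner_commute)
    also have "\<dots> = (\<Sum>s\<in>S. e' s * (\<Sum>s'\<in>S. A s s' * c s'))"
      by (simp add: inner2 sum_distrib_left mult_ac)
    also have "\<dots> = (\<Sum>s\<in>S. e' s * dgrad_functional g R (b s))" using c by simp
    also have "\<dots> = dgrad_functional g R (W e')"
      unfolding W_def by (rule dgrad_functional_lincomb[OF R g b3, symmetric])
    also have "\<dots> = dgrad_functional g R V"
      by (rule dgrad_functional_cong[OF R Wh3_elementwise_continuous[OF V]]) (simp add: VW)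
    finally show "(LINT x:R|lebesgue. W c x \<bullet> V x) = dgrad_functional g R V" .
  qed
qed

lemma discrete_gradient_exists:
  assumes g: "elementwise_continuous g"
  shows "\<exists>G. is_discrete_gradient k d g G"
proof -
  have "\<forall>R\<in>T. \<exists>W. (\<forall>i. (\<lambda>x. W x $ i) \<in> Qpoly k) \<and>
    (\<forall>V\<in>Wh3 k d. (LINT x:R|lebesgue. W x \<bullet> V x) = dgrad_functional g R V)"
  proof
    fix R assume "R \<in> T"
    then obtain W where "\<And>i. (\<lambda>x. W x $ i) \<in> Qpoly k"
      "\<And>V. V \<in> Wh3 k d \<Longrightarrow> (LINT x:R|lebesgue. W x \<bullet> V x) = dgrad_functional g R V"
      using element_riesz[OF _ g, of R] by blast
    then show "\<exists>W. (\<forall>i. (\<lambda>x. W x $ i) \<in> Qpoly k) \<and>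
      (\<forall>V\<in>Wh3 k d. (LINT x:R|lebesgue. W x \<bullet> V x) = dgrad_functional g R V)" by blast
  qed
  from bchoice[OF this] obtain W where W': "\<forall>R\<in>T. (\<forall>i. (\<lambda>x. W R x $ i) \<in> Qpoly k) \<and>
    (\<forall>V\<in>Wh3 k d. (LINT x:R|lebesgue. W R x \<bullet> V x) = dgrad_functional g R V)" ..
  have W: "\<And>R i. R \<in> T \<Longrightarrow> (\<lambda>x. W R x $ i) \<in> Qpoly k"
    "\<And>R V. R \<in> T \<Longrightarrow> V \<in> Wh3 k d \<Longrightarrow> (LINT x:R|lebesgue. W R x \<bullet> V x) = dgrad_functional g R V"
    using W' by blast+
  \<comment> \<open>Interiors are disjoint, so inside an element the choice is forced; on the
    skeleton the value is arbitrary.\<close>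
  define G where "G x = W (SOME R. R \<in> T \<and> x \<in> interior R) x" for x
  have GW: "G x = W R x" if "R \<in> T" "x \<in> interior R" for R x
  proof -
    have "(SOME R. R \<in> T \<and> x \<in> interior R) = R"
    proof (rule some_equality)
      show "R \<in> T \<and> x \<in> interior R" using that by simp
      show "R' = R" if "R' \<in> T \<and> x \<in> interior R'" for R'
        using interior_disjoint[of R' R] that \<open>R \<in> T\<close> \<open>x \<in> interior R\<close> by auto
    qed
    then show ?thesis by (simp add: G_def)
  qed
  have "G \<in> Wh3 k d" unfolding Wh3_def Wh_iff
  proof (intro CollectI allI ballI)
    fix i R assume R: "R \<in> T"
    show "\<exists>P\<in>Qpoly k. \<forall>x\<in>interior R. G x $ i = P x"
      using GW[OF R] by (intro bexI[OF _ W(1)[OF R, of i]]) simp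
  qed
  moreover have "ip d G V = (\<Sum>R\<in>T. dgrad_functional g R V)" if V: "V \<in> Wh3 k d" for V
  proof -
    have "(LINT x:R|lebesgue. G x \<bullet> V x) = dgrad_functional g R V" if R: "R \<in> T" for R
      using LINT_element_cong(1)[OF R, of "\<lambda>x. G x \<bullet> V x" "\<lambda>x. W R x \<bullet> V x"] GW[OF R] W(2)[OF R V] by simp
    then show ?thesis by (simp add: ip_def)
  qed
  ultimately show ?thesis unfolding is_discrete_gradient_iff by blast
qed

lemma discrete_gradient_unique:
  assumes G: "is_discrete_gradient k d g G" and H: "is_discrete_gradient k d g H" and x: "x \<in> inner_region"
  shows "G x = H x"
proof -
  have G3: "G \<in> Wh3 k d" and H3: "H \<in> Wh3 k d" using G H by (auto simp: is_discrete_gradient_def)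
  \<comment> \<open>The difference of the two candidates, written as a two-term combination to fit
    \<open>Wh3_lincomb\<close>. Testing both equations with it shows that its norm is zero.\<close>
  define V where "V x = (\<Sum>b\<in>{True, False}. (if b then 1 else - 1) *\<^sub>R (if b then G else H) x)" for x
  have V: "V = (\<lambda>x. G x - H x)" by (auto simp: V_def)
  have V3: "V \<in> Wh3 k d" unfolding V_def by (rule Wh3_lincomb) (simp add: G3 H3)
  note ec = Wh3_elementwise_continuous[OF V3]
  have eq: "ip d G V = ip d H V" using G H V3 unfolding is_discrete_gradient_iff by simp
  have "(\<Sum>R\<in>T. LINT x:R|lebesgue. V x \<bullet> V x) = ip d G V - ip d H V"
    unfolding ip_def sum_subtractf[symmetric]
  proof (intro sum.cong refl)
    fix R assume R: "R \<in> T"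
    have "(LINT x:R|lebesgue. G x \<bullet> V x - H x \<bullet> V x) = (LINT x:R|lebesgue. G x \<bullet> V x) - (LINT x:R|lebesgue. H x \<bullet> V x)"
      by (intro set_integral_diff elementwise_continuous_integrable[OF _ R] elementwise_continuous_inner
          Wh3_elementwise_continuous G3 H3 V3)
    moreover have "V x \<bullet> V x = G x \<bullet> V x - H x \<bullet> V x" for x
      using fun_cong[OF V, of x] by (simp only: inner_diff_left[symmetric])
    ultimately show "(LINT x:R|lebesgue. V x \<bullet> V x) = (LINT x:R|lebesgue. G x \<bullet> V x) - (LINT x:R|lebesgue. H x \<bullet> V x)"
      by (simp only:)
  qed
  then have "(\<Sum>R\<in>T. LINT x:R|lebesgue. V x \<bullet> V x) = 0" using eq by simp
  moreover have "0 \<le> (LINT x:R|lebesgue. V x \<bullet> V x)" for R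
    unfolding set_lebesgue_integral_def by (rule integral_nonneg_AE) simp
  ultimately have z: "\<forall>R\<in>T. (LINT x:R|lebesgue. V x \<bullet> V x) = 0"
    using sum_nonneg_eq_0_iff[OF finite_mesh, of "\<lambda>R. LINT x:R|lebesgue. V x \<bullet> V x"] by simp
  obtain R where R: "R \<in> T" "x \<in> interior R" using x by (auto simp: inner_region_def)
  have "V x = 0" by (rule zero_if_integral_zero[OF ec R(1) bspec[OF z R(1)] R(2)])
  then show ?thesis by (simp add: V)
qed

section \<open>The representative \<open>dgrad\<close> and its values on the skeleton\<close>

lemma inner_region_islimpt: "x \<in> \<Omega> \<Longrightarrow> at x within inner_region \<noteq> bot"
proof -
  assume x: "x \<in> \<Omega>"
  then obtain R where R: "R \<in> T" "x \<in> R" using mesh_cover closure_subset by blast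
  have "at x within interior R \<le> at x within inner_region" by (rule at_le[OF interior_subset_inner[OF R(1)]])
  then show ?thesis using polytope_limpt[OF element[OF R(1)] R(2)] by (metis bot.extremum_uniqueI)
qed

text \<open>Frees \<open>dgrad\<close> from the choice in its definition: by uniqueness any discrete
  gradient agrees with the chosen one off the skeleton and so has the same limits, including limits
  at skeleton points.\<close>

lemma dgrad_eq_discrete_gradient:
  assumes G: "is_discrete_gradient k d g G" and g: "elementwise_continuous g"
    and x: "x \<in> \<Omega>" and l: "(G \<longlongrightarrow> l) (at x within inner_region)"
  shows "dgrad k d g x = l"
proof -
  let ?G = "SOME G. is_discrete_gradient k d g G"
  have "is_discrete_gradient k d g ?G" using discrete_gradient_exists[OF g] by (rule someI_ex)
  then have "eventually (\<lambda>y. G y = ?G y) (at x within inner_region)"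
    using discrete_gradient_unique[OF G] by (simp add: eventually_at_filter)
  with l have "(?G \<longlongrightarrow> l) (at x within inner_region)" by (rule Lim_transform_eventually)
  then show ?thesis
    unfolding dgrad_def using tendsto_Lim[OF inner_region_islimpt[OF x]] by (simp add: inner_region_def)
qed

lemma dgrad_Wh3:
  assumes g: "elementwise_continuous g"
  shows "dgrad k d g \<in> Wh3 k d"
proof -
  obtain G where G: "is_discrete_gradient k d g G" using discrete_gradient_exists[OF g] by blast
  then have G3: "G \<in> Wh3 k d" by (simp add: is_discrete_gradient_def)
  have "dgrad k d g x = G x" if x: "x \<in> inner_region" for x
  proof (rule dgrad_eq_discrete_gradient[OF G g])
    show "x \<in> \<Omega>" using x inner_region_subset by blast
    show "(G \<longlongrightarrow> G x) (at x within inner_region)"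
      using elementwise_continuous_on_inner[OF Wh3_elementwise_continuous[OF G3]] x by (simp add: continuous_on_def)
  qed
  then show ?thesis using G3 unfolding Wh3_def by (simp add: Wh_cong[of "\<lambda>x. dgrad k d g x $ _" "\<lambda>x. G x $ _"])
qed

lemma C1_trace:
  assumes \<psi>: "\<psi> \<in> Wh k d" "\<psi> \<in> C1 \<Omega>" and R: "R \<in> T" and x: "x \<in> R" "x \<in> \<Omega>"
  shows "trace_in R \<psi> x = \<psi> x"
proof (rule trace_in_eq[OF element[OF R] x(1)])
  have "isCont \<psi> x" using \<psi>(2) x(2) by (auto simp: C1_def intro: differentiable_imp_continuous_within)
  then show "(\<psi> \<longlongrightarrow> \<psi> x) (at x within interior R)"
    unfolding isCont_def by (rule tendsto_within_subset) simp
qed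

text \<open>Elementwise integration by parts gives the required equation with the inner trace of
  \<open>\<psi>\<close> in place of the check flux. For a continuous function both traces are its
  value, so it does not matter which side the check flux selects.\<close>

lemma grad_is_discrete_gradient:
  assumes \<psi>: "\<psi> \<in> Wh k d" "\<psi> \<in> C1 \<Omega>"
  shows "is_discrete_gradient k d \<psi> (grad \<psi>)"
  unfolding is_discrete_gradient_def
proof (intro conjI ballI)
  show "grad \<psi> \<in> Wh3 k d" by (rule Wh_grad(2)[OF \<psi>(1)])
  fix V assume V: "V \<in> Wh3 k d"
  note ec\<psi> = Wh_elementwise_continuous[OF \<psi>(1)] and ecV = Wh3_elementwise_continuous[OF V]
    and ecG = Wh3_elementwise_continuous[OF Wh_grad(2)[OF \<psi>(1)]]
    and ecD = Wh_elementwise_continuous[OF Wh3_divergence(1)[OF V]]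
  have "ip d (grad \<psi>) V + ip d \<psi> (divergence V) =
    (\<Sum>R\<in>T. LINT x:R|lebesgue. \<psi> x * divergence V x + grad \<psi> x \<bullet> V x)"
    unfolding ip_def sum.distrib[symmetric]
  proof (intro sum.cong refl)
    fix R assume R: "R \<in> T"
    show "(LINT x:R|lebesgue. grad \<psi> x \<bullet> V x) + (LINT x:R|lebesgue. \<psi> x \<bullet> divergence V x) =
      (LINT x:R|lebesgue. \<psi> x * divergence V x + grad \<psi> x \<bullet> V x)"
      by (subst set_integral_add(2))
         (auto intro!: elementwise_continuous_integrable[OF _ R] elementwise_continuous_inner elementwise_continuous_mult ec\<psi> ecV ecG ecD)
  qed
  also have "\<dots> = (\<Sum>R\<in>T. \<Sum>(n, c)\<in>facets R. LINT x:(R \<inter> {x. n \<bullet> x = c})|plane_area n c. trace_in R \<psi> x * (trace_in R V x \<bullet> n))"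
  proof (intro sum.cong refl element_integration_by_parts Wh_grad(1)[OF \<psi>(1)] Wh_grad(1)[OF Wh3_component[OF V]] ec\<psi> ecV)
    fix R assume R: "R \<in> T"
    show "set_integrable lebesgue R (\<lambda>x. \<psi> x * divergence V x + grad \<psi> x \<bullet> V x)"
      by (intro set_integral_add(1) elementwise_continuous_integrable[OF _ R] elementwise_continuous_inner elementwise_continuous_mult ec\<psi> ecV ecG ecD)
  qed
  also have "\<dots> = (\<Sum>e\<in>oriented_faces d. face_integral d e (\<lambda>R R' n x. trace_in R \<psi> x * (trace_in R V x \<bullet> n))) +
     Gamma_integral d (\<lambda>R n x. trace_in R \<psi> x * (trace_in R V x \<bullet> n))"
    by (rule boundary_integral_split) (intro continuous_intros elementwise_continuousD(1) ec\<psi> ecV)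
  also have "(\<Sum>e\<in>oriented_faces d. face_integral d e (\<lambda>R R' n x. trace_in R \<psi> x * (trace_in R V x \<bullet> n))) =
    (\<Sum>e\<in>oriented_faces d. face_integral d e (\<lambda>R R' n x. check_flux d \<psi> R R' n x * (trace_in R V x \<bullet> n)))"
  proof (rule sum.cong[OF refl])
    fix e assume "e \<in> oriented_faces d"
    then obtain R R' n c where e: "e = (R, R', n, c)" "(R, R', n, c) \<in> oriented_faces d" by (metis prod.collapse)
    note D = oriented_facesD[OF e(2)]
    show "face_integral d e (\<lambda>R R' n x. trace_in R \<psi> x * (trace_in R V x \<bullet> n)) =
       face_integral d e (\<lambda>R R' n x. check_flux d \<psi> R R' n x * (trace_in R V x \<bullet> n))"
      unfolding face_integral_def e(1) prod.case
      by (rule set_integral_cong_set) (simp add: check_flux_def C1_trace[OF \<psi> D(1)] C1_trace[OF \<psi> D(2)])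
  qed
  finally show "ip d (grad \<psi>) V = - ip d \<psi> (divergence V) +
    ((\<Sum>e\<in>oriented_faces d. face_integral d e (\<lambda>R R' n x. check_flux d \<psi> R R' n x * (trace_in R V x \<bullet> n))) +
     Gamma_integral d (\<lambda>R n x. trace_in R \<psi> x * (trace_in R V x \<bullet> n)))" by simp
qed

text \<open>The limit defining \<open>dgrad\<close> is attained by continuity of the classical
  gradient, also on the skeleton. Validity at every point of the domain is what makes the collision
  tensor continuous there.\<close>

lemma dgrad_C1:
  assumes \<psi>: "\<psi> \<in> Wh k d" "\<psi> \<in> C1 \<Omega>" and x: "x \<in> \<Omega>"
  shows "dgrad k d \<psi> x = grad \<psi> x"
proof (rule dgrad_eq_discrete_gradient[OF grad_is_discrete_gradient[OF \<psi>] Wh_elementwise_continuous[OF \<psi>(1)] x])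
  have "(grad \<psi> \<longlongrightarrow> grad \<psi> x) (at x within \<Omega>)" using \<psi>(2) x by (auto simp: C1_def continuous_on_def)
  then show "(grad \<psi> \<longlongrightarrow> grad \<psi> x) (at x within inner_region)"
    by (rule tendsto_within_subset) (rule inner_region_subset)
qed

end

subsection \<open>Collision tensor, upwind flux and time derivatives\<close>

lemma inner_outer_mult: "x \<bullet> (outer a b *v y) = (x \<bullet> a) * (b \<bullet> y)"
  by (simp add: outer_def matrix_vector_mult_def inner_vec_def sum_3 algebra_simps)

lemma coll_tensor_self_adjoint: "x \<bullet> (coll_tensor rg v w *v y) = (coll_tensor rg v w *v x) \<bullet> y"
proof -
  have "(outer a a *v x) \<bullet> y = x \<bullet> (outer a a *v y)" for a
    unfolding inner_commute[of "outer a a *v x"] inner_outer_mult by (simp add: inner_commute)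
  moreover have "x \<bullet> ((c *\<^sub>R mat 1) *v y) = ((c *\<^sub>R mat 1) *v x) \<bullet> y" for c
    by (simp add: scaleR_matrix_vector_assoc[symmetric])
  ultimately show ?thesis
    by (cases rg) (simp_all add: Let_def matrix_vector_mult_diff_rdistrib inner_diff_left inner_diff_right)
qed

text \<open>Exchanging the arguments reverses \<open>u\<close> and keeps \<open>z\<close>, and every
  term is quadratic in \<open>u\<close>.\<close>

lemma coll_tensor_commute: "coll_tensor rg v w = coll_tensor rg w v"
proof -
  have "outer (v - w) (v - w) = outer (w - v) (w - v)"
    by (simp add: outer_def vec_eq_iff algebra_simps)
  moreover have "cross3 ((1/2) *\<^sub>R (v + w)) (v - w) = - cross3 ((1/2) *\<^sub>R (w + v)) (w - v)"
    using cross_minus_right[of "(1/2) *\<^sub>R (v + w)" "w - v"] by (simp add: add.commute)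
  moreover have "outer (- a) (- a) = outer a a" for a by (simp add: outer_def vec_eq_iff)
  ultimately show ?thesis
    by (cases rg) (simp_all add: Let_def norm_minus_commute)
qed

text \<open>The first two terms are \<open>|u|^2\<close> times the orthogonal projection off
  \<open>u\<close>, and \<open>z \<times> u\<close> is perpendicular to \<open>u\<close>.\<close>

lemma coll_tensor_null: "coll_tensor rg v w *v (v - w) = 0"
proof -
  have o: "outer a b *v y = (b \<bullet> y) *\<^sub>R a" for a b y
    by (simp add: outer_def matrix_vector_mult_def inner_vec_def sum_3 vec_eq_iff algebra_simps)
  have "cross3 z u \<bullet> u = 0" for z u by (simp add: dot_cross_self)
  then show ?thesis
    by (cases rg) (simp_all add: Let_def matrix_vector_mult_diff_rdistrib o
        scaleR_matrix_vector_assoc[symmetric] dot_square_norm)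
qed

lemma continuous_coll_tensor:
  fixes S :: "'a::t2_space set"
  assumes "continuous_on S v" "continuous_on S w"
  shows "continuous_on S (\<lambda>x. coll_tensor rg (v x) (w x))"
proof -
  have o: "continuous_on S (\<lambda>x. outer (a x) (b x))" if "continuous_on S a" "continuous_on S b" for a b
    unfolding outer_def by (intro continuous_on_vec_lambda continuous_intros that)
  show ?thesis
    by (cases rg) (auto simp: Let_def intro!: continuous_intros o continuous_on_cross assms)
qed

text \<open>The form without case distinction shows that the flux is continuous in the drift and the
  traces.\<close>

lemma upwind_eq: "upwind u a b = max u 0 * a + min u 0 * b"
  by (auto simp: upwind_def)

lemma upwind_minus: "upwind (- u) b a = - upwind u a b"
  by (auto simp: upwind_def)

text \<open>One interface seen from both sides. For \<open>u > 0\<close> it reads u (a^2 - b^2) / 2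
  - u a (a - b) = - u (a - b)^2 / 2, and for \<open>u < 0\<close> the value \<open>b\<close>
  replaces \<open>a\<close> in the flux.\<close>

lemma upwind_jump:
  "(1/2 * (u * a\<^sup>2) - upwind u a b * a) + (1/2 * (- u * b\<^sup>2) - upwind (- u) b a * b) = - (\<bar>u\<bar> / 2 * (a - b)\<^sup>2)"
  by (auto simp: upwind_def power2_eq_square algebra_simps)

lemma integrable_bilinear_bounded:
  fixes f :: "'a \<Rightarrow> 'b::euclidean_space" and g :: "'a \<Rightarrow> 'c::euclidean_space" and h :: "'b \<Rightarrow> 'c \<Rightarrow> 'd::euclidean_space"
  assumes h: "bounded_bilinear h" and f: "integrable M f"
    and g: "g \<in> borel_measurable M" "\<And>x. norm (g x) \<le> B"
  shows "integrable M (\<lambda>x. h (f x) (g x))"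
proof -
  interpret bounded_bilinear h by fact
  obtain K where K: "K > 0" "\<And>a b. norm (h a b) \<le> norm a * norm b * K" using pos_bounded by blast
  show ?thesis
  proof (rule Bochner_Integration.integrable_bound)
    show "integrable M (\<lambda>x. norm (f x) * (B * K))" using f by simp
    have "continuous_on UNIV (\<lambda>p. h (fst p) (snd p))" by (intro continuous_on continuous_intros)
    then show "(\<lambda>x. h (f x) (g x)) \<in> borel_measurable M"
      using borel_measurable_continuous_Pair[of f M g h] f g(1) by (simp add: split_beta')
    show "AE x in M. norm (h (f x) (g x)) \<le> norm (norm (f x) * (B * K))"
    proof (intro AE_I2)
      fix x
      have "norm (h (f x) (g x)) \<le> norm (f x) * norm (g x) * K" by (rule K)
      also have "\<dots> \<le> norm (f x) * B * K" using K(1) g(2) by (intro mult_right_mono mult_left_mono) auto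
      also have "\<dots> \<le> norm (norm (f x) * (B * K))" by (simp add: mult.assoc)
      finally show "norm (h (f x) (g x)) \<le> norm (norm (f x) * (B * K))" .
    qed
  qed
qed

lemma bounded_bilinear_matrix_vector_mult: "bounded_bilinear ((*v) :: real^3^3 \<Rightarrow> real^3 \<Rightarrow> real^3)"
  by (rule bilinear_conv_bounded_bilinear[THEN iffD1])
     (auto simp: bilinear_def intro!: linearI
       simp: matrix_vector_mult_add_rdistrib matrix_vector_right_distrib scaleR_matrix_vector_assoc
         matrix_vector_mult_scaleR)

context admissible_discretization
begin

text \<open>On each element the solution is fixed by its values at finitely many nodes, so the
  integrals are finite combinations of these values, or of their products, with coefficients
  independent of time. Differentiation then never has to pass under an integral.\<close>

lemma time_derivative_ip:
  assumes f: "\<And>s. s \<in> I \<Longrightarrow> f s \<in> Wh k d"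
    and diff: "\<And>R x. R \<in> T \<Longrightarrow> x \<in> interior R \<Longrightarrow> (\<lambda>s. f s x) differentiable (at t within I)"
    and t: "t \<in> I" "at t within I \<noteq> bot"
  shows "elementwise_continuous \<phi> \<Longrightarrow>
      ((\<lambda>s. ip d (f s) \<phi>) has_real_derivative ip d (time_deriv I f t) \<phi>) (at t within I)"
    and "((\<lambda>s. ip d (f s) (f s)) has_real_derivative 2 * ip d (time_deriv I f t) (f t)) (at t within I)"
proof -
  have rep: "\<exists>N L. (\<forall>a. elementwise_continuous (L a)) \<and>
     (\<forall>s\<in>I. \<forall>x\<in>interior R. f s x = (\<Sum>a\<in>multi_idx k. f s (N a) * L a x)) \<and>
     (\<forall>a\<in>multi_idx k. ((\<lambda>s. f s (N a)) has_real_derivative time_deriv I f t (N a)) (at t within I)) \<and>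
     (\<forall>x\<in>interior R. time_deriv I f t x = (\<Sum>a\<in>multi_idx k. time_deriv I f t (N a) * L a x))"
    if R: "R \<in> T" for R
  proof -
    obtain N L where N: "\<And>a. a \<in> multi_idx k \<Longrightarrow> N a \<in> interior R" and L: "\<And>a. continuous_on UNIV (L a)"
      and P: "\<And>P x. P \<in> Qpoly k \<Longrightarrow> P x = (\<Sum>a\<in>multi_idx k. P (N a) * L a x)"
      by (rule Qpoly_interpolation[OF open_interior element_interior[OF R], where k = k]) (rule that; assumption)
    have ec: "elementwise_continuous (L a)" for a
      unfolding elementwise_continuous_def using L continuous_on_subset by blast
    have fs: "f s x = (\<Sum>a\<in>multi_idx k. f s (N a) * L a x)" if s: "s \<in> I" and x: "x \<in> interior R" for s x
    proof -
      obtain P where "P \<in> Qpoly k" "\<forall>x\<in>interior R. f s x = P x" using f[OF s] R unfolding Wh_iff by blast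
      then show ?thesis using P[of P x] N x by simp
    qed
    have der: "((\<lambda>s. f s x) has_real_derivative time_deriv I f t x) (at t within I)" if "x \<in> interior R" for x
      using diff[OF R that] vector_derivative_works[of "\<lambda>s. f s x" "at t within I"]
      by (simp add: time_deriv_def has_real_derivative_iff_has_vector_derivative)
    \<comment> \<open>The interpolation formula is differentiated at fixed \<open>x\<close>;
      uniqueness of the derivative within \<open>I\<close> transfers it to the time
      derivative.\<close>
    have "time_deriv I f t x = (\<Sum>a\<in>multi_idx k. time_deriv I f t (N a) * L a x)" if x: "x \<in> interior R" for x
    proof -
      have "((\<lambda>s. \<Sum>a\<in>multi_idx k. f s (N a) * L a x) has_real_derivative
          (\<Sum>a\<in>multi_idx k. time_deriv I f t (N a) * L a x)) (at t within I)"
        by (intro DERIV_sum DERIV_cmult_right der N)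
      \<comment> \<open>The radius 1 is an arbitrary choice, because the two functions agree at all
        times in \<open>I\<close>.\<close>
      then have "((\<lambda>s. f s x) has_real_derivative (\<Sum>a\<in>multi_idx k. time_deriv I f t (N a) * L a x)) (at t within I)"
        by (rule has_field_derivative_transform_within[OF _ zero_less_one t(1)]) (simp add: fs[OF _ x])
      then show ?thesis unfolding time_deriv_def
        by (intro vector_derivative_within[OF t(2)]) (simp add: has_real_derivative_iff_has_vector_derivative)
    qed
    then show ?thesis using ec fs der[OF N] by blast
  qed
  show "((\<lambda>s. ip d (f s) \<phi>) has_real_derivative ip d (time_deriv I f t) \<phi>) (at t within I)"
    if \<phi>: "elementwise_continuous \<phi>"
    unfolding ip_def
  proof (rule DERIV_sum)
    fix R assume R: "R \<in> T"
    obtain N L where L: "\<And>a. elementwise_continuous (L a)"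
      and fs: "\<forall>s\<in>I. \<forall>x\<in>interior R. f s x = (\<Sum>a\<in>multi_idx k. f s (N a) * L a x)"
      and der: "\<forall>a\<in>multi_idx k. ((\<lambda>s. f s (N a)) has_real_derivative time_deriv I f t (N a)) (at t within I)"
      and td: "\<forall>x\<in>interior R. time_deriv I f t x = (\<Sum>a\<in>multi_idx k. time_deriv I f t (N a) * L a x)"
      using rep[OF R] by blast
    have lin: "(LINT x:R|lebesgue. g x \<bullet> \<phi> x) = (\<Sum>a\<in>multi_idx k. g (N a) * (LINT x:R|lebesgue. L a x * \<phi> x))"
      if "\<forall>x\<in>interior R. g x = (\<Sum>a\<in>multi_idx k. g (N a) * L a x)" for g :: "real^3 \<Rightarrow> real"
    proof -
      have "(LINT x:R|lebesgue. g x \<bullet> \<phi> x) = (LINT x:R|lebesgue. \<Sum>a\<in>multi_idx k. g (N a) * (L a x * \<phi> x))"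
      proof (rule LINT_element_cong[OF R])
        fix x assume x: "x \<in> interior R"
        have "g x \<bullet> \<phi> x = (\<Sum>a\<in>multi_idx k. g (N a) * L a x) * \<phi> x" using bspec[OF that x] by simp
        then show "g x \<bullet> \<phi> x = (\<Sum>a\<in>multi_idx k. g (N a) * (L a x * \<phi> x))"
          by (simp only: sum_distrib_right mult.assoc)
      qed
      also have "\<dots> = (\<Sum>a\<in>multi_idx k. g (N a) * (LINT x:R|lebesgue. L a x * \<phi> x))"
        by (intro set_integral_lincomb elementwise_continuous_integrable[OF _ R] elementwise_continuous_mult(1) L \<phi>)
      finally show ?thesis .
    qed
    have "((\<lambda>s. \<Sum>a\<in>multi_idx k. f s (N a) * (LINT x:R|lebesgue. L a x * \<phi> x)) has_real_derivative
        (\<Sum>a\<in>multi_idx k. time_deriv I f t (N a) * (LINT x:R|lebesgue. L a x * \<phi> x))) (at t within I)"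
      by (intro DERIV_sum DERIV_cmult_right) (use der in blast)
    then have "((\<lambda>s. LINT x:R|lebesgue. f s x \<bullet> \<phi> x) has_real_derivative
        (\<Sum>a\<in>multi_idx k. time_deriv I f t (N a) * (LINT x:R|lebesgue. L a x * \<phi> x))) (at t within I)"
      by (rule has_field_derivative_transform_within[OF _ zero_less_one t(1)]) (use lin fs in simp)
    then show "((\<lambda>s. LINT x:R|lebesgue. f s x \<bullet> \<phi> x) has_real_derivative
        (LINT x:R|lebesgue. time_deriv I f t x \<bullet> \<phi> x)) (at t within I)"
      unfolding lin[OF td] .
  qed
  show "((\<lambda>s. ip d (f s) (f s)) has_real_derivative 2 * ip d (time_deriv I f t) (f t)) (at t within I)"
    unfolding ip_def sum_distrib_left
  proof (rule DERIV_sum)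
    fix R assume R: "R \<in> T"
    obtain N L where L: "\<And>a. elementwise_continuous (L a)"
      and fs: "\<forall>s\<in>I. \<forall>x\<in>interior R. f s x = (\<Sum>a\<in>multi_idx k. f s (N a) * L a x)"
      and der: "\<forall>a\<in>multi_idx k. ((\<lambda>s. f s (N a)) has_real_derivative time_deriv I f t (N a)) (at t within I)"
      and td: "\<forall>x\<in>interior R. time_deriv I f t x = (\<Sum>a\<in>multi_idx k. time_deriv I f t (N a) * L a x)"
      using rep[OF R] by blast
    \<comment> \<open>The element mass matrix for the interpolation basis; it turns the squared norm
      into a quadratic form in the nodal values.\<close>
    define M where "M a b = (LINT x:R|lebesgue. L a x * L b x)" for a b
    have lin: "(LINT x:R|lebesgue. g x \<bullet> h x) = (\<Sum>a\<in>multi_idx k. \<Sum>b\<in>multi_idx k. (g (N a) * h (N b)) * M a b)"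
      if g: "\<forall>x\<in>interior R. g x = (\<Sum>a\<in>multi_idx k. g (N a) * L a x)"
        and h: "\<forall>x\<in>interior R. h x = (\<Sum>a\<in>multi_idx k. h (N a) * L a x)" for g h :: "real^3 \<Rightarrow> real"
    proof -
      let ?S = "multi_idx k \<times> multi_idx k"
      have "(LINT x:R|lebesgue. g x \<bullet> h x) =
        (LINT x:R|lebesgue. \<Sum>p\<in>?S. (g (N (fst p)) * h (N (snd p))) * (L (fst p) x * L (snd p) x))"
      proof (rule LINT_element_cong[OF R])
        fix x assume x: "x \<in> interior R"
        have "g x \<bullet> h x = (\<Sum>a\<in>multi_idx k. g (N a) * L a x) * (\<Sum>b\<in>multi_idx k. h (N b) * L b x)"
          using bspec[OF g x] bspec[OF h x] by simp
        also have "\<dots> = (\<Sum>p\<in>?S. (g (N (fst p)) * L (fst p) x) * (h (N (snd p)) * L (snd p) x))"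
          by (simp only: sum_product sum.cartesian_product split_beta')
        finally show "g x \<bullet> h x = (\<Sum>p\<in>?S. (g (N (fst p)) * h (N (snd p))) * (L (fst p) x * L (snd p) x))"
          by (simp only: mult_ac)
      qed
      also have "\<dots> = (\<Sum>p\<in>?S. (g (N (fst p)) * h (N (snd p))) * M (fst p) (snd p))"
        unfolding M_def
        by (intro set_integral_lincomb elementwise_continuous_integrable[OF _ R] elementwise_continuous_mult(1) L)
      finally show ?thesis by (simp only: sum.cartesian_product split_beta')
    qed
    have "((\<lambda>s. \<Sum>a\<in>multi_idx k. \<Sum>b\<in>multi_idx k. (f s (N a) * f s (N b)) * M a b) has_real_derivative
        (\<Sum>a\<in>multi_idx k. \<Sum>b\<in>multi_idx k. (time_deriv I f t (N a) * f t (N b) + time_deriv I f t (N b) * f t (N a)) * M a b)) (at t within I)"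
      by (intro DERIV_sum DERIV_cmult_right DERIV_mult) (use der in blast)+
    then have D: "((\<lambda>s. LINT x:R|lebesgue. f s x \<bullet> f s x) has_real_derivative
        (\<Sum>a\<in>multi_idx k. \<Sum>b\<in>multi_idx k. (time_deriv I f t (N a) * f t (N b) + time_deriv I f t (N b) * f t (N a)) * M a b)) (at t within I)"
      by (rule has_field_derivative_transform_within[OF _ zero_less_one t(1)]) (use lin fs in simp)
    have "(\<Sum>a\<in>multi_idx k. \<Sum>b\<in>multi_idx k. (time_deriv I f t (N a) * f t (N b) + time_deriv I f t (N b) * f t (N a)) * M a b) =
      (\<Sum>a\<in>multi_idx k. \<Sum>b\<in>multi_idx k. (time_deriv I f t (N a) * f t (N b)) * M a b) +
      (\<Sum>a\<in>multi_idx k. \<Sum>b\<in>multi_idx k. (f t (N a) * time_deriv I f t (N b)) * M a b)"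
      unfolding sum.distrib[symmetric] by (intro sum.cong refl) (simp add: algebra_simps)
    also have "\<dots> = (LINT x:R|lebesgue. time_deriv I f t x \<bullet> f t x) + (LINT x:R|lebesgue. f t x \<bullet> time_deriv I f t x)"
      using lin[OF td bspec[OF fs t(1)]] lin[OF bspec[OF fs t(1)] td] by simp
    also have "\<dots> = 2 * (LINT x:R|lebesgue. time_deriv I f t x \<bullet> f t x)"
      by (simp add: mult.commute)
    finally show "((\<lambda>s. LINT x:R|lebesgue. f s x \<bullet> f s x) has_real_derivative
        2 * (LINT x:R|lebesgue. time_deriv I f t x \<bullet> f t x)) (at t within I)"
      using D by simp
  qed
qed

end

subsection \<open>Conservation laws and stability\<close>

lemma Phi_h_apply:
  "Phi_h k rg d \<Lambda> p q *v y = \<Lambda> p q *\<^sub>R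
    (coll_tensor rg (dgrad k d (Proj d (energy rg)) p) (dgrad k d (Proj d (energy rg)) q) *v y)"
  by (simp add: Phi_h_def scaleR_matrix_vector_assoc)

lemma Phi_h_symmetric:
  assumes "\<Lambda> p q = \<Lambda> q p"
  shows "x \<bullet> (Phi_h k rg d \<Lambda> q p *v y) = (Phi_h k rg d \<Lambda> p q *v x) \<bullet> y"
  unfolding Phi_h_apply using assms coll_tensor_commute coll_tensor_self_adjoint by simp

text \<open>The joint integrability in \<open>regular_kernel\<close> refers to the product of two
  completed measures, so Fubini is applied to that product.\<close>

lemma sigma_finite_lebesgue: "sigma_finite_measure (lebesgue :: 'a::euclidean_space measure)"
proof
  obtain A :: "'a set set" where A: "countable A" "A \<subseteq> sets lborel" "\<Union>A = space lborel"
    "\<forall>a\<in>A. emeasure lborel a \<noteq> \<infinity>"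
    using lborel.sigma_finite_countable by blast
  have "emeasure lebesgue a \<noteq> \<infinity>" if "a \<in> A" for a
    using A(2,4) that by (simp add: subset_iff)
  then show "\<exists>A. countable A \<and> A \<subseteq> sets lebesgue \<and> \<Union>A = space lebesgue \<and>
      (\<forall>a\<in>A. emeasure lebesgue (a :: 'a set) \<noteq> \<infinity>)"
    using A by (intro exI[of _ A]) auto
qed

context admissible_discretization
begin

section \<open>Integrability of the kernel; balance of diffusion and drift\<close>

lemma inner_indicator_measurable:
  fixes F :: "real^3 \<Rightarrow> 'b::euclidean_space"
  assumes F: "elementwise_continuous F"
  shows "(\<lambda>x. indicator inner_region x *\<^sub>R F x) \<in> borel_measurable lebesgue"
proof -
  have "(\<lambda>x. indicator inner_region x *\<^sub>R F x) \<in> borel_measurable borel"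
    by (rule borel_measurable_continuous_on_indicator)
       (use open_inner_region elementwise_continuous_on_inner[OF F] in auto)
  then show ?thesis using measurable_completion[of _ lborel borel] by simp
qed

lemma set_integrable_bilinear:
  fixes K :: "real^3 \<Rightarrow> 'b::euclidean_space" and F :: "real^3 \<Rightarrow> 'c::euclidean_space"
    and h :: "'b \<Rightarrow> 'c \<Rightarrow> 'd::euclidean_space"
  assumes h: "bounded_bilinear h" and K: "set_integrable lebesgue inner_region K" and F: "elementwise_continuous F"
  shows "set_integrable lebesgue inner_region (\<lambda>x. h (K x) (F x))"
proof -
  obtain B where B: "B \<ge> 0" "\<And>x. x \<in> inner_region \<Longrightarrow> norm (F x) \<le> B" using elementwise_bounded[OF F] by blast
  have "integrable lebesgue (\<lambda>x. h (indicator inner_region x *\<^sub>R K x) (indicator inner_region x *\<^sub>R F x))"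
    by (rule integrable_bilinear_bounded[OF h _ inner_indicator_measurable[OF F], where B=B])
       (use K B in \<open>auto simp: set_integrable_def indicator_def\<close>)
  moreover have "h (indicator inner_region x *\<^sub>R K x) (indicator inner_region x *\<^sub>R F x) =
    indicator inner_region x *\<^sub>R h (K x) (F x)" for x
    using bounded_bilinear.zero_left[OF h] by (auto simp: indicator_def)
  ultimately show ?thesis by (simp add: set_integrable_def)
qed

lemma kernel_integrable:
  assumes reg: "regular_kernel k rg d \<Lambda>" and p: "p \<in> inner_region"
  shows "set_integrable lebesgue inner_region (Phi_h k rg d \<Lambda> p)"
  by (rule set_integrable_subset[of _ \<Omega>])
     (use reg p inner_region_subset open_inner_region in \<open>auto simp: regular_kernel_def\<close>)

text \<open>The matrix-valued integral is read off through the bounded linear functional sending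
  \<open>M\<close> to \<open>a \<bullet> (M *v b)\<close>, so that only scalar integrals take part
  in the exchange of variables.\<close>

lemma D_h_quadratic:
  assumes reg: "regular_kernel k rg d \<Lambda>" and g: "g \<in> Wh k d" and p: "p \<in> inner_region"
  shows "a \<bullet> (D_h k rg d \<Lambda> g p *v b) = (LINT q:inner_region|lebesgue. g q * (a \<bullet> (Phi_h k rg d \<Lambda> p q *v b)))"
proof -
  have "set_integrable lebesgue inner_region (\<lambda>q. g q *\<^sub>R Phi_h k rg d \<Lambda> p q)"
    using set_integrable_bilinear[OF bounded_bilinear.flip[OF bounded_bilinear_scaleR]
      kernel_integrable[OF reg p] Wh_elementwise_continuous[OF g]] .
  then have I: "integrable lebesgue (\<lambda>q. indicator inner_region q *\<^sub>R (g q *\<^sub>R Phi_h k rg d \<Lambda> p q))"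
    by (simp add: set_integrable_def)
  have bl: "bounded_linear (\<lambda>M::real^3^3. a \<bullet> (M *v b))"
    by (rule bounded_linear_compose[OF bounded_linear_inner_right
        bounded_bilinear.bounded_linear_left[OF bounded_bilinear_matrix_vector_mult]])
  have "a \<bullet> (D_h k rg d \<Lambda> g p *v b) =
    a \<bullet> ((\<integral>q. indicator inner_region q *\<^sub>R (g q *\<^sub>R Phi_h k rg d \<Lambda> p q) \<partial>lebesgue) *v b)"
    unfolding D_h_def LINT_domain(1) by (simp add: set_lebesgue_integral_def)
  also have "\<dots> = (\<integral>q. a \<bullet> ((indicator inner_region q *\<^sub>R (g q *\<^sub>R Phi_h k rg d \<Lambda> p q)) *v b) \<partial>lebesgue)"
    by (rule integral_bounded_linear[OF bl I, symmetric])
  also have "\<dots> = (LINT q:inner_region|lebesgue. g q * (a \<bullet> (Phi_h k rg d \<Lambda> p q *v b)))"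
    unfolding set_lebesgue_integral_def
    by (rule Bochner_Integration.integral_cong) (auto simp: scaleR_matrix_vector_assoc[symmetric])
  finally show ?thesis .
qed

lemma U_h_inner:
  assumes reg: "regular_kernel k rg d \<Lambda>" and g: "g \<in> Wh k d" and p: "p \<in> inner_region"
  shows "U_h k rg d \<Lambda> g p \<bullet> b = (LINT q:inner_region|lebesgue. (Phi_h k rg d \<Lambda> p q *v dgrad k d g q) \<bullet> b)"
proof -
  have "set_integrable lebesgue inner_region (\<lambda>q. Phi_h k rg d \<Lambda> p q *v dgrad k d g q)"
    by (rule set_integrable_bilinear[OF bounded_bilinear_matrix_vector_mult kernel_integrable[OF reg p]
      Wh3_elementwise_continuous[OF dgrad_Wh3[OF Wh_elementwise_continuous[OF g]]]])
  then have I: "integrable lebesgue (\<lambda>q. indicator inner_region q *\<^sub>R (Phi_h k rg d \<Lambda> p q *v dgrad k d g q))"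
    by (simp add: set_integrable_def)
  have "U_h k rg d \<Lambda> g p \<bullet> b = (\<integral>q. indicator inner_region q *\<^sub>R (Phi_h k rg d \<Lambda> p q *v dgrad k d g q) \<partial>lebesgue) \<bullet> b"
    unfolding U_h_def LINT_domain(1) by (simp add: set_lebesgue_integral_def)
  also have "\<dots> = (\<integral>q. (indicator inner_region q *\<^sub>R (Phi_h k rg d \<Lambda> p q *v dgrad k d g q)) \<bullet> b \<partial>lebesgue)"
    by (rule integral_bounded_linear[OF bounded_linear_inner_left I, symmetric])
  also have "\<dots> = (LINT q:inner_region|lebesgue. (Phi_h k rg d \<Lambda> p q *v dgrad k d g q) \<bullet> b)"
    by (simp add: set_lebesgue_integral_def)
  finally show ?thesis .
qed

text \<open>The kernel is symmetric under exchanging the two momenta and annihilates the difference of the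
  gradients of an invariant, so diffusion and drift balance after renaming the integration variables.\<close>

lemma diffusion_drift_balance:
  assumes reg: "regular_kernel k rg d \<Lambda>" and g: "g \<in> Wh k d" and \<psi>: "\<psi> \<in> Wh k d" "\<psi> \<in> C1 \<Omega>"
    and inv: "\<And>p q. p \<in> \<Omega> \<Longrightarrow> q \<in> \<Omega> \<Longrightarrow> Phi_h k rg d \<Lambda> p q *v (grad \<psi> p - grad \<psi> q) = 0"
  shows "ip d (dgrad k d g) (\<lambda>p. D_h k rg d \<Lambda> g p *v dgrad k d \<psi> p) =
    ip d (\<lambda>p. g p *\<^sub>R U_h k rg d \<Lambda> g p) (grad \<psi>)"
proof -
  let ?O = inner_region and ?K = "Phi_h k rg d \<Lambda>"
  define A where "A = dgrad k d g"
  define B where "B = grad \<psi>"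
  \<comment> \<open>The integrand of the drift term. With its arguments exchanged it becomes that of
    the diffusion term, so the balance is Fubini's theorem for \<open>F\<close>.\<close>
  define F where "F p q = indicator ?O p * indicator ?O q * (g p * ((?K p q *v A q) \<bullet> B p))" for p q
  have ecA: "elementwise_continuous A" unfolding A_def
    by (rule Wh3_elementwise_continuous[OF dgrad_Wh3[OF Wh_elementwise_continuous[OF g]]])
  have ecB: "elementwise_continuous B" unfolding B_def by (rule Wh3_elementwise_continuous[OF Wh_grad(2)[OF \<psi>(1)]])
  have ecg: "elementwise_continuous g" by (rule Wh_elementwise_continuous[OF g])
  have ecgB: "elementwise_continuous (\<lambda>p. g p *\<^sub>R B p)" by (rule elementwise_continuous_scaleR(1)[OF ecg ecB])
  interpret LL: pair_sigma_finite "lebesgue :: (real^3) measure" "lebesgue :: (real^3) measure"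
    by (intro pair_sigma_finite.intro sigma_finite_lebesgue)
  have FI: "integrable (lebesgue \<Otimes>\<^sub>M lebesgue) (case_prod F)"
  proof -
    have K: "integrable (lebesgue \<Otimes>\<^sub>M lebesgue) (\<lambda>x. indicator (?O \<times> ?O) x *\<^sub>R (case x of (p, q) \<Rightarrow> ?K p q))"
      using set_integrable_subset[of "lebesgue \<Otimes>\<^sub>M lebesgue" "\<Omega> \<times> \<Omega>" "\<lambda>(p, q). ?K p q" "?O \<times> ?O"]
        reg inner_region_subset open_inner_region
      by (auto simp: regular_kernel_def set_integrable_def intro!: pair_measureI)
    obtain bA where bA: "bA \<ge> 0" "\<And>x. x \<in> ?O \<Longrightarrow> norm (A x) \<le> bA" using elementwise_bounded[OF ecA] by blast
    obtain bB where bB: "bB \<ge> 0" "\<And>x. x \<in> ?O \<Longrightarrow> norm (g x *\<^sub>R B x) \<le> bB" using elementwise_bounded[OF ecgB] by blast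
    have 1: "integrable (lebesgue \<Otimes>\<^sub>M lebesgue)
      (\<lambda>x. (indicator (?O \<times> ?O) x *\<^sub>R (case x of (p, q) \<Rightarrow> ?K p q)) *v (indicator ?O (snd x) *\<^sub>R A (snd x)))"
    proof (rule integrable_bilinear_bounded[OF bounded_bilinear_matrix_vector_mult K, where B = bA])
      show "(\<lambda>x. indicator ?O (snd x) *\<^sub>R A (snd x)) \<in> borel_measurable (lebesgue \<Otimes>\<^sub>M lebesgue)"
        by (rule measurable_compose[OF measurable_snd inner_indicator_measurable[OF ecA]])
      show "norm (indicator ?O (snd x) *\<^sub>R A (snd x)) \<le> bA" for x :: "(real^3) \<times> (real^3)"
        using bA by (auto simp: indicator_def)
    qed
    have 2: "integrable (lebesgue \<Otimes>\<^sub>M lebesgue)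
      (\<lambda>x. ((indicator (?O \<times> ?O) x *\<^sub>R (case x of (p, q) \<Rightarrow> ?K p q)) *v (indicator ?O (snd x) *\<^sub>R A (snd x))) \<bullet>
        (indicator ?O (fst x) *\<^sub>R (g (fst x) *\<^sub>R B (fst x))))"
    proof (rule integrable_bilinear_bounded[OF bounded_bilinear_inner 1, where B = bB])
      show "(\<lambda>x. indicator ?O (fst x) *\<^sub>R (g (fst x) *\<^sub>R B (fst x))) \<in> borel_measurable (lebesgue \<Otimes>\<^sub>M lebesgue)"
        by (rule measurable_compose[OF measurable_fst inner_indicator_measurable[OF ecgB]])
      show "norm (indicator ?O (fst x) *\<^sub>R (g (fst x) *\<^sub>R B (fst x))) \<le> bB" for x :: "(real^3) \<times> (real^3)"
        using bB by (auto simp: indicator_def)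
    qed
    have 3: "((indicator (?O \<times> ?O) x *\<^sub>R (case x of (p, q) \<Rightarrow> ?K p q)) *v (indicator ?O (snd x) *\<^sub>R A (snd x))) \<bullet>
        (indicator ?O (fst x) *\<^sub>R (g (fst x) *\<^sub>R B (fst x))) = case_prod F x" for x
      by (cases x) (auto simp: F_def indicator_def)
    show ?thesis using 2 unfolding 3 .
  qed
  have rhs: "indicator ?O p * (g p * (U_h k rg d \<Lambda> g p \<bullet> B p)) = (\<integral>q. F p q \<partial>lebesgue)" for p
  proof (cases "p \<in> ?O")
    case True
    have "(\<integral>q. F p q \<partial>lebesgue) = (\<integral>q. g p * (indicator ?O q *\<^sub>R ((?K p q *v A q) \<bullet> B p)) \<partial>lebesgue)"
      using True by (intro Bochner_Integration.integral_cong) (auto simp: F_def mult_ac)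
    also have "\<dots> = g p * (LINT q:?O|lebesgue. (?K p q *v A q) \<bullet> B p)"
      by (simp add: set_lebesgue_integral_def)
    finally show ?thesis using True U_h_inner[OF reg g True, of "B p"] by (simp add: A_def)
  qed (simp add: F_def)
  have lhs: "indicator ?O p * (A p \<bullet> (D_h k rg d \<Lambda> g p *v dgrad k d \<psi> p)) = (\<integral>q. F q p \<partial>lebesgue)" for p
  proof (cases "p \<in> ?O")
    case True
    then have p\<Omega>: "p \<in> \<Omega>" using inner_region_subset by blast
    have "(\<integral>q. F q p \<partial>lebesgue) = (\<integral>q. indicator ?O q *\<^sub>R (g q * (A p \<bullet> (?K p q *v B p))) \<partial>lebesgue)"
    proof (intro Bochner_Integration.integral_cong refl)
      fix q
      show "F q p = indicator ?O q *\<^sub>R (g q * (A p \<bullet> (?K p q *v B p)))"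
      proof (cases "q \<in> ?O")
        case q: True
        then have q\<Omega>: "q \<in> \<Omega>" using inner_region_subset by blast
        have sym: "\<Lambda> p q = \<Lambda> q p" using reg p\<Omega> q\<Omega> by (auto simp: regular_kernel_def)
        \<comment> \<open>Symmetry moves the kernel from \<open>A p\<close> onto \<open>B q\<close>;
          since the kernel annihilates \<open>B p - B q\<close>, the vector \<open>B q\<close> may
          then be replaced by \<open>B p\<close>, which no longer depends on the integration
          variable.\<close>
        have "(?K q p *v A p) \<bullet> B q = A p \<bullet> (?K p q *v B q)"
          using Phi_h_symmetric[of \<Lambda> q p "A p" k rg d "B q"] sym by simp
        also have "?K p q *v B q = ?K p q *v B p"
          using inv[OF p\<Omega> q\<Omega>] by (simp add: B_def matrix_vector_mult_diff_distrib)
        finally show ?thesis using q True by (simp add: F_def)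
      qed (simp add: F_def)
    qed
    also have "\<dots> = A p \<bullet> (D_h k rg d \<Lambda> g p *v B p)"
      unfolding D_h_quadratic[OF reg g True] by (simp add: set_lebesgue_integral_def)
    finally show ?thesis using True dgrad_C1[OF \<psi> p\<Omega>] by (simp add: B_def)
  qed (simp add: F_def)
  have "ip d A (\<lambda>p. D_h k rg d \<Lambda> g p *v dgrad k d \<psi> p) = (LINT p:?O|lebesgue. A p \<bullet> (D_h k rg d \<Lambda> g p *v dgrad k d \<psi> p))"
    unfolding ip_def
    by (rule sum_elements(1)) (use LL.integrable_snd[OF FI] lhs in \<open>simp add: set_integrable_def\<close>)
  also have "\<dots> = (\<integral>p. (\<integral>q. F q p \<partial>lebesgue) \<partial>lebesgue)"
    by (simp add: set_lebesgue_integral_def lhs)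
  also have "\<dots> = (\<integral>p. (\<integral>q. F p q \<partial>lebesgue) \<partial>lebesgue)"
    by (rule LL.Fubini_integral[OF FI])
  also have "\<dots> = (LINT p:?O|lebesgue. g p * (U_h k rg d \<Lambda> g p \<bullet> B p))"
    by (simp add: set_lebesgue_integral_def rhs)
  also have "\<dots> = ip d (\<lambda>p. g p *\<^sub>R U_h k rg d \<Lambda> g p) B"
    unfolding ip_def inner_scaleR_left
    by (rule sum_elements(1)[symmetric]) (use LL.integrable_fst[OF FI] rhs in \<open>simp add: set_integrable_def\<close>)
  finally show ?thesis by (simp add: A_def B_def)
qed

section \<open>Regularity of the drift and cancellation of interface fluxes\<close>

lemma projected_energy: "Proj d (energy rg) \<in> Wh k d" "Proj d (energy rg) \<in> C1 \<Omega>"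
  using adm by (auto simp: admissible_def linear_projection_onto_def)

lemma projection_fixes:
  assumes "\<psi> \<in> Wh k d" "\<psi> \<in> C1 \<Omega>" "x \<in> \<Omega>"
  shows "Proj d \<psi> x = \<psi> x"
  using adm assms by (auto simp: admissible_def linear_projection_onto_def)

text \<open>Inside elements the properties come from \<open>regular_kernel\<close>. The last one is
  continuity across interfaces: the projected energy is C1, so its \<open>dgrad\<close> and hence
  the tensor are continuous on the domain, the premise under which \<open>regular_kernel\<close>
  grants continuity of the drift. The normal drift therefore agrees from both sides up to the sign
  of the normal.\<close>

lemma U_h_regular:
  assumes reg: "regular_kernel k rg d \<Lambda>" and g: "g \<in> Wh k d"
  defines "U \<equiv> U_h k rg d \<Lambda> g"
  shows "elementwise_continuous U" "R \<in> T \<Longrightarrow> (\<lambda>x. U x $ i) \<in> C1 (interior R)"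
    "R \<in> T \<Longrightarrow> set_integrable lebesgue R (divergence U)"
    "R \<in> T \<Longrightarrow> x \<in> R \<Longrightarrow> x \<in> \<Omega> \<Longrightarrow> trace_in R U x = U x"
proof -
  let ?v = "dgrad k d (Proj d (energy rg))"
  have C1: "(\<lambda>x. U x $ i) \<in> C1 (interior R)" if "R \<in> T" for R i
    using reg g that by (auto simp: regular_kernel_def U_def)
  then show "R \<in> T \<Longrightarrow> (\<lambda>x. U x $ i) \<in> C1 (interior R)" .
  show "R \<in> T \<Longrightarrow> set_integrable lebesgue R (divergence U)"
    using reg g by (auto simp: regular_kernel_def U_def)
  have lims: "\<exists>l. (U \<longlongrightarrow> l) (at x within interior R)" if "R \<in> T" "x \<in> R" for R x
    using reg g that by (auto simp: regular_kernel_def U_def)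
  have cont: "isCont U x" if R: "R \<in> T" "x \<in> interior R" for R x
  proof -
    have "(U has_derivative (\<lambda>h. \<chi> i. frechet_derivative (\<lambda>x. U x $ i) (at x) h)) (at x)"
      by (rule has_derivative_vec_components) (use C1[OF R(1)] R(2) in \<open>simp add: C1_def frechet_derivative_works\<close>)
    then show ?thesis by (rule has_derivative_continuous)
  qed
  show "elementwise_continuous U"
    unfolding elementwise_continuous_def
  proof
    fix R assume R: "R \<in> T"
    have "continuous_on R (trace_in R U)" by (rule continuous_on_trace_in[OF element[OF R] lims[OF R]])
    moreover have "\<forall>x\<in>interior R. U x = trace_in R U x"
      using trace_in_interior[OF element[OF R] _ cont[OF R]] by simp
    ultimately show "\<exists>C. continuous_on R C \<and> (\<forall>x\<in>interior R. U x = C x)" by blast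
  qed
  have "continuous_on \<Omega> (grad (Proj d (energy rg)))" using projected_energy(2) by (simp add: C1_def)
  then have v: "continuous_on \<Omega> ?v" using dgrad_C1[OF projected_energy] by (simp cong: continuous_on_cong)
  have v1: "continuous_on (\<Omega> \<times> \<Omega>) (\<lambda>x. ?v (fst x))" "continuous_on (\<Omega> \<times> \<Omega>) (\<lambda>x. ?v (snd x))"
    by (auto intro!: continuous_on_compose2[OF v] continuous_intros)
  have "continuous_on (\<Omega> \<times> \<Omega>) (\<lambda>(p, q). coll_tensor rg (?v p) (?v q))"
    using continuous_coll_tensor[OF v1] by (simp add: split_beta')
  then have "continuous_on \<Omega> U" using reg g by (auto simp: regular_kernel_def U_def)
  then have Uc: "isCont U x" if "x \<in> \<Omega>" for x
    using that open_domain by (simp add: continuous_on_eq_continuous_at)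
  show "trace_in R U x = U x" if "R \<in> T" "x \<in> R" "x \<in> \<Omega>"
  proof (rule trace_in_eq[OF element[OF that(1)] that(2)])
    show "(U \<longlongrightarrow> U x) (at x within interior R)"
      using Uc[OF that(3)] unfolding isCont_def by (rule tendsto_within_subset) simp
  qed
qed

text \<open>An interface inside the open domain need not be closed; boundedness comes from a
  continuous function on the compact set \<open>R \<inter> R'\<close> that agrees with the integrand
  on the interface.\<close>

lemma face_integrable:
  fixes W w :: "real^3 \<Rightarrow> real"
  assumes e: "(R, R', n, c) \<in> oriented_faces d" and W: "continuous_on (R \<inter> R') W"
    and w: "\<And>x. x \<in> R \<inter> R' \<inter> \<Omega> \<Longrightarrow> w x = W x"
  shows "set_integrable (plane_area n c) (R \<inter> R' \<inter> \<Omega>) w"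
proof -
  note D = oriented_facesD[OF e]
  have "set_integrable (plane_area n c) (R \<inter> R' \<inter> \<Omega>) W"
    by (rule set_integrable_plane_area[OF D(5) _ W])
       (use D(1,2) element_compact element_closed compact_Int_closed in auto)
  moreover have "indicator (R \<inter> R' \<inter> \<Omega>) x *\<^sub>R w x = indicator (R \<inter> R' \<inter> \<Omega>) x *\<^sub>R W x" for x
    using w by (auto simp: indicator_def)
  ultimately show ?thesis unfolding set_integrable_def by (simp only:)
qed

lemma upwind_integrable:
  assumes e: "(R, R', n, c) \<in> oriented_faces d" and reg: "regular_kernel k rg d \<Lambda>"
    and g: "g \<in> Wh k d" and \<phi>: "elementwise_continuous \<phi>"
  shows "set_integrable (plane_area n c) (R \<inter> R' \<inter> \<Omega>)
    (\<lambda>x. upwind (U_h k rg d \<Lambda> g x \<bullet> n) (trace_in R g x) (trace_in R' g x) * trace_in R \<phi> x)"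
proof (rule face_integrable[OF e])
  note D = oriented_facesD[OF e] and U = U_h_regular[OF reg g] and ecg = Wh_elementwise_continuous[OF g]
  let ?U = "trace_in R (U_h k rg d \<Lambda> g)"
  show "continuous_on (R \<inter> R') (\<lambda>x. upwind (?U x \<bullet> n) (trace_in R g x) (trace_in R' g x) * trace_in R \<phi> x)"
    unfolding upwind_eq
    by (intro continuous_intros continuous_on_subset[OF elementwise_continuousD(1)[OF U(1) D(1)]]
        continuous_on_subset[OF elementwise_continuousD(1)[OF ecg D(1)]]
        continuous_on_subset[OF elementwise_continuousD(1)[OF ecg D(2)]]
        continuous_on_subset[OF elementwise_continuousD(1)[OF \<phi> D(1)]]) auto
  show "upwind (U_h k rg d \<Lambda> g x \<bullet> n) (trace_in R g x) (trace_in R' g x) * trace_in R \<phi> x =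
    upwind (?U x \<bullet> n) (trace_in R g x) (trace_in R' g x) * trace_in R \<phi> x" if "x \<in> R \<inter> R' \<inter> \<Omega>" for x
    using U(4)[OF D(1)] that by simp
qed

text \<open>Negating the normal and swapping the traces negates the upwind flux, while
  \<open>\<psi>\<close> has the same trace on both sides; the two views of each interface cancel
  pointwise.\<close>

lemma upwind_flux_cancels:
  assumes reg: "regular_kernel k rg d \<Lambda>" and g: "g \<in> Wh k d" and \<psi>: "\<psi> \<in> Wh k d" "\<psi> \<in> C1 \<Omega>"
  shows "(\<Sum>e\<in>oriented_faces d. face_integral d e (\<lambda>R R' n x.
     upwind (U_h k rg d \<Lambda> g x \<bullet> n) (trace_in R g x) (trace_in R' g x) * trace_in R \<psi> x)) = 0"
proof -
  let ?w = "\<lambda>R R' n x. upwind (U_h k rg d \<Lambda> g x \<bullet> n) (trace_in R g x) (trace_in R' g x) * trace_in R \<psi> x"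
  have "(\<Sum>e\<in>oriented_faces d. face_integral d e ?w) =
    (\<Sum>e\<in>interior_faces d. face_integral d e (\<lambda>R R' n x. ?w R R' n x + ?w R' R (- n) x))"
    by (rule sum_oriented_pairs) (rule upwind_integrable[OF _ reg g Wh_elementwise_continuous[OF \<psi>(1)]])
  also have "\<dots> = 0"
  proof (rule sum.neutral, rule ballI)
    fix e assume "e \<in> interior_faces d"
    then obtain R R' n c where e: "e = (R, R', n, c)" "(R, R', n, c) \<in> oriented_faces d"
      by (auto simp: interior_faces_def)
    note D = oriented_facesD[OF e(2)]
    have "(LINT x:(R \<inter> R' \<inter> \<Omega>)|plane_area n c. ?w R R' n x + ?w R' R (- n) x) = (LINT x:(R \<inter> R' \<inter> \<Omega>)|plane_area n c. 0)"
      by (rule set_integral_cong_set)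
         (simp add: C1_trace[OF \<psi> D(1)] C1_trace[OF \<psi> D(2)] upwind_minus)
    then show "face_integral d e (\<lambda>R R' n x. ?w R R' n x + ?w R' R (- n) x) = 0"
      by (simp add: face_integral_def e(1))
  qed
  finally show ?thesis .
qed

text \<open>The projected function \<open>\<phi>\<close> is tied to \<open>\<psi>\<close> only on
  the domain, so the weak form is tested with \<open>\<psi>\<close> and the result is transferred.
  The hypothesis \<open>inv\<close> isolates what makes a function a collision invariant.\<close>

lemma conserved_moment:
  assumes reg: "regular_kernel k rg d \<Lambda>" and sol: "weak_solution k rg d \<Lambda> I f"
    and t: "t \<in> I" "at t within I \<noteq> bot"
    and \<psi>: "\<psi> \<in> Wh k d" "\<psi> \<in> C1 \<Omega>" and \<phi>: "\<And>x. x \<in> \<Omega> \<Longrightarrow> \<phi> x = \<psi> x"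
    and inv: "\<And>p q. p \<in> \<Omega> \<Longrightarrow> q \<in> \<Omega> \<Longrightarrow> Phi_h k rg d \<Lambda> p q *v (grad \<psi> p - grad \<psi> q) = 0"
  shows "((\<lambda>s. ip d (f s) \<phi>) has_real_derivative 0) (at t within I)"
proof -
  have f: "\<And>s. s \<in> I \<Longrightarrow> f s \<in> Wh k d"
    and diff: "\<And>R x. R \<in> T \<Longrightarrow> x \<in> interior R \<Longrightarrow> (\<lambda>s. f s x) differentiable (at t within I)"
    using sol t(1) by (auto simp: weak_solution_def)
  have "ip d (time_deriv I f t) \<psi> + ip d (dgrad k d (f t)) (\<lambda>p. D_h k rg d \<Lambda> (f t) p *v dgrad k d \<psi> p)
     = ip d (\<lambda>p. f t p *\<^sub>R U_h k rg d \<Lambda> (f t) p) (grad \<psi>)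
       - (\<Sum>e\<in>oriented_faces d. face_integral d e (\<lambda>R R' n x.
          upwind (U_h k rg d \<Lambda> (f t) x \<bullet> n) (trace_in R (f t) x) (trace_in R' (f t) x) * trace_in R \<psi> x))"
    using sol t(1) \<psi>(1) unfolding weak_solution_def by blast
  then have "ip d (time_deriv I f t) \<psi> = 0"
    using diffusion_drift_balance[OF reg f[OF t(1)] \<psi> inv] upwind_flux_cancels[OF reg f[OF t(1)] \<psi>] by simp
  moreover have "ip d (f s) \<phi> = ip d (f s) \<psi>" for s
    by (rule ip_cong) (use \<phi> interior_subset_domain in auto)
  ultimately show ?thesis
    using time_derivative_ip(1)[OF f diff t Wh_elementwise_continuous[OF \<psi>(1)]] by simp
qed

lemma l2_balance:
  assumes reg: "regular_kernel k rg d \<Lambda>" and sol: "weak_solution k rg d \<Lambda> I f" and t: "t \<in> I"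
  defines "U \<equiv> U_h k rg d \<Lambda> (f t)"
  shows "ip d (time_deriv I f t) (f t)
      + ip d (dgrad k d (f t)) (\<lambda>p. D_h k rg d \<Lambda> (f t) p *v dgrad k d (f t) p)
      + ip d (\<lambda>p. 1/2 * divergence U p) (\<lambda>p. (f t p)\<^sup>2)
      - Gamma_integral d (\<lambda>R n x. 1/2 * (trace_in R U x \<bullet> n) * (trace_in R (f t) x)\<^sup>2)
    = - (\<Sum>e\<in>interior_faces d. face_integral d e (\<lambda>R R' n x.
        \<bar>U x \<bullet> n\<bar> / 2 * (jump (f t) R R' n x \<bullet> jump (f t) R R' n x)))"
proof -
  define g where "g = f t"
  have g: "g \<in> Wh k d" using sol t by (auto simp: weak_solution_def g_def)
  have U: "elementwise_continuous U" "\<And>R i. R \<in> T \<Longrightarrow> (\<lambda>x. U x $ i) \<in> C1 (interior R)"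
    "\<And>R. R \<in> T \<Longrightarrow> set_integrable lebesgue R (divergence U)"
    "\<And>R x. R \<in> T \<Longrightarrow> x \<in> R \<Longrightarrow> x \<in> \<Omega> \<Longrightarrow> trace_in R U x = U x"
    using U_h_regular[OF reg g] by (simp_all add: U_def g_def)
  have ecg: "elementwise_continuous g" by (rule Wh_elementwise_continuous[OF g])
  note g2 = elementwise_continuous_mult[OF ecg ecg]
  have ecG: "elementwise_continuous (grad g)" by (rule Wh3_elementwise_continuous[OF Wh_grad(2)[OF g]])
  have tr2: "trace_in R (\<lambda>x. g x * g x) x = (trace_in R g x)\<^sup>2" if "R \<in> T" "x \<in> R" for R x
    using g2(2)[OF that] by (simp add: power2_eq_square)
  define q where "q R n x = (trace_in R g x)\<^sup>2 * (trace_in R U x \<bullet> n)" for R n x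
  have qc: "continuous_on R (q R n)" if "R \<in> T" for R n
    unfolding q_def by (intro continuous_intros elementwise_continuousD(1) ecg U(1) that)
  \<comment> \<open>The divergence of the drift is integrable without being bounded, so the product
    is controlled by the boundedness of \<open>g * g\<close> instead of by continuity.\<close>
  have div: "set_integrable lebesgue R (\<lambda>x. (g x * g x) * divergence U x)" if R: "R \<in> T" for R
  proof -
    have "set_integrable lebesgue R (\<lambda>x. indicator inner_region x *\<^sub>R (g x * g x) * divergence U x)"
    proof -
      obtain B where B: "B \<ge> 0" "\<And>x. x \<in> inner_region \<Longrightarrow> norm (g x * g x) \<le> B" using elementwise_bounded[OF g2(1)] by blast
      have "integrable lebesgue (\<lambda>x. (indicator R x *\<^sub>R divergence U x) * (indicator inner_region x *\<^sub>R (g x * g x)))"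
        by (rule integrable_bilinear_bounded[OF bounded_bilinear_mult _ inner_indicator_measurable[OF g2(1)], where B=B])
           (use U(3)[OF R] B in \<open>auto simp: set_integrable_def indicator_def\<close>)
      then show ?thesis by (simp add: set_integrable_def mult_ac)
    qed
    then show ?thesis
      using LINT_element_cong(2)[OF R, of "\<lambda>x. indicator inner_region x *\<^sub>R (g x * g x) * divergence U x" "\<lambda>x. (g x * g x) * divergence U x"]
        interior_subset_inner[OF R] by (simp add: subset_iff)
  qed
  have gU: "set_integrable lebesgue R (\<lambda>x. (g x *\<^sub>R U x) \<bullet> grad g x)" if "R \<in> T" for R
    by (intro elementwise_continuous_integrable[OF _ that] elementwise_continuous_inner elementwise_continuous_scaleR(1) ecg U(1) ecG)
  have grad2: "grad (\<lambda>x. g x * g x) x \<bullet> U x = 2 * ((g x *\<^sub>R U x) \<bullet> grad g x)" if "R \<in> T" "x \<in> interior R" for R x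
  proof -
    have "g differentiable (at x)" using Wh_grad(1)[OF g that(1)] that(2) by (auto simp: C1_def)
    then show ?thesis
      unfolding grad_mult[OF \<open>g differentiable (at x)\<close> \<open>g differentiable (at x)\<close>] inner_add_left inner_scaleR_left
      by (simp only: inner_commute[of "grad g x"] mult_2)
  qed
  have elem: "(LINT x:R|lebesgue. (g x * g x) * divergence U x) + 2 * (LINT x:R|lebesgue. (g x *\<^sub>R U x) \<bullet> grad g x) =
    (\<Sum>(n, c)\<in>facets R. LINT x:(R \<inter> {x. n \<bullet> x = c})|plane_area n c. q R n x)" if R: "R \<in> T" for R
  proof -
    have gU2: "set_integrable lebesgue R (\<lambda>x. 2 * ((g x *\<^sub>R U x) \<bullet> grad g x))"
      using gU[OF R] by simp
    have eq: "(g x * g x) * divergence U x + grad (\<lambda>x. g x * g x) x \<bullet> U x =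
      (g x * g x) * divergence U x + 2 * ((g x *\<^sub>R U x) \<bullet> grad g x)" if "x \<in> interior R" for x
      using grad2[OF R that] by simp
    have "(LINT x:R|lebesgue. (g x * g x) * divergence U x) + 2 * (LINT x:R|lebesgue. (g x *\<^sub>R U x) \<bullet> grad g x) =
      (LINT x:R|lebesgue. (g x * g x) * divergence U x + 2 * ((g x *\<^sub>R U x) \<bullet> grad g x))"
      using set_integral_add(2)[OF div[OF R] gU2] by simp
    also have "\<dots> = (LINT x:R|lebesgue. (g x * g x) * divergence U x + grad (\<lambda>x. g x * g x) x \<bullet> U x)"
      by (rule LINT_element_cong(1)[OF R, symmetric]) (rule eq)
    also have "\<dots> = (\<Sum>(n, c)\<in>facets R. LINT x:(R \<inter> {x. n \<bullet> x = c})|plane_area n c. trace_in R (\<lambda>x. g x * g x) x * (trace_in R U x \<bullet> n))"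
    proof (rule element_integration_by_parts[OF R _ g2(1) U(2)[OF R] U(1)])
      show "(\<lambda>x. g x * g x) \<in> C1 (interior R)" by (rule C1_mult[OF Wh_grad(1)[OF g R] Wh_grad(1)[OF g R]])
      show "set_integrable lebesgue R (\<lambda>x. g x * g x * divergence U x + grad (\<lambda>x. g x * g x) x \<bullet> U x)"
        using LINT_element_cong(2)[OF R eq] set_integral_add(1)[OF div[OF R] gU2] by simp
    qed
    also have "\<dots> = (\<Sum>(n, c)\<in>facets R. LINT x:(R \<inter> {x. n \<bullet> x = c})|plane_area n c. q R n x)"
      by (intro sum.cong refl, clarify, rule set_integral_cong_set) (auto simp: q_def tr2[OF R])
    finally show ?thesis .
  qed
  \<comment> \<open>\<open>Q\<close> is the flux of \<open>g^2 U\<close> through all oriented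
    interfaces, \<open>Z\<close> the drift term of the weak form and \<open>Dv\<close> the
    divergence term. The divergence theorem reads 2 Dv + 2 Z = Q + 2 Gam; eliminating
    \<open>Z\<close> from the weak form leaves \<open>1/2 * Q\<close> minus the upwind sum, which
    lives on interfaces alone.\<close>
  define Q where "Q = (\<Sum>e\<in>oriented_faces d. face_integral d e (\<lambda>R R' n x. q R n x))"
  define Gam where "Gam = Gamma_integral d (\<lambda>R n x. 1/2 * (trace_in R U x \<bullet> n) * (trace_in R g x)\<^sup>2)"
  define Z where "Z = ip d (\<lambda>p. g p *\<^sub>R U p) (grad g)"
  define Dv where "Dv = ip d (\<lambda>p. 1/2 * divergence U p) (\<lambda>p. (g p)\<^sup>2)"
  have Gam2: "Gamma_integral d q = 2 * Gam"
  proof -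
    have "(LINT x:S|M. q R n x) = 2 * (LINT x:S|M. 1/2 * (trace_in R U x \<bullet> n) * (trace_in R g x)\<^sup>2)" for S M R n
      unfolding q_def by (subst set_integral_mult_right[symmetric]) (simp add: mult_ac)
    then show ?thesis by (simp add: Gamma_integral_def Gam_def sum_distrib_left split_beta')
  qed
  have Dv2: "2 * Dv = (\<Sum>R\<in>T. LINT x:R|lebesgue. (g x * g x) * divergence U x)"
    unfolding Dv_def ip_def sum_distrib_left
    by (intro sum.cong refl, subst set_integral_mult_right[symmetric]) (simp add: power2_eq_square mult_ac)
  have "2 * Dv + 2 * Z = (\<Sum>R\<in>T. \<Sum>(n, c)\<in>facets R. LINT x:(R \<inter> {x. n \<bullet> x = c})|plane_area n c. q R n x)"
    unfolding Dv2 Z_def ip_def sum_distrib_left sum.distrib[symmetric] by (intro sum.cong refl elem)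
  also have "\<dots> = Q + Gamma_integral d q"
    unfolding Q_def by (rule boundary_integral_split) (rule qc)
  finally have Zeq: "Z = 1/2 * Q + Gam - Dv" by (simp add: Gam2)
  let ?up = "\<lambda>R R' n x. upwind (U x \<bullet> n) (trace_in R g x) (trace_in R' g x) * trace_in R g x"
  \<comment> \<open>The central flux of the squared trace minus the upwind dissipation, seen from
    one side. It has no sign by itself; only the sum over both sides is the quadratic form of
    \<open>upwind_jump\<close>.\<close>
  define w where "w R R' n x = 1/2 * (U x \<bullet> n * (trace_in R g x)\<^sup>2) - ?up R R' n x" for R R' n x
  have weak: "ip d (time_deriv I f t) g + ip d (dgrad k d g) (\<lambda>p. D_h k rg d \<Lambda> g p *v dgrad k d g p) =
    Z - (\<Sum>e\<in>oriented_faces d. face_integral d e ?up)"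
    using sol t g unfolding weak_solution_def Z_def U_def g_def by blast
  have upI: "set_integrable (plane_area n c) (R \<inter> R' \<inter> \<Omega>) (?up R R' n)"
    if "(R, R', n, c) \<in> oriented_faces d" for R R' n c
    using upwind_integrable[OF that reg g ecg] by (simp add: U_def g_def)
  have qI: "set_integrable (plane_area n c) (R \<inter> R' \<inter> \<Omega>) (\<lambda>x. 1/2 * (U x \<bullet> n * (trace_in R g x)\<^sup>2))"
    if e: "(R, R', n, c) \<in> oriented_faces d" for R R' n c
  proof (rule face_integrable[OF e])
    note D = oriented_facesD[OF e]
    show "continuous_on (R \<inter> R') (\<lambda>x. 1/2 * q R n x)"
      by (intro continuous_intros continuous_on_subset[OF qc[OF D(1)]]) auto
    show "1/2 * (U x \<bullet> n * (trace_in R g x)\<^sup>2) = 1/2 * q R n x" if "x \<in> R \<inter> R' \<inter> \<Omega>" for x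
      using U(4)[OF D(1)] that by (simp add: q_def)
  qed
  have "1/2 * Q - (\<Sum>e\<in>oriented_faces d. face_integral d e ?up) = (\<Sum>e\<in>oriented_faces d. face_integral d e w)"
    unfolding Q_def sum_distrib_left sum_subtractf[symmetric]
  proof (rule sum.cong[OF refl])
    fix e assume "e \<in> oriented_faces d"
    then obtain R R' n c where e: "e = (R, R', n, c)" "(R, R', n, c) \<in> oriented_faces d" by (metis prod.collapse)
    note D = oriented_facesD[OF e(2)]
    have "1/2 * (LINT x:(R \<inter> R' \<inter> \<Omega>)|plane_area n c. q R n x) =
      (LINT x:(R \<inter> R' \<inter> \<Omega>)|plane_area n c. 1/2 * (U x \<bullet> n * (trace_in R g x)\<^sup>2))"
      unfolding set_integral_mult_right[symmetric]
      by (rule set_integral_cong_set) (simp add: q_def U(4)[OF D(1)])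
    then show "1/2 * face_integral d e (\<lambda>R R' n x. q R n x) - face_integral d e ?up = face_integral d e w"
      using set_integral_diff(2)[OF qI[OF e(2)] upI[OF e(2)]]
      by (simp add: face_integral_def e(1) w_def)
  qed
  also have "\<dots> = (\<Sum>e\<in>interior_faces d. face_integral d e (\<lambda>R R' n x. w R R' n x + w R' R (- n) x))"
    by (rule sum_oriented_pairs) (unfold w_def, intro set_integral_diff(1) qI upI)
  also have "\<dots> = (\<Sum>e\<in>interior_faces d. - face_integral d e (\<lambda>R R' n x.
        \<bar>U x \<bullet> n\<bar> / 2 * (jump g R R' n x \<bullet> jump g R R' n x)))"
  proof (rule sum.cong[OF refl])
    fix e assume "e \<in> interior_faces d"
    then obtain R R' n c where e: "e = (R, R', n, c)" "(R, R', n, c) \<in> oriented_faces d"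
      by (auto simp: interior_faces_def)
    have nn: "n \<bullet> n = 1" using oriented_facesD(5)[OF e(2)] by (simp add: dot_square_norm)
    have j: "jump g R R' n x \<bullet> jump g R R' n x = (trace_in R g x - trace_in R' g x)\<^sup>2" for x
    proof -
      have "jump g R R' n x = (trace_in R g x - trace_in R' g x) *\<^sub>R n"
        by (simp add: jump_def scaleR_diff_left)
      then show ?thesis by (simp add: nn power2_eq_square)
    qed
    have "w R R' n x + w R' R (- n) x = - (\<bar>U x \<bullet> n\<bar> / 2 * (jump g R R' n x \<bullet> jump g R R' n x))" for x
      using upwind_jump[of "U x \<bullet> n" "trace_in R g x" "trace_in R' g x"] by (simp add: w_def j)
    then show "face_integral d e (\<lambda>R R' n x. w R R' n x + w R' R (- n) x) =
      - face_integral d e (\<lambda>R R' n x. \<bar>U x \<bullet> n\<bar> / 2 * (jump g R R' n x \<bullet> jump g R R' n x))"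
      by (simp add: face_integral_def e(1) set_lebesgue_integral_def)
  qed
  finally show ?thesis
    using weak Zeq unfolding Dv_def[symmetric, unfolded g_def] Gam_def[symmetric, unfolded g_def]
    by (simp add: g_def sum_negf Dv_def Gam_def)
qed

end

section \<open>Polynomial invariants, time intervals and the final statement\<close>

lemma Qpoly_C1: "P \<in> Qpoly k \<Longrightarrow> P \<in> C1 S"
proof -
  assume "P \<in> Qpoly k"
  then obtain D where D: "\<And>i. (\<lambda>x. D x $ i) \<in> Qpoly k" "\<And>x. (P has_derivative (\<lambda>h. D x \<bullet> h)) (at x)"
    using Qpoly_derivative by blast
  have "grad P = D" using grad_eqI[OF D(2)] by blast
  moreover have "continuous_on S D"
    using continuous_on_vec_lambda[of S "\<lambda>i x. D x $ i"] Qpoly_continuous[OF D(1)] by simp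
  ultimately show ?thesis using D(2) by (auto simp: C1_def differentiable_def)
qed

text \<open>Derivatives within \<open>I\<close> are thereby unique also at an end point of the
  interval, where they are one-sided.\<close>

lemma interval_limpt:
  fixes I :: "real set"
  assumes I: "is_interval I" "interior I \<noteq> {}" and t: "t \<in> I"
  shows "at t within I \<noteq> bot"
proof -
  have "convex I" using I(1) by (simp add: is_interval_convex_1)
  then have "t \<in> closure (interior I)"
    using convex_closure_interior[OF _ I(2)] t closure_subset by blast
  then have "t islimpt interior I"
    by (metis closure_def UnE interior_limit_point islimpt_in_closure mem_Collect_eq interior_interior)
  then have "t islimpt I" by (rule islimpt_subset) (rule interior_subset)
  then show ?thesis by (simp add: trivial_limit_within)
qed

theorem theorem4:
  fixes k :: nat and rg :: regime
    and r :: "(real^3) set \<Rightarrow> real" and F :: "discretization set" and d :: discretization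
    and \<Lambda> :: "real^3 \<Rightarrow> real^3 \<Rightarrow> real"
    and I :: "real set" and f :: "real \<Rightarrow> real^3 \<Rightarrow> real" and t :: real
  assumes "k \<ge> 2"
    and "\<forall>d'\<in>F. admissible k rg d'"
    and "consistent_family k rg r F"
    and "d \<in> F"
    and "regular_kernel k rg d \<Lambda>"
    and "is_interval I" and "interior I \<noteq> {}"
    and "weak_solution k rg d \<Lambda> I f"
    and "t \<in> I"
  shows "((\<lambda>s. ip d (f s) (Proj d (\<lambda>p. 1))) has_real_derivative 0) (at t within I)
    \<and> (\<forall>i. ((\<lambda>s. ip d (f s) (Proj d (\<lambda>p. p $ i))) has_real_derivative 0) (at t within I))
    \<and> ((\<lambda>s. ip d (f s) (Proj d (energy rg))) has_real_derivative 0) (at t within I)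
    \<and> (\<lambda>s. ip d (f s) (f s)) differentiable (at t within I)
    \<and> 1/2 * vector_derivative (\<lambda>s. ip d (f s) (f s)) (at t within I)
        + ip d (dgrad k d (f t)) (\<lambda>p. D_h k rg d \<Lambda> (f t) p *v dgrad k d (f t) p)
        + ip d (\<lambda>p. 1/2 * divergence (U_h k rg d \<Lambda> (f t)) p) (\<lambda>p. (f t p)\<^sup>2)
        - Gamma_integral d (\<lambda>R n x.
            1/2 * (trace_in R (U_h k rg d \<Lambda> (f t)) x \<bullet> n) * (trace_in R (f t) x)\<^sup>2)
      = - (\<Sum>e\<in>interior_faces d. face_integral d e (\<lambda>R R' n x.
            \<bar>U_h k rg d \<Lambda> (f t) x \<bullet> n\<bar> / 2 * (jump (f t) R R' n x \<bullet> jump (f t) R R' n x)))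
    \<and> - (\<Sum>e\<in>interior_faces d. face_integral d e (\<lambda>R R' n x.
            \<bar>U_h k rg d \<Lambda> (f t) x \<bullet> n\<bar> / 2 * (jump (f t) R R' n x \<bullet> jump (f t) R R' n x)))
      \<le> 0"
proof -
  interpret admissible_discretization k rg d
    by unfold_locales (use assms(2,4) in blast)
  note reg = assms(5) and sol = assms(8)
  have t: "t \<in> I" "at t within I \<noteq> bot" using assms(9) interval_limpt[OF assms(6,7)] by auto
  have f: "\<And>s. s \<in> I \<Longrightarrow> f s \<in> Wh k d"
    and diff: "\<And>R x. R \<in> mesh d \<Longrightarrow> x \<in> interior R \<Longrightarrow> (\<lambda>s. f s x) differentiable (at t within I)"
    using sol t(1) by (auto simp: weak_solution_def)
  have mass: "((\<lambda>s. ip d (f s) (Proj d (\<lambda>p. 1))) has_real_derivative 0) (at t within I)"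
  proof (rule conserved_moment[OF reg sol t, of "\<lambda>p. 1"])
    have "grad (\<lambda>p. 1) p = 0" for p by (rule grad_eqI) (auto intro!: derivative_eq_intros)
    then show "Phi_h k rg d \<Lambda> p q *v (grad (\<lambda>p. 1) p - grad (\<lambda>p. 1) q) = 0" for p q by simp
  qed (simp_all add: Wh_of_Qpoly Qpoly_1 Qpoly_C1[OF Qpoly_1] projection_fixes)
  have momentum: "((\<lambda>s. ip d (f s) (Proj d (\<lambda>p. p $ i))) has_real_derivative 0) (at t within I)" for i
  proof (rule conserved_moment[OF reg sol t, of "\<lambda>p. p $ i"])
    have k: "1 \<le> k" using assms(1) by simp
    show W: "(\<lambda>p. p $ i) \<in> Wh k d" by (rule Wh_of_Qpoly[OF Qpoly_coordinate[OF k]])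
    show C: "(\<lambda>p. p $ i) \<in> C1 (Omega d)" by (rule Qpoly_C1[OF Qpoly_coordinate[OF k]])
    show "Proj d (\<lambda>p. p $ i) x = x $ i" if "x \<in> Omega d" for x by (rule projection_fixes[OF W C that])
    have "grad (\<lambda>p::real^3. p $ i) p = axis i 1" for p
      by (rule grad_eqI) (simp add: inner_axis' bounded_linear_imp_has_derivative bounded_linear_vec_nth)
    then show "Phi_h k rg d \<Lambda> p q *v (grad (\<lambda>p. p $ i) p - grad (\<lambda>p. p $ i) q) = 0" for p q by simp
  qed
  have energy: "((\<lambda>s. ip d (f s) (Proj d (energy rg))) has_real_derivative 0) (at t within I)"
  proof (rule conserved_moment[OF reg sol t projected_energy])
    show "Phi_h k rg d \<Lambda> p q *v (grad (Proj d (energy rg)) p - grad (Proj d (energy rg)) q) = 0"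
      if "p \<in> Omega d" "q \<in> Omega d" for p q
      unfolding Phi_h_apply using that by (simp add: dgrad_C1[OF projected_energy] coll_tensor_null)
  qed simp
  have der: "((\<lambda>s. ip d (f s) (f s)) has_real_derivative 2 * ip d (time_deriv I f t) (f t)) (at t within I)"
    by (rule time_derivative_ip(2)[OF f diff t])
  then have dif: "(\<lambda>s. ip d (f s) (f s)) differentiable (at t within I)"
    using real_differentiable_def by blast
  have "vector_derivative (\<lambda>s. ip d (f s) (f s)) (at t within I) = 2 * ip d (time_deriv I f t) (f t)"
    using der by (intro vector_derivative_within t(2)) (simp add: has_real_derivative_iff_has_vector_derivative)
  then have half: "1/2 * vector_derivative (\<lambda>s. ip d (f s) (f s)) (at t within I) = ip d (time_deriv I f t) (f t)"
    by simp
  have "0 \<le> (\<Sum>e\<in>interior_faces d. face_integral d e (\<lambda>R R' n x.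
            \<bar>U_h k rg d \<Lambda> (f t) x \<bullet> n\<bar> / 2 * (jump (f t) R R' n x \<bullet> jump (f t) R R' n x)))"
    unfolding face_integral_def set_lebesgue_integral_def
    by (intro sum_nonneg) (auto intro!: integral_nonneg_AE split: prod.splits)
  then show ?thesis
    unfolding half using mass momentum energy dif l2_balance[OF reg sol t(1)] by simp
qed

end
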